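(* Let $G$ be a group acting by automorphisms of a group $V$, let $\Gamma$ be a subgroup of $G$ leaving a subgroup $V_0$ of $V$ invariant, and suppose that $(V\rtimes G,V_0\rtimes\Gamma)$ is a Hecke pair which is reduced. Denote by $\bar V$ and $\bar V_0$ the closures of $V$ and $V_0$ in the Schlichting completion of $(V\rtimes G,V_0)$, and suppose that $(\tilde G,\tilde\Gamma)$ and $\tilde\rho:G\to\tilde G$ form a completion of $(G,\Gamma)$. (i) The map $\rho(g):=(\operatorname{Ad}g,\tilde\rho(g))$ is a homomorphism from $G$ into $\operatorname{HAut}(\bar V)\times\tilde G$, and the closures $\bar G:=\overline{\rho(G)}$ and $\bar\Gamma:=\overline{\rho(\Gamma)}$ satisfy that $(\bar V\rtimes\bar G,\bar V_0\rtimes\bar\Gamma)$ is a completion of $(V\rtimes G,V_0\rtimes\Gamma)$ together with the map $\iota:V\rtimes G\to\bar V\rtimes\bar G$ given by $\iota(v,g)=(v,\rho(g))$. (ii) Let $(\overline{V\rtimes G},\overline{V_0\rtimes\Gamma})$ be the Schlichting completion of $(V\rtimes G,V_0\rtimes\Gamma)$. If $(\tilde G,\tilde\Gamma)$ is the Schlichting completion of $(G,\Gamma)$ and for every $v\in V$ there is a finite set $\{g_1,\dots,g_n\}$ in $G$ such that $\bigcap_{i=1}^n g_i(V_0)\subset vV_0v^{-1}$, then $\iota$ extends to a topological isomorphism of $\overline{V\rtimes G}$ onto $\bar V\rtimes\bar G$ and of $\overline{V_0\rtimes\Gamma}$ onto $\bar V_0\rtimes\bar\Gamma$.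
   Context: A pair $(N,N_0)$ of a group and a subgroup is a Hecke pair if $[N_0:N_0\cap xN_0x^{-1}]<\infty$ for all $x\in N$, and is reduced if $\bigcap_{x\in N}xN_0x^{-1}=\{e\}$. A pair $(\bar N,\bar N_0)$ and a homomorphism $\rho:N\to\bar N$ form a completion of $(N,N_0)$ if $\bar N$ is a locally compact group, $\bar N_0$ is a compact open subgroup, $\rho(N)$ is dense in $\bar N$, $\rho(N_0)$ is dense in $\bar N_0$, and $\rho^{-1}(\bar N_0)=N_0$. The Schlichting completion of $(N,N_0)$ is the pair $(\bar N,\bar N_0)$ with a homomorphism $\phi:N\to\bar N$ characterized uniquely by: $\bar N$ is locally compact totally disconnected, $\bar N_0$ is a compact open subgroup, $(\bar N,\bar N_0)$ is reduced, $\phi(N)$ is dense in $\bar N$, and $\phi^{-1}(\bar N_0)=N_0$. If $(N,N_0)$ is reduced then $\phi$ is injective and $N$ is identified with $\phi(N)$. If $(V\rtimes G,V_0\rtimes\Gamma)$ is a reduced Hecke pair then $(V\rtimes G,V_0)$ is also a reduced Hecke pair. $\operatorname{HAut}(\bar V)$ is the group of homeomorphic group automorphisms of the locally compact group $\bar V$, a topological group with neighbourhood base at the identity given by the sets $\{\beta:\beta(u)\in Uu\text{ and }\beta^{-1}(u)\in Uu\text{ for all }u\in K\}$, for $K\subset\bar V$ compact and $U$ a neighbourhood of $e$ in $\bar V$. $\operatorname{Ad}g\in\operatorname{HAut}(\bar V)$ denotes conjugation by $g$ (in the Schlichting completion of $(V\rtimes G,V_0)$) restricted to $\bar V$, i.e.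 the continuous extension to $\bar V$ of the action of $g$ on $V$. The closures $\bar G$, $\bar\Gamma$ are taken in $\operatorname{HAut}(\bar V)\times\tilde G$, and $\bar G$ acts on $\bar V$ through the projection onto $\operatorname{HAut}(\bar V)$. Semidirect products: $(v,g)(w,h)=(v\,g(w),gh)$. *)

theory Defs
  imports "HOL-Analysis.Analysis" "HOL-Algebra.Coset" "HOL-Algebra.Bij"
begin

text \<open>Groups are carrier-based records of HOL-Algebra; a topology on a group is a separate
  abstract topology whose underlying space is the carrier.\<close>

definition topological_group :: "('a, 'm) monoid_scheme \<Rightarrow> 'a topology \<Rightarrow> bool" where
  "topological_group G T \<longleftrightarrow>
     group G \<and> topspace T = carrier G \<and>
     continuous_map (prod_topology T T) T (\<lambda>(x, y). x \<otimes>\<^bsub>G\<^esub> y) \<and>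
     continuous_map T T (\<lambda>x. inv\<^bsub>G\<^esub> x)"

text \<open>As usual, locally compact groups are Hausdorff.\<close>

definition locally_compact_group :: "('a, 'm) monoid_scheme \<Rightarrow> 'a topology \<Rightarrow> bool" where
  "locally_compact_group G T \<longleftrightarrow>
     topological_group G T \<and> locally_compact_space T \<and> Hausdorff_space T"

definition totally_disconnected :: "'a topology \<Rightarrow> bool" where
  "totally_disconnected T \<longleftrightarrow> (\<forall>x\<in>topspace T. connected_component_of_set T x = {x})"

definition topological_iso ::
  "('a, 'm) monoid_scheme \<Rightarrow> 'a topology \<Rightarrow> ('b, 'n) monoid_scheme \<Rightarrow> 'b topology
    \<Rightarrow> ('a \<Rightarrow> 'b) \<Rightarrow> bool" where
  "topological_iso G S H T f \<longleftrightarrow> f \<in> iso G H \<and> homeomorphic_map S T f"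

definition conjugate :: "('a, 'm) monoid_scheme \<Rightarrow> 'a \<Rightarrow> 'a set \<Rightarrow> 'a set" where
  "conjugate N x H = (x <#\<^bsub>N\<^esub> H) #>\<^bsub>N\<^esub> (inv\<^bsub>N\<^esub> x)"

definition hecke_pair :: "('a, 'm) monoid_scheme \<Rightarrow> 'a set \<Rightarrow> bool" where
  "hecke_pair N N0 \<longleftrightarrow>
     group N \<and> subgroup N0 N \<and>
     (\<forall>x\<in>carrier N. finite (rcosets\<^bsub>N\<lparr>carrier := N0\<rparr>\<^esub> (N0 \<inter> conjugate N x N0)))"

definition reduced_pair :: "('a, 'm) monoid_scheme \<Rightarrow> 'a set \<Rightarrow> bool" where
  "reduced_pair N N0 \<longleftrightarrow> (\<Inter>x\<in>carrier N. conjugate N x N0) = {\<one>\<^bsub>N\<^esub>}"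

definition is_completion ::
  "('a, 'm) monoid_scheme \<Rightarrow> 'a set \<Rightarrow> ('b, 'n) monoid_scheme \<Rightarrow> 'b topology \<Rightarrow> 'b set
    \<Rightarrow> ('a \<Rightarrow> 'b) \<Rightarrow> bool" where
  "is_completion N N0 M T M0 \<rho> \<longleftrightarrow>
     locally_compact_group M T \<and>
     subgroup M0 M \<and> compactin T M0 \<and> openin T M0 \<and>
     \<rho> \<in> hom N M \<and>
     T closure_of (\<rho> ` carrier N) = carrier M \<and>
     \<rho> ` N0 \<subseteq> M0 \<and> subtopology T M0 closure_of (\<rho> ` N0) = M0 \<and>
     {x \<in> carrier N. \<rho> x \<in> M0} = N0"

text \<open>The properties that determine the Schlichting completion up to unique isomorphism.\<close>

definition is_schlichting_completion ::
  "('a, 'm) monoid_scheme \<Rightarrow> 'a set \<Rightarrow> ('b, 'n) monoid_scheme \<Rightarrow> 'b topology \<Rightarrow> 'b set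
    \<Rightarrow> ('a \<Rightarrow> 'b) \<Rightarrow> bool" where
  "is_schlichting_completion N N0 M T M0 \<phi> \<longleftrightarrow>
     locally_compact_group M T \<and> totally_disconnected T \<and>
     subgroup M0 M \<and> compactin T M0 \<and> openin T M0 \<and>
     reduced_pair M M0 \<and>
     \<phi> \<in> hom N M \<and>
     T closure_of (\<phi> ` carrier N) = carrier M \<and>
     {x \<in> carrier N. \<phi> x \<in> M0} = N0"

definition semidirect ::
  "('v, 'm) monoid_scheme \<Rightarrow> ('g, 'n) monoid_scheme \<Rightarrow> ('g \<Rightarrow> 'v \<Rightarrow> 'v) \<Rightarrow> ('v \<times> 'g) monoid" where
  "semidirect V G \<alpha> =
     \<lparr>carrier = carrier V \<times> carrier G,
      mult = (\<lambda>(v, g) (w, h). (v \<otimes>\<^bsub>V\<^esub> \<alpha> g w, g \<otimes>\<^bsub>G\<^esub> h)),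
      one = (\<one>\<^bsub>V\<^esub>, \<one>\<^bsub>G\<^esub>)\<rparr>"

definition HAut :: "('v, 'm) monoid_scheme \<Rightarrow> 'v topology \<Rightarrow> ('v \<Rightarrow> 'v) monoid" where
  "HAut V T = (AutoGroup V)\<lparr>carrier := {\<beta> \<in> auto V. homeomorphic_map T T \<beta>}\<rparr>"

definition HAut_nhd ::
  "('v, 'm) monoid_scheme \<Rightarrow> 'v topology \<Rightarrow> 'v set \<Rightarrow> 'v set \<Rightarrow> ('v \<Rightarrow> 'v) set" where
  "HAut_nhd V T K U =
     {\<beta> \<in> carrier (HAut V T).
        \<forall>u\<in>K. \<beta> u \<in> U #>\<^bsub>V\<^esub> u \<and> inv_into (carrier V) \<beta> u \<in> U #>\<^bsub>V\<^esub> u}"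

text \<open>The group topology on \<open>HAut V T\<close> in which the sets \<open>HAut_nhd V T K U\<close> (\<open>K\<close> compact,
  \<open>U\<close> an open neighbourhood of the identity) form a neighbourhood base at the identity: a set is
  open iff it contains a translate \<open>HAut_nhd V T K U \<cdot> \<beta>\<close> for each of its elements \<open>\<beta>\<close>.\<close>

definition HAut_open :: "('v, 'm) monoid_scheme \<Rightarrow> 'v topology \<Rightarrow> ('v \<Rightarrow> 'v) set \<Rightarrow> bool" where
  "HAut_open V T S \<longleftrightarrow>
     S \<subseteq> carrier (HAut V T) \<and>
     (\<forall>\<beta>\<in>S. \<exists>K U. compactin T K \<and> openin T U \<and> \<one>\<^bsub>V\<^esub> \<in> U \<and>
        HAut_nhd V T K U #>\<^bsub>HAut V T\<^esub> \<beta> \<subseteq> S)"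

definition HAut_topology :: "('v, 'm) monoid_scheme \<Rightarrow> 'v topology \<Rightarrow> ('v \<Rightarrow> 'v) topology" where
  "HAut_topology V T = topology (HAut_open V T)"

lemma istopology_HAut_open: "istopology (HAut_open V T)"
  unfolding istopology_def
proof (intro conjI allI impI)
  fix S S' assume S: "HAut_open V T S" and S': "HAut_open V T S'"
  show "HAut_open V T (S \<inter> S')"
    unfolding HAut_open_def
  proof (intro conjI ballI)
    show "S \<inter> S' \<subseteq> carrier (HAut V T)"
      using S by (auto simp: HAut_open_def)
    fix \<beta> assume \<beta>: "\<beta> \<in> S \<inter> S'"
    obtain K U where 1: "compactin T K" "openin T U" "\<one>\<^bsub>V\<^esub> \<in> U"
        "HAut_nhd V T K U #>\<^bsub>HAut V T\<^esub> \<beta> \<subseteq> S"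
      using S \<beta> unfolding HAut_open_def by blast
    obtain K' U' where 2: "compactin T K'" "openin T U'" "\<one>\<^bsub>V\<^esub> \<in> U'"
        "HAut_nhd V T K' U' #>\<^bsub>HAut V T\<^esub> \<beta> \<subseteq> S'"
      using S' \<beta> unfolding HAut_open_def by blast
    have "HAut_nhd V T (K \<union> K') (U \<inter> U') \<subseteq> HAut_nhd V T K U \<inter> HAut_nhd V T K' U'"
      by (auto simp: HAut_nhd_def r_coset_def)
    hence "HAut_nhd V T (K \<union> K') (U \<inter> U') #>\<^bsub>HAut V T\<^esub> \<beta> \<subseteq> S \<inter> S'"
      using 1(4) 2(4) unfolding r_coset_def by blast
    thus "\<exists>K U. compactin T K \<and> openin T U \<and> \<one>\<^bsub>V\<^esub> \<in> U \<and>
        HAut_nhd V T K U #>\<^bsub>HAut V T\<^esub> \<beta> \<subseteq> S \<inter> S'"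
      using 1 2 by (intro exI[of _ "K \<union> K'"] exI[of _ "U \<inter> U'"]) (auto intro: compactin_Un)
  qed
next
  fix \<S> assume *: "\<forall>S\<in>\<S>. HAut_open V T S"
  show "HAut_open V T (\<Union>\<S>)"
    unfolding HAut_open_def
  proof (intro conjI ballI)
    show "\<Union>\<S> \<subseteq> carrier (HAut V T)"
      using * by (auto simp: HAut_open_def)
    fix \<beta> assume "\<beta> \<in> \<Union>\<S>"
    then obtain S where S: "S \<in> \<S>" "\<beta> \<in> S" by blast
    have "HAut_open V T S" using * S(1) by blast
    then obtain K U where KU: "compactin T K" "openin T U" "\<one>\<^bsub>V\<^esub> \<in> U"
        "HAut_nhd V T K U #>\<^bsub>HAut V T\<^esub> \<beta> \<subseteq> S"
      using S(2) unfolding HAut_open_def by blast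
    have "HAut_nhd V T K U #>\<^bsub>HAut V T\<^esub> \<beta> \<subseteq> \<Union>\<S>"
      by (rule subset_trans[OF KU(4) Union_upper[OF S(1)]])
    with KU show "\<exists>K U. compactin T K \<and> openin T U \<and> \<one>\<^bsub>V\<^esub> \<in> U \<and>
        HAut_nhd V T K U #>\<^bsub>HAut V T\<^esub> \<beta> \<subseteq> \<Union>\<S>"
      by (intro exI conjI)
  qed
qed

lemma openin_HAut_topology: "openin (HAut_topology V T) S \<longleftrightarrow> HAut_open V T S"
  by (simp add: HAut_topology_def istopology_HAut_open topology_inverse')

text \<open>Conjugation by \<open>x\<close> in \<open>W\<close> restricted to \<open>S\<close>, as an extensional function.\<close>

definition Ad :: "('a, 'm) monoid_scheme \<Rightarrow> 'a set \<Rightarrow> 'a \<Rightarrow> 'a \<Rightarrow> 'a" where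
  "Ad W S x = (\<lambda>y\<in>S. x \<otimes>\<^bsub>W\<^esub> y \<otimes>\<^bsub>W\<^esub> inv\<^bsub>W\<^esub> x)"

end

theory Submission
  imports Defs
begin

text \<open>Let \<open>N\<close> denote the semidirect product of \<open>V\<close> and \<open>G\<close>, and put \<open>N0 = V0 \<times> \<Gamma>\<close>.

  The topology of a Schlichting completion can be read off from the group that it completes.
  If \<open>H\<close> is a compact open subgroup of a Hausdorff group and the conjugates of \<open>H\<close> meet only in the
  identity, then, by compactness of \<open>H\<close>, the finite intersections of these conjugates form a
  neighbourhood base at the identity (\<open>nhd_base_conjugates\<close>), and conjugates by the elements of a
  dense subgroup suffice. So the completion \<open>W\<close> of \<open>(N, V0)\<close> has a base of compact open
  subgroups that are finite intersections of conjugates of \<open>W0\<close>, and \<open>W0\<close> is the closure of \<open>V0\<close>.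

  The heart of (i) is that the closure of \<open>\<rho>(\<Gamma>)\<close> is compact. The Hecke condition says that the orbits of
  \<open>N0\<close> on its left cosets in \<open>N\<close> are finite. Since \<open>N0\<close> normalizes \<open>W0\<close>, conjugation by \<open>\<Gamma>\<close> moves a
  given conjugate of \<open>W0\<close> to only finitely many subgroups. Intersecting these shows that the
  \<open>\<Gamma>\<close>-invariant compact open subgroups still form a base (\<open>invariant_subgroup\<close>): \<open>\<Gamma>\<close> acts
  equicontinuously on the closure \<open>B\<close> of \<open>V\<close>. In the same way a \<open>\<Gamma>\<close>-orbit in \<open>B\<close> meets only finitely many cosets of
  \<open>W0\<close> and lies in a compact set (\<open>orbit_in_compact\<close>). An argument in the style of the Ascoli
  theorem now applies (\<open>compactin_closure_S\<close>): by the Tychonoff theorem the pairs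
  \<open>(\<beta>, \<beta>\<^sup>-\<^sup>1)\<close> with \<open>\<beta>\<close> in the image of \<open>\<Gamma>\<close> have compact closure in a product of copies of \<open>B\<close>, and
  equicontinuity makes every limit a pair of mutually inverse homeomorphic automorphisms and
  makes pointwise convergence imply convergence in the automorphism group. Moreover the closure of
  \<open>\<rho>(\<Gamma>)\<close> is open in the closure of \<open>\<rho>(G)\<close>, being the part that lies over the open subgroup \<open>\<Gamma>t\<close>
  (\<open>\<Gamma>b_eq\<close>). The semidirect product is a topological group because evaluation of automorphisms is
  jointly continuous, and the remaining properties of a completion are density statements.

  For (ii), two reduced completions in which the same subgroup is the preimage of the compact open
  subgroup are isomorphic: the closure of the set of pairs \<open>(\<phi> n, \<phi>' n)\<close> is the graph of an
  isomorphism (\<open>completion_extends\<close>, \<open>reduced_completion_unique\<close>). It remains to show that the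
  conjugates of \<open>W0 \<times> \<Gamma>b\<close>, where \<open>\<Gamma>b\<close> is the closure of \<open>\<rho>(\<Gamma>)\<close>, meet trivially (\<open>reduced_P\<close>). If \<open>(u, b)\<close> lies in all of them,
  then the component of \<open>b\<close> in the completion of \<open>G\<close> is trivial because that completion is reduced, and \<open>u\<close> lies in
  \<open>g(W0)\<close> for every \<open>g\<close>. Passed to closures, the condition on finite sets puts such a \<open>u\<close> into all
  conjugates of \<open>W0\<close>, whence \<open>u = e\<close> (\<open>conjugates_by_G_trivial\<close>). The same reasoning applied to the conjugate of \<open>(u, b)\<close> by
  \<open>v \<in> V\<close> shows that \<open>b\<close> fixes \<open>v\<close>, so \<open>b\<close> acts trivially on the closure of \<open>V\<close>.\<close>

section \<open>Conjugates and cosets in groups\<close>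

lemma (in group) inv_cancel_left [simp]:
  assumes "x \<in> carrier G" "y \<in> carrier G"
  shows "x \<otimes> (inv x \<otimes> y) = y" "inv x \<otimes> (x \<otimes> y) = y"
  using assms by (simp_all flip: m_assoc)

lemma (in group) mem_conjugate_iff:
  assumes "x \<in> carrier G" "H \<subseteq> carrier G"
  shows "y \<in> conjugate G x H \<longleftrightarrow> y \<in> carrier G \<and> inv x \<otimes> y \<otimes> x \<in> H"
proof
  assume "y \<in> conjugate G x H"
  then obtain h where "h \<in> H" "y = x \<otimes> h \<otimes> inv x"
    by (auto simp: conjugate_def l_coset_def r_coset_def)
  then show "y \<in> carrier G \<and> inv x \<otimes> y \<otimes> x \<in> H"
    using assms by (auto simp: m_assoc subset_eq)
next
  assume *: "y \<in> carrier G \<and> inv x \<otimes> y \<otimes> x \<in> H"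
  then have "y = x \<otimes> (inv x \<otimes> y \<otimes> x) \<otimes> inv x"
    using assms by (simp add: m_assoc)
  with * show "y \<in> conjugate G x H"
    by (auto simp: conjugate_def l_coset_def r_coset_def)
qed

lemma (in group) conjugate_eq_Collect:
  assumes "x \<in> carrier G" "H \<subseteq> carrier G"
  shows "conjugate G x H = {y \<in> carrier G. inv x \<otimes> y \<otimes> x \<in> H}"
  using mem_conjugate_iff[OF assms] by auto

lemma (in group) conjugate_eq_image:
  "conjugate G x H = (\<lambda>h. x \<otimes> h \<otimes> inv x) ` H"
  by (auto simp: conjugate_def l_coset_def r_coset_def)

lemma (in group) subgroup_conjugate:
  assumes "x \<in> carrier G" "subgroup H G"
  shows "subgroup (conjugate G x H) G"
proof (rule subgroupI)
  note H = subgroup.subset[OF assms(2)]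
  show "conjugate G x H \<subseteq> carrier G"
    using assms H by (auto simp: mem_conjugate_iff)
  show "conjugate G x H \<noteq> {}"
    using subgroup.one_closed[OF assms(2)] by (auto simp: conjugate_eq_image)
  fix a assume a: "a \<in> conjugate G x H"
  have "inv (inv x \<otimes> a \<otimes> x) \<in> H"
    using a assms H by (simp add: mem_conjugate_iff subgroup.m_inv_closed)
  then show "inv a \<in> conjugate G x H"
    using a assms H by (simp add: mem_conjugate_iff inv_mult_group m_assoc)
  fix b assume b: "b \<in> conjugate G x H"
  have "(inv x \<otimes> a \<otimes> x) \<otimes> (inv x \<otimes> b \<otimes> x) \<in> H"
    using a b assms H by (auto simp: mem_conjugate_iff intro!: subgroup.m_closed)
  then show "a \<otimes> b \<in> conjugate G x H"
    using a b assms H by (simp add: mem_conjugate_iff m_assoc)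
qed

lemma (in group) conjugate_mult:
  assumes "x \<in> carrier G" "y \<in> carrier G" "H \<subseteq> carrier G"
  shows "conjugate G x (conjugate G y H) = conjugate G (x \<otimes> y) H"
proof -
  have "conjugate G y H \<subseteq> carrier G"
    using assms by (auto simp: mem_conjugate_iff)
  then show ?thesis
    using assms by (auto simp: mem_conjugate_iff inv_mult_group m_assoc)
qed

lemma (in group) conjugate_subgroup_self:
  assumes "subgroup H G" "h \<in> H"
  shows "conjugate G h H = H"
proof -
  interpret H: subgroup H G by fact
  have "inv h \<otimes> y \<otimes> h \<in> H \<longleftrightarrow> y \<in> H" if "y \<in> carrier G" for y
  proof
    assume "inv h \<otimes> y \<otimes> h \<in> H"
    then have "h \<otimes> (inv h \<otimes> y \<otimes> h) \<otimes> inv h \<in> H"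
      using assms(2) by simp
    then show "y \<in> H" using that assms(2) by (simp add: m_assoc)
  qed (use assms(2) in simp)
  then show ?thesis using assms(2) H.subset by (auto simp: mem_conjugate_iff)
qed

lemma (in group) conjugate_coset:
  assumes "x \<in> carrier G" "subgroup H G" "h \<in> H"
  shows "conjugate G (x \<otimes> h) H = conjugate G x H"
  using assms conjugate_subgroup_self[of H h] conjugate_mult[of x h H] subgroup.subset[of H G]
  by auto

lemma (in group) mem_r_coset_iff:
  assumes "U \<subseteq> carrier G" "x \<in> carrier G"
  shows "y \<in> U #> x \<longleftrightarrow> y \<in> carrier G \<and> y \<otimes> inv x \<in> U"
proof
  assume "y \<in> U #> x"
  then show "y \<in> carrier G \<and> y \<otimes> inv x \<in> U"
    using assms by (auto simp: r_coset_def m_assoc subset_eq)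
next
  assume "y \<in> carrier G \<and> y \<otimes> inv x \<in> U"
  moreover from this have "y = y \<otimes> inv x \<otimes> x" using assms by (simp add: m_assoc)
  ultimately show "y \<in> U #> x" by (auto simp: r_coset_def)
qed

lemma (in group) subgroup_INT:
  assumes "I \<noteq> {}" "\<And>i. i \<in> I \<Longrightarrow> subgroup (H i) G"
  shows "subgroup (\<Inter>i\<in>I. H i) G"
proof (rule subgroupI)
  show "(\<Inter>i\<in>I. H i) \<subseteq> carrier G" using assms subgroup.subset by blast
  show "(\<Inter>i\<in>I. H i) \<noteq> {}" using assms subgroup.one_closed by blast
qed (use assms in \<open>auto intro: subgroup.m_closed subgroup.m_inv_closed\<close>)

lemma (in group) l_coset_mult_subgroup:
  assumes "subgroup H G" "x \<in> carrier G" "h \<in> H"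
  shows "(x \<otimes> h) <# H = x <# H"
proof -
  have h: "h \<in> carrier G" and H: "H \<subseteq> carrier G" using assms subgroup.subset by auto
  show ?thesis
    using lcos_m_assoc[OF H assms(2) h] coset_join3[OF h assms(1,3)] by simp
qed

section \<open>Topological groups\<close>

locale top_group = group M for M (structure) +
  fixes T
  assumes topological_group: "topological_group M T"
begin

lemma topspace [simp]: "topspace T = carrier M"
  using topological_group by (simp add: topological_group_def)

lemma continuous_map_mult [continuous_intros]:
  assumes "continuous_map X T f" "continuous_map X T g"
  shows "continuous_map X T (\<lambda>x. f x \<otimes> g x)"
  using continuous_map_compose[OF continuous_map_pairedI[OF assms]] topological_group
  by (force simp: topological_group_def o_def)

lemma continuous_map_inv [continuous_intros]:
  assumes "continuous_map X T f"
  shows "continuous_map X T (\<lambda>x. inv (f x))"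
  using continuous_map_compose[OF assms] topological_group
  by (force simp: topological_group_def o_def)

lemma open_preimage:
  assumes "continuous_map T T f" "openin T U"
  shows "openin T {y \<in> carrier M. f y \<in> U}"
  using openin_continuous_map_preimage[OF assms] by simp

lemma openin_r_coset:
  assumes "openin T U" "x \<in> carrier M"
  shows "openin T (U #> x)"
proof -
  have "U #> x = {y \<in> carrier M. y \<otimes> inv x \<in> U}"
    using mem_r_coset_iff[of U x] openin_subset[OF assms(1)] assms(2) by auto
  then show ?thesis
    using assms by (auto intro!: open_preimage continuous_intros)
qed

lemma openin_conjugate:
  assumes "openin T U" "x \<in> carrier M"
  shows "openin T (conjugate M x U)"
  using assms openin_subset[OF assms(1)]
  by (auto simp: conjugate_eq_Collect intro!: open_preimage continuous_intros)

lemma compactin_conjugate: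
  assumes "compactin T K" "x \<in> carrier M"
  shows "compactin T (conjugate M x K)"
  unfolding conjugate_eq_image
  using assms by (intro image_compactin) (auto intro!: continuous_intros)

lemma compactin_set_mult:
  assumes "compactin T K" "compactin T L"
  shows "compactin T (K <#> L)"
proof -
  have "K <#> L = (\<lambda>p. fst p \<otimes> snd p) ` (K \<times> L)"
    by (force simp: set_mult_def)
  moreover have "compactin (prod_topology T T) (K \<times> L)"
    using assms by (simp add: compactin_Times)
  ultimately show ?thesis
    by (auto intro!: image_compactin continuous_intros)
qed

text \<open>Every point of the closure of \<open>D\<close> is a product of an element of \<open>D\<close> and one of a prescribed
  neighbourhood of the identity, since \<open>y \<mapsto> y\<^sup>-\<^sup>1 x\<close> is continuous and takes the value \<open>\<one>\<close> at \<open>x\<close>.\<close>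

lemma closure_coset_meets:
  assumes "x \<in> T closure_of D" "openin T U" "\<one> \<in> U"
  obtains d where "d \<in> D" "d \<in> carrier M" "inv d \<otimes> x \<in> U"
proof -
  have x: "x \<in> carrier M" using subsetD[OF closure_of_subset_topspace assms(1)] by simp
  then have "openin T {y \<in> carrier M. inv y \<otimes> x \<in> U}"
    using assms by (auto intro!: open_preimage continuous_intros)
  moreover have "x \<in> {y \<in> carrier M. inv y \<otimes> x \<in> U}"
    using assms x by simp
  ultimately obtain d where "d \<in> D" "d \<in> {y \<in> carrier M. inv y \<otimes> x \<in> U}"
    using assms(1) by (meson in_closure_of)
  then show ?thesis using that by blast
qed

lemma closure_conjugate:
  assumes "x \<in> carrier M" "\<And>s. s \<in> D \<Longrightarrow> x \<otimes> s \<otimes> inv x \<in> D'" "u \<in> T closure_of D"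
  shows "x \<otimes> u \<otimes> inv x \<in> T closure_of D'"
proof -
  have "continuous_map T T (\<lambda>u. x \<otimes> u \<otimes> inv x)"
    using assms(1) by (intro continuous_map_mult) auto
  from continuous_map_image_closure_subset[OF this, of D]
  have "x \<otimes> u \<otimes> inv x \<in> T closure_of ((\<lambda>u. x \<otimes> u \<otimes> inv x) ` D)" using assms(3) by blast
  then show ?thesis using closure_of_mono[of "(\<lambda>u. x \<otimes> u \<otimes> inv x) ` D" D' T] assms(2) by blast
qed

lemma subgroup_closure:
  assumes "subgroup H M"
  shows "subgroup (T closure_of H) M"
proof (rule subgroupI)
  interpret H: subgroup H M by fact
  have H: "H \<subseteq> T closure_of H" by (simp add: closure_of_subset H.subset)
  show "T closure_of H \<subseteq> carrier M" using closure_of_subset_topspace by force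
  show "T closure_of H \<noteq> {}" using H H.one_closed by blast
  have "continuous_map T T (\<lambda>x. inv x)" by (intro continuous_intros)
  from continuous_map_image_closure_subset[OF this, of H]
  have "(\<lambda>x. inv x) ` (T closure_of H) \<subseteq> T closure_of H"
    using closure_of_mono[of "(\<lambda>x. inv x) ` H" H T] by fastforce
  then show "inv a \<in> T closure_of H" if "a \<in> T closure_of H" for a using that by blast
  have "continuous_map (prod_topology T T) T (\<lambda>p. fst p \<otimes> snd p)" 
    by (intro continuous_intros)
  from continuous_map_image_closure_subset[OF this, of "H \<times> H"]
  have "(\<lambda>p. fst p \<otimes> snd p) ` ((T closure_of H) \<times> (T closure_of H)) \<subseteq> T closure_of H"
    using closure_of_mono[of "(\<lambda>p. fst p \<otimes> snd p) ` (H \<times> H)" H T] 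
    by (fastforce simp: closure_of_Times)
  then show "a \<otimes> b \<in> T closure_of H" if "a \<in> T closure_of H" "b \<in> T closure_of H" for a b
    using that by force
qed

lemma top_group_subgroup:
  assumes "subgroup H M"
  shows "top_group (M\<lparr>carrier := H\<rparr>) (subtopology T H)"
proof -
  interpret H: subgroup H M by fact
  have g: "group (M\<lparr>carrier := H\<rparr>)" by (rule subgroup_imp_group[OF assms])
  have "continuous_map (subtopology T H) (subtopology T H) (\<lambda>x. inv\<^bsub>M\<lparr>carrier := H\<rparr>\<^esub> x)"
  proof (rule continuous_map_eq)
    show "continuous_map (subtopology T H) (subtopology T H) (\<lambda>x. inv x)"
      unfolding continuous_map_in_subtopology
      by (auto intro!: continuous_intros)
  qed (use assms in simp)
  moreover have "continuous_map (prod_topology (subtopology T H) (subtopology T H)) (subtopology T H) 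
      (\<lambda>p. fst p \<otimes> snd p)"
    unfolding continuous_map_in_subtopology
    by (intro conjI continuous_intros continuous_map_of_fst continuous_map_of_snd) 
       (auto intro!: continuous_map_into_fulltopology[OF continuous_map_fst] 
         continuous_map_into_fulltopology[OF continuous_map_snd])
  ultimately show ?thesis
    using g H.subset
    by (auto simp: top_group_def top_group_axioms_def topological_group_def case_prod_unfold)
qed

text \<open>A homomorphism is continuous as soon as it is so at the identity: near \<open>x\<close> one writes
  \<open>f z = f (z x\<^sup>-\<^sup>1) f x\<close>.\<close>

lemma continuous_hom:
  assumes "top_group M' T'" "f \<in> hom M M'"
    and nhd: "\<And>Q. openin T' Q \<Longrightarrow> \<one>\<^bsub>M'\<^esub> \<in> Q \<Longrightarrow> \<exists>U. openin T U \<and> \<one> \<in> U \<and> f ` U \<subseteq> Q"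
  shows "continuous_map T T' f"
proof -
  interpret M': top_group M' T' by fact
  interpret f: group_hom M M' f by unfold_locales fact
  have "\<exists>S. openin T S \<and> x \<in> S \<and> S \<subseteq> {x \<in> topspace T. f x \<in> Q}"
    if Q: "openin T' Q" and x: "x \<in> topspace T" "f x \<in> Q" for Q x
  proof -
    have "openin T' {y \<in> carrier M'. y \<otimes>\<^bsub>M'\<^esub> f x \<in> Q}"
      using Q x by (auto intro!: M'.open_preimage continuous_intros)
    moreover have "\<one>\<^bsub>M'\<^esub> \<in> {y \<in> carrier M'. y \<otimes>\<^bsub>M'\<^esub> f x \<in> Q}" using x by simp
    ultimately obtain U where U: "openin T U" "\<one> \<in> U" "f ` U \<subseteq> {y \<in> carrier M'. y \<otimes>\<^bsub>M'\<^esub> f x \<in> Q}"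
      using nhd by metis
    have "U #> x \<subseteq> {x \<in> topspace T. f x \<in> Q}"
      using openin_subset[OF U(1)] U(3) x by (auto simp: r_coset_def subset_eq)
    moreover have "x \<in> U #> x" using U(2) x by (force simp: r_coset_def)
    ultimately show ?thesis using openin_r_coset[OF U(1)] x by auto
  qed
  moreover have "f \<in> topspace T \<rightarrow> topspace T'" by auto
  ultimately show ?thesis
    by (subst continuous_map_def, subst openin_subopen) auto
qed

lemma locally_compact:
  assumes "openin T U" "compactin T U" "\<one> \<in> U"
  shows "locally_compact_space T"
  unfolding locally_compact_space_def
proof (intro ballI exI conjI)
  fix x assume x: "x \<in> topspace T"
  then show "openin T (U #> x)" using assms openin_r_coset by simp
  have "U #> x = (\<lambda>u. u \<otimes> x) ` U" by (auto simp: r_coset_def)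
  then show "compactin T (U #> x)"
    using assms x by (auto intro!: image_compactin continuous_intros)
  show "x \<in> U #> x" using assms(3) x by (force simp: r_coset_def)
qed auto

end

lemma top_groupI: "topological_group M T \<Longrightarrow> top_group M T"
  by (auto simp: top_group_def top_group_axioms_def topological_group_def)

lemma top_group_DirProd:
  assumes "top_group M T" "top_group M' T'"
  shows "top_group (M \<times>\<times> M') (prod_topology T T')"
proof -
  interpret M: top_group M T by fact
  interpret M': top_group M' T' by fact
  let ?Z = "prod_topology T T'"
  have "continuous_map (prod_topology ?Z ?Z) ?Z
     (\<lambda>p. (fst (fst p) \<otimes>\<^bsub>M\<^esub> fst (snd p), snd (fst p) \<otimes>\<^bsub>M'\<^esub> snd (snd p)))"
    using continuous_map_compose[OF continuous_map_fst continuous_map_fst]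
      continuous_map_compose[OF continuous_map_fst continuous_map_snd]
      continuous_map_compose[OF continuous_map_snd continuous_map_fst]
      continuous_map_compose[OF continuous_map_snd continuous_map_snd]
    by (intro continuous_map_pairedI M.continuous_map_mult M'.continuous_map_mult) (simp_all add: o_def)
  moreover have "continuous_map ?Z ?Z (\<lambda>p. (inv\<^bsub>M\<^esub> fst p, inv\<^bsub>M'\<^esub> snd p))"
    by (intro continuous_map_pairedI M.continuous_map_inv M'.continuous_map_inv 
        continuous_map_fst continuous_map_snd)
  then have "continuous_map ?Z ?Z (\<lambda>x. inv\<^bsub>M \<times>\<times> M'\<^esub> x)"
    by (rule continuous_map_eq) (auto simp: M.is_group M'.is_group)
  ultimately show ?thesis
    by (intro top_groupI) 
       (auto simp: topological_group_def DirProd_group M.is_group M'.is_group case_prod_unfold mult_DirProd')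
qed

section \<open>The topology of the automorphism group\<close>

text \<open>A family of subgroups that is stable under conjugation up to passing to smaller members is a
  base at the identity for a group topology. Because the members are subgroups, their right cosets
  are open, and both group operations reduce to moving a member past an element by conjugation.\<close>

lemma (in group) subgroup_family_topology:
  assumes top: "topspace T = carrier G"
    and opn: "\<And>S. openin T S \<longleftrightarrow> S \<subseteq> carrier G \<and> (\<forall>x\<in>S. \<exists>B\<in>\<B>. B #> x \<subseteq> S)"
    and sub: "\<And>B. B \<in> \<B> \<Longrightarrow> subgroup B G"
    and conj: "\<And>B x. B \<in> \<B> \<Longrightarrow> x \<in> carrier G \<Longrightarrow> \<exists>B'\<in>\<B>. conjugate G x B' \<subseteq> B"
  shows topological_group_subgroup_family: "topological_group G T"
    and Hausdorff_subgroup_family: "\<Inter>\<B> \<subseteq> {\<one>} \<Longrightarrow> Hausdorff_space T"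
proof -
  have coset: "openin T (B #> x)" "x \<in> B #> x" if B: "B \<in> \<B>" and x: "x \<in> carrier G" for B x
  proof -
    interpret B: subgroup B G using sub[OF B] .
    have "B #> y \<subseteq> B #> x" if "y \<in> B #> x" for y
      using that x B.subset by (auto simp: r_coset_def m_assoc[symmetric] subset_eq)
    moreover have "B #> x \<subseteq> carrier G"
      using x B.subset by (auto simp: r_coset_def)
    ultimately show "openin T (B #> x)" using B unfolding opn by blast
    show "x \<in> B #> x" using x by (force simp: r_coset_def)
  qed
  have "continuous_map (prod_topology T T) T (\<lambda>(x, y). x \<otimes> y)"
    unfolding continuous_map_def
  proof (intro conjI allI impI)
    fix S assume S: "openin T S"
    show "openin (prod_topology T T) {p \<in> topspace (prod_topology T T). (case p of (x, y) \<Rightarrow> x \<otimes> y) \<in> S}"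
      unfolding openin_prod_topology_alt
    proof (intro allI impI)
      fix x y 
      assume "(x, y) \<in> {p \<in> topspace (prod_topology T T). (case p of (x, y) \<Rightarrow> x \<otimes> y) \<in> S}"
      then have xy: "x \<in> carrier G" "y \<in> carrier G" "x \<otimes> y \<in> S" by (auto simp: top)
      then obtain B where B: "B \<in> \<B>" "B #> (x \<otimes> y) \<subseteq> S" using S unfolding opn by blast
      obtain B' where B': "B' \<in> \<B>" "conjugate G x B' \<subseteq> B" using conj B xy by blast
      interpret B: subgroup B G using sub[OF B(1)] .
      interpret B': subgroup B' G using sub[OF B'(1)] .
      have "b \<otimes> x \<otimes> (b' \<otimes> y) \<in> S" if "b \<in> B" "b' \<in> B'" for b b'
      proof -
        have "x \<otimes> b' \<otimes> inv x \<in> B" using B'(2) that by (auto simp: conjugate_eq_image)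
        then have "b \<otimes> (x \<otimes> b' \<otimes> inv x) \<otimes> (x \<otimes> y) \<in> S"
          using B(2) that by (auto simp: r_coset_def)
        then show ?thesis using that xy by (simp add: m_assoc)
      qed
      then have "(B #> x) \<times> (B' #> y) \<subseteq> {p \<in> topspace (prod_topology T T). (case p of (x, y) \<Rightarrow> x \<otimes> y) \<in> S}"
        using xy B.subset B'.subset by (auto simp: r_coset_def top)
      with coset[OF B(1) xy(1)] coset[OF B'(1) xy(2)]
      show "\<exists>U W. openin T U \<and> openin T W \<and> x \<in> U \<and> y \<in> W \<and> 
          U \<times> W \<subseteq> {p \<in> topspace (prod_topology T T). (case p of (x, y) \<Rightarrow> x \<otimes> y) \<in> S}"
        by blast
    qed
  qed (auto simp: top)
  moreover have "continuous_map T T (\<lambda>x. inv x)"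
    unfolding continuous_map_def
  proof (intro conjI allI impI)
    fix S assume S: "openin T S"
    show "openin T {x \<in> topspace T. inv x \<in> S}"
      unfolding opn
    proof (intro conjI ballI)
      fix x assume "x \<in> {x \<in> topspace T. inv x \<in> S}"
      then have x: "x \<in> carrier G" "inv x \<in> S" by (auto simp: top)
      then obtain B where B: "B \<in> \<B>" "B #> inv x \<subseteq> S" using S unfolding opn by blast
      obtain B' where B': "B' \<in> \<B>" "conjugate G (inv x) B' \<subseteq> B" using conj B x by blast
      interpret B: subgroup B G using sub[OF B(1)] .
      interpret B': subgroup B' G using sub[OF B'(1)] .
      have "inv (b \<otimes> x) \<in> S" if "b \<in> B'" for b
      proof -
        have "inv x \<otimes> inv b \<otimes> x \<in> B" using B'(2) that x by (auto simp: conjugate_eq_image)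
        then have "inv x \<otimes> inv b \<otimes> x \<otimes> inv x \<in> S"
          using B(2) by (auto simp: r_coset_def)
        then show ?thesis using that x by (simp add: m_assoc inv_mult_group)
      qed
      then have "B' #> x \<subseteq> {x \<in> topspace T. inv x \<in> S}" using x by (auto simp: r_coset_def top)
      then show "\<exists>B\<in>\<B>. B #> x \<subseteq> {x \<in> topspace T. inv x \<in> S}" using B'(1) by blast
    qed (auto simp: top)
  qed (auto simp: top)
  ultimately show "topological_group G T"
    using is_group top by (simp add: topological_group_def)
  assume sep: "\<Inter>\<B> \<subseteq> {\<one>}"
  show "Hausdorff_space T"
    unfolding Hausdorff_space_def
  proof (intro allI impI)
    fix x y assume "x \<in> topspace T \<and> y \<in> topspace T \<and> x \<noteq> y"
    then have xy: "x \<in> carrier G" "y \<in> carrier G" "x \<noteq> y" by (auto simp: top)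
    then have "x \<otimes> inv y \<noteq> \<one>" by (metis inv_closed inv_equality inv_inv)
    then obtain B where B: "B \<in> \<B>" "x \<otimes> inv y \<notin> B" using sep by blast
    interpret B: subgroup B G using sub[OF B(1)] .
    have False if "b \<in> B" "c \<in> B" "b \<otimes> x = c \<otimes> y" for b c
    proof -
      have "x = inv b \<otimes> (c \<otimes> y)" using that xy by (metis B.mem_carrier inv_cancel_left(2))
      then have "x \<otimes> inv y = inv b \<otimes> c" using that xy by (simp add: m_assoc)
      then show False using B(2) that by simp
    qed
    then have "disjnt (B #> x) (B #> y)" by (auto simp: disjnt_def r_coset_def)
    with coset[OF B(1) xy(1)] coset[OF B(1) xy(2)]
    show "\<exists>U W. openin T U \<and> openin T W \<and> x \<in> U \<and> y \<in> W \<and> disjnt U W"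
      by (intro exI conjI)
  qed
qed

text \<open>By van Dantzig's theorem these are exactly the totally disconnected locally compact groups; the
  base of compact open subgroups is the form in which that condition is used.\<close>

locale tdlc_group = top_group +
  assumes Hausdorff: "Hausdorff_space T"
    and compact_open_subgroup_base: "openin T Q \<Longrightarrow> \<one> \<in> Q \<Longrightarrow>
          \<exists>U. subgroup U M \<and> openin T U \<and> compactin T U \<and> U \<subseteq> Q"

lemma (in group) HAut_carrier:
  "\<beta> \<in> carrier (HAut G T) \<longleftrightarrow> \<beta> \<in> hom G G \<and> \<beta> \<in> Bij (carrier G) \<and> homeomorphic_map T T \<beta>"
  by (auto simp: HAut_def auto_def)

lemma HAut_one [simp]: "\<one>\<^bsub>HAut G T\<^esub> = (\<lambda>x\<in>carrier G. x)"
  by (simp add: HAut_def AutoGroup_def BijGroup_def)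

lemma (in group) HAut_subgroup:
  assumes "topspace T = carrier G"
  shows "subgroup (carrier (HAut G T)) (AutoGroup G)"
proof (rule group.subgroupI[OF AutoGroup])
  show "carrier (HAut G T) \<subseteq> carrier (AutoGroup G)" by (auto simp: HAut_def AutoGroup_def)
  have "homeomorphic_map T T (\<lambda>x\<in>carrier G. x)"
    by (rule homeomorphic_map_eq[OF homeomorphic_map_id[THEN iffD2, OF refl]]) (simp add: assms)
  then show "carrier (HAut G T) \<noteq> {}"
    using id_in_auto by (auto simp: HAut_def)
  fix \<beta> assume b: "\<beta> \<in> carrier (HAut G T)"
  have bij: "\<beta> \<in> Bij (carrier G)" "\<beta> \<in> auto G" using b by (auto simp: HAut_def auto_def)
  have inv: "inv\<^bsub>AutoGroup G\<^esub> \<beta> = restrict (inv_into (carrier G) \<beta>) (carrier G)"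
    using group.m_inv_consistent[OF group_BijGroup subgroup_auto bij(2)] inv_BijGroup[OF bij(1)]
    by (simp add: AutoGroup_def)
  have "inv\<^bsub>AutoGroup G\<^esub> \<beta> \<in> auto G"
    using group.inv_closed[OF AutoGroup, of \<beta>] bij by (simp add: AutoGroup_def)
  moreover have "homeomorphic_map T T (inv\<^bsub>AutoGroup G\<^esub> \<beta>)"
  proof -
    obtain g where g: "homeomorphic_maps T T \<beta> g"
      using b by (auto simp: HAut_def homeomorphic_map_maps)
    have hm: "homeomorphic_map T T g"
      using g homeomorphic_maps_sym[of T T \<beta> g] homeomorphic_maps_map[of T T g \<beta>] by simp
    have eq: "inv_into (carrier G) \<beta> x = g x" if "x \<in> carrier G" for x
      using g that bij(1) assms
      by (intro inv_into_f_eq) (auto simp: homeomorphic_maps_def continuous_map_def Bij_def bij_betw_def)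
    have "homeomorphic_map T T (restrict (inv_into (carrier G) \<beta>) (carrier G))"
      by (rule homeomorphic_map_eq[OF hm]) (simp add: eq assms)
    then show ?thesis by (simp add: inv)
  qed
  ultimately show "inv\<^bsub>AutoGroup G\<^esub> \<beta> \<in> carrier (HAut G T)" by (simp add: HAut_def)
  fix \<gamma> assume c: "\<gamma> \<in> carrier (HAut G T)"
  have m: "\<beta> \<otimes>\<^bsub>AutoGroup G\<^esub> \<gamma> = compose (carrier G) \<beta> \<gamma>"
    using b c by (auto simp: HAut_def AutoGroup_def BijGroup_def auto_def)
  have "homeomorphic_map T T (compose (carrier G) \<beta> \<gamma>)"
    using homeomorphic_map_eq[OF homeomorphic_map_compose[of T T \<gamma> T \<beta>], of "compose (carrier G) \<beta> \<gamma>"] b c assms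
    by (auto simp: HAut_def compose_def)
  moreover have "\<beta> \<otimes>\<^bsub>AutoGroup G\<^esub> \<gamma> \<in> auto G"
    using monoid.m_closed[OF group.is_monoid[OF AutoGroup], of \<beta> \<gamma>] b c
    by (simp add: AutoGroup_def HAut_def)
  ultimately show "\<beta> \<otimes>\<^bsub>AutoGroup G\<^esub> \<gamma> \<in> carrier (HAut G T)"
    by (simp add: HAut_def m)
qed

context top_group
begin

abbreviation "A \<equiv> HAut M T"

lemma group_HAut: "group A"
  using group.subgroup_imp_group[OF AutoGroup HAut_subgroup[of T]] by (simp add: HAut_def)

lemma HAut_memD:
  assumes "\<beta> \<in> carrier A"
  shows HAut_hom: "\<beta> \<in> hom M M" and HAut_Bij: "\<beta> \<in> Bij (carrier M)"
    and HAut_homeomorphic: "homeomorphic_map T T \<beta>"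
    and HAut_extensional: "\<beta> \<in> extensional (carrier M)"
  using assms by (auto simp: HAut_carrier Bij_def)

lemma HAut_closed [simp, intro]:
  "\<beta> \<in> carrier A \<Longrightarrow> x \<in> carrier M \<Longrightarrow> \<beta> x \<in> carrier M"
  using HAut_hom by (auto simp: hom_def)

lemma HAut_mult_arg [simp]:
  "\<beta> \<in> carrier A \<Longrightarrow> x \<in> carrier M \<Longrightarrow> y \<in> carrier M \<Longrightarrow> \<beta> (x \<otimes> y) = \<beta> x \<otimes> \<beta> y"
  using HAut_hom by (auto simp: hom_def)

lemma HAut_group_hom: "\<beta> \<in> carrier A \<Longrightarrow> group_hom M M \<beta>"
  by unfold_locales (rule HAut_hom)

lemma HAut_mult:
  "\<beta> \<in> carrier A \<Longrightarrow> \<gamma> \<in> carrier A \<Longrightarrow> \<beta> \<otimes>\<^bsub>A\<^esub> \<gamma> = compose (carrier M) \<beta> \<gamma>"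
  by (auto simp: HAut_def AutoGroup_def BijGroup_def auto_def)

lemma HAut_mult_apply [simp]:
  "\<beta> \<in> carrier A \<Longrightarrow> \<gamma> \<in> carrier A \<Longrightarrow> x \<in> carrier M \<Longrightarrow> (\<beta> \<otimes>\<^bsub>A\<^esub> \<gamma>) x = \<beta> (\<gamma> x)"
  by (simp add: HAut_mult compose_def)

lemma HAut_inv_closed [simp, intro]: "\<beta> \<in> carrier A \<Longrightarrow> inv\<^bsub>A\<^esub> \<beta> \<in> carrier A"
  by (rule group.inv_closed[OF group_HAut])

lemma HAut_m_closed [simp, intro]: 
  "\<beta> \<in> carrier A \<Longrightarrow> \<gamma> \<in> carrier A \<Longrightarrow> \<beta> \<otimes>\<^bsub>A\<^esub> \<gamma> \<in> carrier A"
  by (rule monoid.m_closed[OF group.is_monoid[OF group_HAut]])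

lemma HAut_inv_apply [simp]:
  assumes "\<beta> \<in> carrier A" "x \<in> carrier M"
  shows "(inv\<^bsub>A\<^esub> \<beta>) (\<beta> x) = x" "\<beta> ((inv\<^bsub>A\<^esub> \<beta>) x) = x"
  using HAut_mult_apply[of "inv\<^bsub>A\<^esub> \<beta>" \<beta> x] HAut_mult_apply[of \<beta> "inv\<^bsub>A\<^esub> \<beta>" x] assms
    group.l_inv[OF group_HAut assms(1)] group.r_inv[OF group_HAut assms(1)]
  by auto

lemma HAut_inv_eq:
  assumes "\<beta> \<in> carrier A" "x \<in> carrier M"
  shows "inv_into (carrier M) \<beta> x = (inv\<^bsub>A\<^esub> \<beta>) x"
  using HAut_Bij[OF assms(1)] assms
  by (intro inv_into_f_eq) (auto simp: Bij_def bij_betw_def)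

lemma HAut_eqI:
  assumes "\<beta> \<in> carrier A" "\<gamma> \<in> carrier A" "\<And>x. x \<in> carrier M \<Longrightarrow> \<beta> x = \<gamma> x"
  shows "\<beta> = \<gamma>"
  by (rule extensionalityI[of _ "carrier M"]) (use assms HAut_extensional in auto)

lemma HAut_nhd_iff:
  assumes "K \<subseteq> carrier M" "U \<subseteq> carrier M"
  shows "\<beta> \<in> HAut_nhd M T K U \<longleftrightarrow> \<beta> \<in> carrier A \<and> 
     (\<forall>u\<in>K. \<beta> u \<otimes> inv u \<in> U \<and> (inv\<^bsub>A\<^esub> \<beta>) u \<otimes> inv u \<in> U)"
  using assms by (auto simp: HAut_nhd_def HAut_inv_eq mem_r_coset_iff subset_eq)

text \<open>The sets \<open>HAut_nhd M T K U\<close> are not subgroups in general: an automorphism close to the identity on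
  \<open>K\<close> may move \<open>K\<close>. If \<open>U\<close> is a subgroup and \<open>U K \<subseteq> K\<close>, then such an
  automorphism maps \<open>K\<close> into itself, and these neighbourhoods are subgroups.\<close>

definition stable_nhds where
  "stable_nhds = {HAut_nhd M T K U | K U. compactin T K \<and> compactin T U \<and> openin T U \<and>
     subgroup U M \<and> U <#> K \<subseteq> K}"

lemma stable_nhds_subgroup:
  assumes "B \<in> stable_nhds"
  shows "subgroup B A"
proof -
  obtain K U where KU: "compactin T K" "subgroup U M" "U <#> K \<subseteq> K" "B = HAut_nhd M T K U"
    using assms by (auto simp: stable_nhds_def)
  interpret U: subgroup U M by fact
  have K: "K \<subseteq> carrier M" using compactin_subset_topspace[OF KU(1)] by simp
  note B = HAut_nhd_iff[OF K U.subset]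
  interpret A: group A by (rule group_HAut)
  \<comment> \<open>Stability of \<open>K\<close> keeps \<open>\<beta> u\<close> inside the set on which the next automorphism is controlled.\<close>
  have shift: "\<beta> u \<in> K" if "\<beta> \<in> carrier A" "u \<in> K" "\<beta> u \<otimes> inv u \<in> U" for \<beta> u
  proof -
    have "\<beta> u = \<beta> u \<otimes> inv u \<otimes> u" using that K by (simp add: m_assoc subset_eq)
    then have "\<beta> u \<in> U <#> K" using that by (auto simp: set_mult_def)
    then show ?thesis using KU(3) by blast
  qed
  have comb: "\<beta> (\<gamma> u) \<otimes> inv u \<in> U" 
    if "\<beta> \<in> carrier A" "\<gamma> \<in> carrier A" "u \<in> K" "\<gamma> u \<otimes> inv u \<in> U" "\<And>u. u \<in> K \<Longrightarrow> \<beta> u \<otimes> inv u \<in> U" for \<beta> \<gamma> u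
  proof -
    have u: "u \<in> carrier M" using that K by blast
    have "(\<beta> (\<gamma> u) \<otimes> inv (\<gamma> u)) \<otimes> (\<gamma> u \<otimes> inv u) \<in> U"
      by (rule U.m_closed[OF that(5)[OF shift[OF that(2-4)]] that(4)])
    then show ?thesis using that u by (simp add: m_assoc)
  qed
  show ?thesis
  proof (rule A.subgroupI)
    show "B \<subseteq> carrier A" using B KU(4) by auto
    have "\<one>\<^bsub>A\<^esub> \<in> B" unfolding KU(4) B using K A.one_closed A.inv_one
      by (auto simp: subset_eq simp del: A.one_closed)
    then show "B \<noteq> {}" by blast
    fix \<beta> assume b: "\<beta> \<in> B" then show "inv\<^bsub>A\<^esub> \<beta> \<in> B" by (auto simp: KU(4) B)
    fix \<gamma> assume c: "\<gamma> \<in> B"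
    note bc = b[unfolded KU(4) B] c[unfolded KU(4) B]
    have "(\<beta> \<otimes>\<^bsub>A\<^esub> \<gamma>) u \<otimes> inv u \<in> U \<and> (inv\<^bsub>A\<^esub> (\<beta> \<otimes>\<^bsub>A\<^esub> \<gamma>)) u \<otimes> inv u \<in> U" if u: "u \<in> K" for u
    proof -
      have "u \<in> carrier M" using u K by blast
      then show ?thesis using bc u comb[of \<beta> \<gamma> u] comb[of "inv\<^bsub>A\<^esub> \<gamma>" "inv\<^bsub>A\<^esub> \<beta>" u]
        by (simp add: A.inv_mult_group)
    qed
    then show "\<beta> \<otimes>\<^bsub>A\<^esub> \<gamma> \<in> B" unfolding KU(4) B using bc by auto
  qed
qed

text \<open>If \<open>K\<close> and \<open>U\<close> define the given member, then their images under \<open>\<beta>\<^sup>-\<^sup>1\<close> define one whose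
  conjugate by \<open>\<beta>\<close> is contained in it; the images qualify because \<open>\<beta>\<^sup>-\<^sup>1\<close> is a homeomorphic automorphism.\<close>

lemma stable_nhds_conjugate:
  assumes "B \<in> stable_nhds" "\<beta> \<in> carrier A"
  shows "\<exists>B'\<in>stable_nhds. conjugate A \<beta> B' \<subseteq> B"
proof -
  obtain K U where KU: "compactin T K" "subgroup U M" "U <#> K \<subseteq> K" "B = HAut_nhd M T K U"
    "compactin T U" "openin T U"
    using assms by (auto simp: stable_nhds_def)
  interpret U: subgroup U M by fact
  interpret A: group A by (rule group_HAut)
  define \<gamma> where "\<gamma> = inv\<^bsub>A\<^esub> \<beta>"
  have g: "\<gamma> \<in> carrier A" using assms by (simp add: \<gamma>_def)
  interpret \<gamma>: group_hom M M \<gamma> by (rule HAut_group_hom[OF g])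
  have K: "K \<subseteq> carrier M" using compactin_subset_topspace[OF KU(1)] by simp
  have cont: "continuous_map T T \<gamma>" "open_map T T \<gamma>"
    using HAut_homeomorphic[OF g] by (auto simp: homeomorphic_map_def homeomorphic_imp_open_map homeomorphic_imp_continuous_map)
  have sub: "subgroup (\<gamma> ` U) M" by (rule \<gamma>.subgroup_img_is_subgroup[OF KU(2)])
  have "\<gamma> ` U <#> \<gamma> ` K \<subseteq> \<gamma> ` K"
  proof -
    have "\<gamma> u \<otimes> \<gamma> k \<in> \<gamma> ` K" if "u \<in> U" "k \<in> K" for u k
    proof -
      have "u \<otimes> k \<in> K" using KU(3) that by (auto simp: set_mult_def)
      then have "\<gamma> (u \<otimes> k) \<in> \<gamma> ` K" by blast
      then show ?thesis using that K g by (simp add: subset_eq)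
    qed
    then show ?thesis by (auto simp: set_mult_def)
  qed
  moreover have "compactin T (\<gamma> ` K)" "compactin T (\<gamma> ` U)" "openin T (\<gamma> ` U)"
    using KU cont by (auto intro: image_compactin simp: open_map_def)
  ultimately have B': "HAut_nhd M T (\<gamma> ` K) (\<gamma> ` U) \<in> stable_nhds"
    using sub by (auto simp: stable_nhds_def)
  have K': "\<gamma> ` K \<subseteq> carrier M" using K by auto
  have key: "\<beta> (\<eta> (\<gamma> u)) \<otimes> inv u \<in> U" 
    if "\<eta> \<in> carrier A" "u \<in> K" "\<eta> (\<gamma> u) \<otimes> inv (\<gamma> u) \<in> \<gamma> ` U" for \<eta> u
  proof -
    have u: "u \<in> carrier M" using that K by blast
    from that(3) obtain h where h: "\<eta> (\<gamma> u) \<otimes> inv (\<gamma> u) = \<gamma> h" "h \<in> U" by (rule imageE)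
    interpret \<beta>: group_hom M M \<beta> by (rule HAut_group_hom[OF assms(2)])
    have "\<beta> (\<eta> (\<gamma> u) \<otimes> inv (\<gamma> u)) = h" using h assms by (simp add: \<gamma>_def)
    then show ?thesis using h u that assms(2) by (simp add: \<gamma>_def del: \<gamma>.hom_inv)
  qed
  have "conjugate A \<beta> (HAut_nhd M T (\<gamma> ` K) (\<gamma> ` U)) \<subseteq> B"
  proof
    fix \<xi> assume "\<xi> \<in> conjugate A \<beta> (HAut_nhd M T (\<gamma> ` K) (\<gamma> ` U))"
    then obtain \<eta> where e: "\<eta> \<in> carrier A" "\<xi> = \<beta> \<otimes>\<^bsub>A\<^esub> \<eta> \<otimes>\<^bsub>A\<^esub> \<gamma>"
      "\<And>u. u \<in> K \<Longrightarrow> \<eta> (\<gamma> u) \<otimes> inv (\<gamma> u) \<in> \<gamma> ` U"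
      "\<And>u. u \<in> K \<Longrightarrow> (inv\<^bsub>A\<^esub> \<eta>) (\<gamma> u) \<otimes> inv (\<gamma> u) \<in> \<gamma> ` U"
      using HAut_nhd_iff[OF K' subgroup.subset[OF sub]] 
      by (auto simp: A.conjugate_eq_image \<gamma>_def)
    have i: "inv\<^bsub>A\<^esub> \<xi> = \<beta> \<otimes>\<^bsub>A\<^esub> inv\<^bsub>A\<^esub> \<eta> \<otimes>\<^bsub>A\<^esub> \<gamma>"
      using e(1) assms(2) by (simp add: e(2) \<gamma>_def A.inv_mult_group A.m_assoc)
    have "\<xi> u \<otimes> inv u \<in> U \<and> (inv\<^bsub>A\<^esub> \<xi>) u \<otimes> inv u \<in> U" if "u \<in> K" for u
      unfolding i unfolding e(2)
      using that K e assms(2) g key[of \<eta> u] key[of "inv\<^bsub>A\<^esub> \<eta>" u] by (auto simp: subset_eq)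
    then show "\<xi> \<in> B" unfolding KU(4) HAut_nhd_iff[OF K U.subset]
      using e assms(2) g by auto
  qed
  with B' show ?thesis by blast
qed

end

context tdlc_group
begin

abbreviation "TA \<equiv> HAut_topology M T"

text \<open>Shrinking \<open>U\<close> to a compact open subgroup \<open>U'\<close> and enlarging \<open>K\<close> to the compact set \<open>U' K\<close> makes
  any basic neighbourhood stable.\<close>

lemma stable_nhds_below:
  assumes "compactin T K" "openin T U" "\<one> \<in> U"
  shows "\<exists>B\<in>stable_nhds. B \<subseteq> HAut_nhd M T K U"
proof -
  obtain U' where U': "subgroup U' M" "openin T U'" "compactin T U'" "U' \<subseteq> U"
    using compact_open_subgroup_base assms by blast
  interpret U': subgroup U' M by fact
  have K: "K \<subseteq> carrier M" using compactin_subset_topspace[OF assms(1)] by simp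
  have 1: "U' <#> (U' <#> K) \<subseteq> U' <#> K"
    using set_mult_assoc[of U' U' K] K U'.subset subgroup_mult_id[OF U'(1)] by simp
  have "k \<in> U' <#> K" if "k \<in> K" for k
  proof -
    have "\<one> \<otimes> k \<in> U' <#> K" using that U'.one_closed unfolding set_mult_def by blast
    then show ?thesis using that K by auto
  qed
  then have "HAut_nhd M T (U' <#> K) U' \<subseteq> HAut_nhd M T K U"
    using U'(4) by (auto simp: HAut_nhd_def r_coset_def) blast+
  moreover have "HAut_nhd M T (U' <#> K) U' \<in> stable_nhds"
    unfolding stable_nhds_def using U'(1-3) 1 compactin_set_mult[OF U'(3) assms(1)] by blast
  ultimately show ?thesis by blast
qed

lemma openin_HAut_iff:
  "openin TA S \<longleftrightarrow> S \<subseteq> carrier A \<and> (\<forall>\<beta>\<in>S. \<exists>B\<in>stable_nhds. B #>\<^bsub>A\<^esub> \<beta> \<subseteq> S)"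
proof -
  have "(\<exists>K U. compactin T K \<and> openin T U \<and> \<one> \<in> U \<and> HAut_nhd M T K U #>\<^bsub>A\<^esub> \<beta> \<subseteq> S) \<longleftrightarrow>
     (\<exists>B\<in>stable_nhds. B #>\<^bsub>A\<^esub> \<beta> \<subseteq> S)" for \<beta>
  proof
    assume "\<exists>K U. compactin T K \<and> openin T U \<and> \<one> \<in> U \<and> HAut_nhd M T K U #>\<^bsub>A\<^esub> \<beta> \<subseteq> S"
    then obtain K U B where "HAut_nhd M T K U #>\<^bsub>A\<^esub> \<beta> \<subseteq> S" "B \<in> stable_nhds" "B \<subseteq> HAut_nhd M T K U"
      using stable_nhds_below by meson
    then show "\<exists>B\<in>stable_nhds. B #>\<^bsub>A\<^esub> \<beta> \<subseteq> S" unfolding r_coset_def by blast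
  next
    assume "\<exists>B\<in>stable_nhds. B #>\<^bsub>A\<^esub> \<beta> \<subseteq> S"
    then show "\<exists>K U. compactin T K \<and> openin T U \<and> \<one> \<in> U \<and> HAut_nhd M T K U #>\<^bsub>A\<^esub> \<beta> \<subseteq> S"
      using subgroup.one_closed unfolding stable_nhds_def by blast
  qed
  then show ?thesis unfolding openin_HAut_topology HAut_open_def by simp
qed

lemma topspace_HAut: "topspace TA = carrier A"
proof -
  have "openin TA (carrier A)" unfolding openin_HAut_topology HAut_open_def
  proof (intro conjI ballI)
    fix \<beta> assume b: "\<beta> \<in> carrier A"
    have "HAut_nhd M T {} (carrier M) #>\<^bsub>A\<^esub> \<beta> \<subseteq> carrier A"
      using b by (auto simp: HAut_nhd_def r_coset_def)
    then show "\<exists>K U. compactin T K \<and> openin T U \<and> \<one> \<in> U \<and> HAut_nhd M T K U #>\<^bsub>A\<^esub> \<beta> \<subseteq> carrier A"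
      by (intro exI[of _ "{}"] exI[of _ "carrier M"]) (use openin_topspace[of T] in simp)
  qed auto
  moreover have "topspace TA \<subseteq> carrier A"
    using openin_topspace[of TA] unfolding openin_HAut_iff by blast
  ultimately show ?thesis using openin_subset by blast
qed

lemma HAut_top_group: "top_group A TA"
  by (intro top_groupI group.topological_group_subgroup_family[OF group_HAut topspace_HAut openin_HAut_iff]
      stable_nhds_subgroup stable_nhds_conjugate)

lemma Hausdorff_HAut: "Hausdorff_space TA"
proof (rule group.Hausdorff_subgroup_family[OF group_HAut topspace_HAut openin_HAut_iff
      stable_nhds_subgroup stable_nhds_conjugate])
  show "\<Inter>stable_nhds \<subseteq> {\<one>\<^bsub>A\<^esub>}"
  proof
    fix \<beta> assume b: "\<beta> \<in> \<Inter>stable_nhds"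
    have ba: "\<beta> \<in> HAut_nhd M T K U" if "compactin T K" "openin T U" "\<one> \<in> U" for K U
      using stable_nhds_below[OF that] b by blast
    have "\<beta> \<in> carrier A" using ba[of "{}" "carrier M"] openin_topspace[of T] by (simp add: HAut_nhd_def)
    moreover have "\<beta> u = u" if u: "u \<in> carrier M" for u
    proof (rule ccontr)
      assume ne: "\<beta> u \<noteq> u"
      have bu: "\<beta> u \<in> carrier M" using \<open>\<beta> \<in> carrier A\<close> u by simp
      have c: "\<beta> u \<otimes> inv u \<in> carrier M" using bu u by simp
      have "openin T (carrier M - {\<beta> u \<otimes> inv u})"
        using closedin_Hausdorff_sing_eq[OF Hausdorff, of "\<beta> u \<otimes> inv u"] c by (auto simp: closedin_def)
      moreover have "\<one> \<in> carrier M - {\<beta> u \<otimes> inv u}"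
        using ne bu u by (metis Diff_iff empty_iff insert_iff inv_closed inv_equality inv_inv one_closed)
      ultimately have "\<beta> \<in> HAut_nhd M T {u} (carrier M - {\<beta> u \<otimes> inv u})"
        using u by (intro ba) auto
      then show False using HAut_nhd_iff[of "{u}" "carrier M - {\<beta> u \<otimes> inv u}" \<beta>] u by auto
    qed
    ultimately show "\<beta> \<in> {\<one>\<^bsub>A\<^esub>}"
      using HAut_eqI[of \<beta> "\<one>\<^bsub>A\<^esub>"] group.is_monoid[OF group_HAut] monoid.one_closed by fastforce
  qed
qed

text \<open>Joint continuity of evaluation at \<open>(\<beta>, u)\<close>: controlling \<open>\<eta>\<close> on the compact neighbourhood
  \<open>U \<beta>(u)\<close> of \<open>\<beta>(u)\<close> controls \<open>\<eta> (\<beta> w)\<close> for all \<open>w\<close> near \<open>u\<close> simultaneously.\<close>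

lemma continuous_map_HAut_eval:
  "continuous_map (prod_topology TA T) T (\<lambda>(\<beta>, u). \<beta> u)"
  unfolding continuous_map_def
proof (intro conjI allI impI)
  fix S assume S: "openin T S"
  show "openin (prod_topology TA T) {p \<in> topspace (prod_topology TA T). (case p of (\<beta>, u) \<Rightarrow> \<beta> u) \<in> S}"
    unfolding openin_prod_topology_alt
  proof (intro allI impI)
    fix \<beta> u assume "(\<beta>, u) \<in> {p \<in> topspace (prod_topology TA T). (case p of (\<beta>, u) \<Rightarrow> \<beta> u) \<in> S}"
    then have b: "\<beta> \<in> carrier A" and u: "u \<in> carrier M" and bu: "\<beta> u \<in> S"
      by (auto simp: topspace_HAut)
    have buc: "\<beta> u \<in> carrier M" using b u by simp
    interpret TA: top_group A TA by (rule HAut_top_group)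
    have "openin T {y \<in> carrier M. y \<otimes> \<beta> u \<in> S}" 
      using S buc by (auto intro!: open_preimage continuous_intros)
    moreover have "\<one> \<in> {y \<in> carrier M. y \<otimes> \<beta> u \<in> S}" using bu buc by simp
    ultimately obtain U where U: "subgroup U M" "openin T U" "compactin T U" "U \<subseteq> {y \<in> carrier M. y \<otimes> \<beta> u \<in> S}"
      using compact_open_subgroup_base by metis
    interpret U: subgroup U M by fact
    define K where "K = U #> \<beta> u"
    have "K = U <#> {\<beta> u}" by (auto simp: K_def r_coset_def set_mult_def)
    then have K: "compactin T K" using compactin_set_mult U buc by simp
    have Kc: "K \<subseteq> carrier M" using compactin_subset_topspace[OF K] by simp
    obtain B where B: "B \<in> stable_nhds" "B \<subseteq> HAut_nhd M T K U"
      using stable_nhds_below[OF K U(2)] by auto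
    have sB: "subgroup B A" by (rule stable_nhds_subgroup[OF B(1)])
    have oB: "openin TA (B #>\<^bsub>A\<^esub> \<beta>)"
    proof (rule TA.openin_r_coset[OF _ b])
      show "openin TA B" unfolding openin_HAut_iff
        using B(1) subgroup.subset[OF sB] TA.coset_join2[OF _ sB] by (metis order_refl subsetD)
    qed
    have bB: "\<beta> \<in> B #>\<^bsub>A\<^esub> \<beta>" using TA.rcos_self[OF b sB] .
    have cont: "continuous_map T T \<beta>" 
      using HAut_homeomorphic[OF b] homeomorphic_imp_continuous_map by blast
    have W: "openin T {w \<in> carrier M. \<beta> w \<in> K}"
      using openin_r_coset[OF U(2) buc] cont by (intro open_preimage) (simp_all add: K_def)
    have uW: "u \<in> {w \<in> carrier M. \<beta> w \<in> K}" using u rcos_self[OF buc U(1)] by (simp add: K_def)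
    have "\<gamma> w \<in> S" if gw: "\<gamma> \<in> B #>\<^bsub>A\<^esub> \<beta>" "w \<in> carrier M" "\<beta> w \<in> K" for \<gamma> w
    proof -
      obtain \<eta> where e: "\<eta> \<in> B" "\<gamma> = \<eta> \<otimes>\<^bsub>A\<^esub> \<beta>" using gw by (auto simp: r_coset_def)
      have ea: "\<eta> \<in> carrier A" "\<eta> (\<beta> w) \<otimes> inv (\<beta> w) \<in> U" 
        using e B(2) HAut_nhd_iff[OF Kc U.subset, of \<eta>] that(3) by auto
      obtain h where h: "h \<in> U" "\<beta> w = h \<otimes> \<beta> u" using gw(3) by (auto simp: K_def r_coset_def)
      have bw: "\<beta> w \<in> carrier M" using b that by simp
      have "(\<eta> (\<beta> w) \<otimes> inv (\<beta> w)) \<otimes> h \<in> U" using ea h by auto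
      then have "(\<eta> (\<beta> w) \<otimes> inv (\<beta> w)) \<otimes> h \<otimes> \<beta> u \<in> S" using U(4) by blast
      moreover have "(\<eta> (\<beta> w) \<otimes> inv (\<beta> w)) \<otimes> h \<otimes> \<beta> u = (\<eta> (\<beta> w) \<otimes> inv (\<beta> w)) \<otimes> (h \<otimes> \<beta> u)"
        using ea(1) bw h(1) buc by (intro m_assoc) auto
      moreover have "\<dots> = \<eta> (\<beta> w)"
        unfolding h(2)[symmetric] using ea(1) bw by (simp add: m_assoc)
      ultimately show "\<gamma> w \<in> S" using e ea b that by simp
    qed
    then have "(B #>\<^bsub>A\<^esub> \<beta>) \<times> {w \<in> carrier M. \<beta> w \<in> K} \<subseteq> 
        {p \<in> topspace (prod_topology TA T). (case p of (\<beta>, u) \<Rightarrow> \<beta> u) \<in> S}"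
      using openin_subset[OF oB] by (auto simp: topspace_HAut)
    with oB bB W uW
    show "\<exists>U W. openin TA U \<and> openin T W \<and> \<beta> \<in> U \<and> u \<in> W \<and> 
        U \<times> W \<subseteq> {p \<in> topspace (prod_topology TA T). (case p of (\<beta>, u) \<Rightarrow> \<beta> u) \<in> S}"
      by blast
  qed
qed (auto simp: topspace_HAut)

end

section \<open>Relatively compact groups of automorphisms\<close>

text \<open>Equicontinuity (a base of invariant open subgroups) and pointwise boundedness (orbits inside
  compact sets), the two hypotheses of an Ascoli theorem, for a group \<open>S\<close> of automorphisms.\<close>

locale relatively_compact_automorphisms = tdlc_group +
  fixes S
  assumes subgroup_S: "subgroup S (HAut M T)"
    and invariant_base: "openin T Q \<Longrightarrow> \<one> \<in> Q \<Longrightarrow>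
          \<exists>U. subgroup U M \<and> openin T U \<and> closedin T U \<and> U \<subseteq> Q \<and> (\<forall>\<beta>\<in>S. \<beta> ` U \<subseteq> U)"
    and orbit_bounded: "u \<in> carrier M \<Longrightarrow> \<exists>K. compactin T K \<and> (\<forall>\<beta>\<in>S. \<beta> u \<in> K)"
begin

abbreviation "TF \<equiv> product_topology (\<lambda>_. T) (carrier M)"
abbreviation "Z \<equiv> prod_topology TF TF"

text \<open>The inverses are recorded together with the automorphisms, since a pointwise limit of
  automorphisms alone need not be surjective.\<close>

definition "C = Z closure_of ((\<lambda>\<beta>. (\<beta>, inv\<^bsub>A\<^esub> \<beta>)) ` S)"

lemma S_carrier: "\<beta> \<in> S \<Longrightarrow> \<beta> \<in> carrier A"
  using subgroup.subset[OF subgroup_S] by blast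

lemma S_inv: "\<beta> \<in> S \<Longrightarrow> inv\<^bsub>A\<^esub> \<beta> \<in> S"
  using subgroup.m_inv_closed[OF subgroup_S] by blast

lemma HAut_topspace_TF: "\<beta> \<in> carrier A \<Longrightarrow> \<beta> \<in> topspace TF"
  using HAut_extensional by (auto simp: PiE_def)

lemma compact_C: "compactin Z C" and graph_C: "\<beta> \<in> S \<Longrightarrow> (\<beta>, inv\<^bsub>A\<^esub> \<beta>) \<in> C"
proof -
  obtain K where K: "\<And>u. u \<in> carrier M \<Longrightarrow> compactin T (K u) \<and> (\<forall>\<beta>\<in>S. \<beta> u \<in> K u)"
    using orbit_bounded by metis
  let ?K = "PiE (carrier M) K"
  have "compactin TF ?K" using K by (subst compactin_PiE) auto
  then have c: "compactin Z (?K \<times> ?K)" by (simp add: compactin_Times)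
  have "\<beta> \<in> ?K" if "\<beta> \<in> S" for \<beta>
    using K that HAut_extensional[OF S_carrier[OF that]] by (auto simp: PiE_def)
  then have "(\<lambda>\<beta>. (\<beta>, inv\<^bsub>A\<^esub> \<beta>)) ` S \<subseteq> ?K \<times> ?K" using S_inv by auto
  moreover have "closedin Z (?K \<times> ?K)"
    using c by (rule compactin_imp_closedin[rotated]) 
      (simp add: Hausdorff_space_prod_topology Hausdorff_space_product_topology Hausdorff)
  ultimately have "C \<subseteq> ?K \<times> ?K" unfolding C_def by (rule closure_of_minimal)
  moreover have "closedin Z C" unfolding C_def by (rule closedin_closure_of)
  ultimately show "compactin Z C" by (rule closed_compactin[OF c])
  have "(\<lambda>\<beta>. (\<beta>, inv\<^bsub>A\<^esub> \<beta>)) ` S \<subseteq> topspace Z"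
    using HAut_topspace_TF S_carrier S_inv by auto
  then show "(\<beta>, inv\<^bsub>A\<^esub> \<beta>) \<in> C" if "\<beta> \<in> S"
    using closure_of_subset that unfolding C_def by blast
qed

lemma continuous_map_fst_eval [continuous_intros]:
  "u \<in> carrier M \<Longrightarrow> continuous_map Z T (\<lambda>p. fst p u)"
  using continuous_map_compose[OF continuous_map_fst continuous_map_product_projection[of u]]
  by (force simp: o_def)

lemma continuous_map_snd_eval [continuous_intros]:
  "u \<in> carrier M \<Longrightarrow> continuous_map Z T (\<lambda>p. snd p u)"
  using continuous_map_compose[OF continuous_map_snd continuous_map_product_projection[of u]]
  by (force simp: o_def)

lemma C_topspace: "p \<in> C \<Longrightarrow> p \<in> topspace Z"
  using subsetD[OF closure_of_subset_topspace] unfolding C_def .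

lemma C_closed [simp]:
  assumes "(f, g) \<in> C" "u \<in> carrier M"
  shows "f u \<in> carrier M" "g u \<in> carrier M"
  using C_topspace[OF assms(1)] assms(2) by (auto simp: PiE_def)

text \<open>Closeness at finitely many points is an open condition, because the product topology only
  involves the coordinates in the finite set \<open>L\<close>.\<close>

lemma pointwise_open:
  assumes "finite L" "L \<subseteq> carrier M" "openin T U" "(f, g) \<in> C"
  shows "openin Z {p \<in> topspace Z. \<forall>u\<in>L. fst p u \<otimes> inv (f u) \<in> U \<and> snd p u \<otimes> inv (g u) \<in> U}"
  using assms(1,2)
proof (induction L)
  case empty
  then show ?case using openin_topspace[of Z] by simp
next
  case (insert x L)
  have x: "x \<in> carrier M" using insert by blast
  note fx = C_closed[OF assms(4) x]
  have "continuous_map Z T (\<lambda>p. fst p x \<otimes> inv (f x))" "continuous_map Z T (\<lambda>p. snd p x \<otimes> inv (g x))"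
    using x fx by (auto intro!: continuous_map_mult continuous_map_fst_eval continuous_map_snd_eval)
  note op = this[THEN openin_continuous_map_preimage, OF assms(3)]
  have "{p \<in> topspace Z. \<forall>u\<in>insert x L. fst p u \<otimes> inv (f u) \<in> U \<and> snd p u \<otimes> inv (g u) \<in> U} =
    {p \<in> topspace Z. \<forall>u\<in>L. fst p u \<otimes> inv (f u) \<in> U \<and> snd p u \<otimes> inv (g u) \<in> U} \<inter>
    ({p \<in> topspace Z. fst p x \<otimes> inv (f x) \<in> U} \<inter> {p \<in> topspace Z. snd p x \<otimes> inv (g x) \<in> U})"
    by blast
  moreover have "openin Z {p \<in> topspace Z. \<forall>u\<in>L. fst p u \<otimes> inv (f u) \<in> U \<and> snd p u \<otimes> inv (g u) \<in> U}"
    using insert by blast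
  ultimately show ?case using op by (simp only: openin_Int)
qed

lemma C_approx:
  assumes "(f, g) \<in> C" "u \<in> carrier M" "w \<in> carrier M" "openin T U" "\<one> \<in> U"
  shows "\<exists>\<beta>\<in>S. \<beta> w \<otimes> inv (f w) \<in> U \<and> (inv\<^bsub>A\<^esub> \<beta>) u \<otimes> inv (g u) \<in> U"
proof -
  let ?O = "{p \<in> topspace Z. \<forall>v\<in>{u, w}. fst p v \<otimes> inv (f v) \<in> U \<and> snd p v \<otimes> inv (g v) \<in> U}"
  have "openin Z ?O" using assms by (intro pointwise_open) auto
  moreover have "(f, g) \<in> ?O"
    using assms C_topspace[OF assms(1)] C_closed[OF assms(1)] by (simp only: mem_Collect_eq) simp
  ultimately obtain q where "q \<in> (\<lambda>\<beta>. (\<beta>, inv\<^bsub>A\<^esub> \<beta>)) ` S" "q \<in> ?O"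
    using assms(1) unfolding C_def by (meson in_closure_of)
  then show ?thesis by auto
qed

lemma C_hom:
  assumes "(f, g) \<in> C"
  shows "f \<in> hom M M" "g \<in> hom M M"
proof -
  have "fst (f, g) (x \<otimes> y) = fst (f, g) x \<otimes> fst (f, g) y" if "x \<in> carrier M" "y \<in> carrier M" for x y
    by (rule forall_in_closure_of_eq[OF assms[unfolded C_def] Hausdorff]) 
       (use that S_carrier in \<open>auto intro!: continuous_map_mult continuous_map_fst_eval\<close>)
  moreover have "snd (f, g) (x \<otimes> y) = snd (f, g) x \<otimes> snd (f, g) y" if "x \<in> carrier M" "y \<in> carrier M" for x y
    by (rule forall_in_closure_of_eq[OF assms[unfolded C_def] Hausdorff]) 
       (use that S_carrier in \<open>auto intro!: continuous_map_mult continuous_map_snd_eval\<close>)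
  ultimately show "f \<in> hom M M" "g \<in> hom M M"
    using C_closed[OF assms] by (auto simp: hom_def)
qed

lemma C_invariant:
  assumes "(f, g) \<in> C" "closedin T U" "\<And>\<beta>. \<beta> \<in> S \<Longrightarrow> \<beta> ` U \<subseteq> U" "u \<in> U"
  shows "f u \<in> U" "g u \<in> U"
proof -
  have u: "u \<in> carrier M" using closedin_subset[OF assms(2)] assms(4) by auto
  have S: "\<beta> u \<in> U" if "\<beta> \<in> S" for \<beta> using assms(3)[OF that] assms(4) by blast
  have "fst (f, g) u \<in> U"
  proof (rule forall_in_closure_of[OF assms(1)[unfolded C_def]])
    show "closedin Z {x \<in> topspace Z. fst x u \<in> U}"
      by (rule closedin_continuous_map_preimage[OF continuous_map_fst_eval[OF u] assms(2)])
  qed (use S in auto)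
  moreover have "snd (f, g) u \<in> U"
  proof (rule forall_in_closure_of[OF assms(1)[unfolded C_def]])
    show "closedin Z {x \<in> topspace Z. snd x u \<in> U}"
      by (rule closedin_continuous_map_preimage[OF continuous_map_snd_eval[OF u] assms(2)])
  qed (use S S_inv in auto)
  ultimately show "f u \<in> U" "g u \<in> U" by auto
qed

lemma invariant_base_separates:
  assumes "x \<in> carrier M" 
    and "\<And>U. subgroup U M \<Longrightarrow> openin T U \<Longrightarrow> closedin T U \<Longrightarrow> (\<And>\<beta>. \<beta> \<in> S \<Longrightarrow> \<beta> ` U \<subseteq> U) \<Longrightarrow> x \<in> U"
  shows "x = \<one>"
proof (rule ccontr)
  assume "x \<noteq> \<one>"
  moreover have "openin T (carrier M - {x})"
    using closedin_Hausdorff_sing_eq[OF Hausdorff, of x] assms(1) by (auto simp: closedin_def)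
  ultimately obtain U where "subgroup U M" "openin T U" "closedin T U" "U \<subseteq> carrier M - {x}" 
    "\<forall>\<beta>\<in>S. \<beta> ` U \<subseteq> U" using invariant_base[of "carrier M - {x}"] by auto
  then show False using assms(2)[of U] by blast
qed

text \<open>Composition is not continuous for pointwise convergence, but here equicontinuity replaces it:
  if \<open>\<beta>\<^sup>-\<^sup>1 u\<close> is close to \<open>g u\<close>, then applying \<open>\<beta>\<close>, which preserves the invariant subgroup \<open>U\<close>, shows that
  \<open>u\<close> is \<open>U\<close>-close to \<open>\<beta> (g u)\<close>, which in turn is \<open>U\<close>-close to \<open>f (g u)\<close>.\<close>

lemma approx_inverse:
  assumes closed: "f (g u) \<in> carrier M" "g u \<in> carrier M" "u \<in> carrier M"
    and approx: "\<And>U. openin T U \<Longrightarrow> \<one> \<in> U \<Longrightarrow> 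
      \<exists>\<beta>\<in>S. \<beta> (g u) \<otimes> inv (f (g u)) \<in> U \<and> (inv\<^bsub>A\<^esub> \<beta>) u \<otimes> inv (g u) \<in> U"
  shows "f (g u) = u"
proof -
  have "f (g u) \<otimes> inv u = \<one>"
  proof (rule invariant_base_separates)
    fix U assume U: "subgroup U M" "openin T U" "closedin T U" "\<And>\<beta>. \<beta> \<in> S \<Longrightarrow> \<beta> ` U \<subseteq> U"
    interpret U: subgroup U M by fact
    obtain \<beta> where b: "\<beta> \<in> S" "\<beta> (g u) \<otimes> inv (f (g u)) \<in> U" "(inv\<^bsub>A\<^esub> \<beta>) u \<otimes> inv (g u) \<in> U"
      using approx[OF U(2) U.one_closed] by blast
    have ba: "\<beta> \<in> carrier A" using S_carrier b by blast
    interpret \<beta>: group_hom M M \<beta> by (rule HAut_group_hom[OF ba])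
    have "\<beta> ((inv\<^bsub>A\<^esub> \<beta>) u \<otimes> inv (g u)) \<in> U" using U(4)[OF b(1)] b(3) by blast
    then have 1: "u \<otimes> inv (\<beta> (g u)) \<in> U" using ba closed by simp
    have "inv ((u \<otimes> inv (\<beta> (g u))) \<otimes> (\<beta> (g u) \<otimes> inv (f (g u)))) \<in> U" using 1 b(2) by simp
    then show "f (g u) \<otimes> inv u \<in> U" using ba closed by (simp add: m_assoc inv_mult_group)
  qed (use closed in simp)
  then show ?thesis using closed by (metis inv_closed inv_equality inv_inv)
qed

lemma C_inverse:
  assumes "(f, g) \<in> C" "u \<in> carrier M"
  shows "f (g u) = u" "g (f u) = u"
proof -
  show "f (g u) = u"
    by (rule approx_inverse) (use assms C_closed[OF assms(1)] C_approx[OF assms(1), of u "g u"] in auto)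
  have "\<exists>\<beta>\<in>S. \<beta> (f u) \<otimes> inv (g (f u)) \<in> U \<and> (inv\<^bsub>A\<^esub> \<beta>) u \<otimes> inv (f u) \<in> U" 
    if U: "openin T U" "\<one> \<in> U" for U
  proof -
    obtain \<beta> where b: "\<beta> \<in> S" "\<beta> u \<otimes> inv (f u) \<in> U" "(inv\<^bsub>A\<^esub> \<beta>) (f u) \<otimes> inv (g (f u)) \<in> U"
      using C_approx[OF assms(1), of "f u" u U] U assms C_closed[OF assms] by auto
    then show ?thesis
      by (intro bexI[of _ "inv\<^bsub>A\<^esub> \<beta>"]) (simp_all add: S_inv group.inv_inv[OF group_HAut S_carrier])
  qed
  then show "g (f u) = u"
    by (intro approx_inverse) (use assms C_closed[OF assms(1)] in auto)
qed

lemma C_HAut: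
  assumes "(f, g) \<in> C"
  shows "f \<in> carrier A" "\<And>u. u \<in> carrier M \<Longrightarrow> (inv\<^bsub>A\<^esub> f) u = g u"
proof -
  note inv = C_inverse[OF assms] and closed = C_closed[OF assms]
  have cont: "continuous_map T T h" if "h = f \<or> h = g" for h
  proof (rule continuous_hom)
    show "top_group M T" by unfold_locales
    show "h \<in> hom M M" using that C_hom[OF assms] by auto
    fix Q assume "openin T Q" "\<one> \<in> Q"
    then obtain U where U: "subgroup U M" "openin T U" "closedin T U" "U \<subseteq> Q" "\<forall>\<beta>\<in>S. \<beta> ` U \<subseteq> U"
      using invariant_base by meson
    have "h u \<in> U" if "u \<in> U" for u
      using C_invariant[OF assms U(3) _ that] U(5) \<open>h = f \<or> h = g\<close> by blast
    then have "h ` U \<subseteq> Q" using U(4) by blast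
    then show "\<exists>U. openin T U \<and> \<one> \<in> U \<and> h ` U \<subseteq> Q" using U subgroup.one_closed[OF U(1)] by blast
  qed
  have "homeomorphic_maps T T f g"
    using cont inv by (simp add: homeomorphic_maps_def)
  moreover have "bij_betw f (carrier M) (carrier M)"
    by (rule bij_betwI[of _ _ _ g]) (use inv closed in auto)
  moreover have "f \<in> extensional (carrier M)"
    using C_topspace[OF assms] by (simp add: PiE_def)
  ultimately show fA: "f \<in> carrier A"
    using C_hom[OF assms] by (auto simp: HAut_carrier Bij_def homeomorphic_map_maps)
  fix u assume u: "u \<in> carrier M"
  show "(inv\<^bsub>A\<^esub> f) u = g u"
    using HAut_inv_apply(1)[OF fA closed(2)[OF u]] inv(1)[OF u] by simp
qed

text \<open>On \<open>C\<close> pointwise convergence implies convergence in the automorphism group: all first and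
  second components preserve the invariant open subgroup \<open>U1\<close>, so closeness at representatives of the
  finitely many cosets \<open>U1 k\<close> covering the compact set \<open>K\<close> gives closeness on all of \<open>K\<close>.\<close>

lemma continuous_map_C_HAut: "continuous_map (subtopology Z C) TA fst"
  unfolding continuous_map_def
proof (intro conjI allI impI)
  show "fst \<in> topspace (subtopology Z C) \<rightarrow> topspace TA" 
    using C_HAut(1) by (auto simp: topspace_HAut)
  fix R assume R: "openin TA R"
  show "openin (subtopology Z C) {p \<in> topspace (subtopology Z C). fst p \<in> R}"
  proof (subst openin_subopen, intro ballI)
    fix p assume p: "p \<in> {p \<in> topspace (subtopology Z C). fst p \<in> R}"
    obtain f g where fg: "p = (f, g)" by (cases p)
    have C: "(f, g) \<in> C" and fR: "f \<in> R" using p by (auto simp: fg)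
    note fA = C_HAut(1)[OF C] and finv = C_HAut(2)[OF C]
    obtain K U where KU: "compactin T K" "openin T U" "\<one> \<in> U" "HAut_nhd M T K U #>\<^bsub>A\<^esub> f \<subseteq> R"
      using R fR unfolding openin_HAut_topology HAut_open_def by meson
    obtain U1 where U1: "subgroup U1 M" "openin T U1" "closedin T U1" "U1 \<subseteq> U" "\<forall>\<beta>\<in>S. \<beta> ` U1 \<subseteq> U1"
      using invariant_base KU by meson
    interpret U1: subgroup U1 M by fact
    have K: "K \<subseteq> carrier M" using compactin_subset_topspace[OF KU(1)] by simp
    have "\<And>W. W \<in> (\<lambda>k. U1 #> k) ` K \<Longrightarrow> openin T W" using K openin_r_coset[OF U1(2)] by blast
    moreover have "K \<subseteq> \<Union>((\<lambda>k. U1 #> k) ` K)" using K rcos_self[OF _ U1(1)] by blast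
    ultimately obtain \<F> where F: "finite \<F>" "\<F> \<subseteq> (\<lambda>k. U1 #> k) ` K" "K \<subseteq> \<Union>\<F>"
      using KU(1) unfolding compactin_def by meson
    obtain L where L: "L \<subseteq> K" "finite L" "\<F> = (\<lambda>k. U1 #> k) ` L"
      using finite_subset_image[OF F(1,2)] by blast
    have Lc: "L \<subseteq> carrier M" using L K by blast
    \<comment> \<open>To compare \<open>f1 \<circ> g\<close> with the identity at \<open>k\<close>, the first components must be close at \<open>g k\<close>; for
      the inverse, the second components must be close at \<open>k\<close> itself.\<close>
    define N where "N = {q \<in> topspace Z. \<forall>u\<in>L \<union> g ` L. fst q u \<otimes> inv (f u) \<in> U1 \<and> snd q u \<otimes> inv (g u) \<in> U1}"
    have "openin Z N" unfolding N_def
      using L Lc U1 C C_closed[OF C] by (intro pointwise_open) auto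
    moreover have "(f, g) \<in> N"
      unfolding N_def using C_topspace[OF C] C_closed[OF C] Lc U1.one_closed 
      by (simp only: mem_Collect_eq) (auto simp: subset_eq)
    moreover have "f1 \<in> R" if C1: "(f1, g1) \<in> C" and N1: "(f1, g1) \<in> N" for f1 g1
    proof -
      note f1A = C_HAut(1)[OF C1] and f1inv = C_HAut(2)[OF C1]
      note iC = C_invariant[OF C U1(3) bspec[OF U1(5)], simplified] and iC1 = C_invariant[OF C1 U1(3) bspec[OF U1(5)], simplified]
      interpret A: group A by (rule group_HAut)
      define \<eta> where "\<eta> = f1 \<otimes>\<^bsub>A\<^esub> inv\<^bsub>A\<^esub> f"
      have eA: "\<eta> \<in> carrier A" using fA f1A by (simp add: \<eta>_def)
      have e1: "\<eta> u = f1 (g u)" if "u \<in> carrier M" for u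
        using that fA f1A finv by (simp add: \<eta>_def)
      have e2: "(inv\<^bsub>A\<^esub> \<eta>) u = f (g1 u)" if "u \<in> carrier M" for u
        using that fA f1A f1inv by (simp add: \<eta>_def A.inv_mult_group)
      have "\<eta> u \<otimes> inv u \<in> U \<and> (inv\<^bsub>A\<^esub> \<eta>) u \<otimes> inv u \<in> U" if u: "u \<in> K" for u
      proof -
        obtain k where k: "k \<in> L" "u \<in> U1 #> k" using F(3) u L(3) by blast
        obtain h where h: "h \<in> U1" "u = h \<otimes> k" using k(2) by (auto simp: r_coset_def)
        have kc: "k \<in> carrier M" "h \<in> carrier M" using k Lc h by auto
        have gk: "g k \<in> carrier M" "g1 k \<in> carrier M" "g h \<in> carrier M" "g1 h \<in> carrier M"
          using C_closed[OF C] C_closed[OF C1] kc by auto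
        have *: "f1 (g h) \<in> U1" "f (g1 h) \<in> U1"
          by (rule iC1(1)[OF iC(2)[OF h(1)]], rule iC(1)[OF iC1(2)[OF h(1)]])
        have "f1 (g k) \<otimes> inv (f (g k)) \<in> U1" "g1 k \<otimes> inv (g k) \<in> U1"
          using N1 k(1) by (auto simp: N_def)
        moreover from this(2) have "f (g1 k \<otimes> inv (g k)) \<in> U1"
          by (rule iC(1))
        moreover have "f (g1 k \<otimes> inv (g k)) = f (g1 k) \<otimes> inv (f (g k))"
          using fA gk group_hom.hom_inv[OF HAut_group_hom[OF fA], of "g k"] by simp
        ultimately have **: "f1 (g k) \<otimes> inv k \<in> U1" "f (g1 k) \<otimes> inv k \<in> U1"
          using C_inverse(1)[OF C kc(1)] by auto
        have "f1 (g h) \<otimes> (f1 (g k) \<otimes> inv k) \<otimes> inv h \<in> U1" "f (g1 h) \<otimes> (f (g1 k) \<otimes> inv k) \<otimes> inv h \<in> U1"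
          using * ** h(1) by auto
        moreover have "g (h \<otimes> k) = g h \<otimes> g k" "g1 (h \<otimes> k) = g1 h \<otimes> g1 k"
          using C_hom(2)[OF C] C_hom(2)[OF C1] kc by (auto simp: hom_def)
        ultimately have "\<eta> u \<otimes> inv u \<in> U1 \<and> (inv\<^bsub>A\<^esub> \<eta>) u \<otimes> inv u \<in> U1"
          using kc gk fA f1A by (simp add: h(2) e1 e2 m_assoc inv_mult_group)
        then show ?thesis using U1(4) by blast
      qed
      then have "\<eta> \<in> HAut_nhd M T K U"
        using HAut_nhd_iff[of K U \<eta>] K openin_subset[OF KU(2)] eA by auto
      moreover have "f1 = \<eta> \<otimes>\<^bsub>A\<^esub> f" using fA f1A by (simp add: \<eta>_def A.m_assoc del: HAut_one)
      ultimately show ?thesis using KU(4) by (auto simp: r_coset_def)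
    qed
    ultimately have "openin (subtopology Z C) (C \<inter> N)" "p \<in> C \<inter> N" 
      "C \<inter> N \<subseteq> {p \<in> topspace (subtopology Z C). fst p \<in> R}"
      using C openin_subset[of Z N] by (auto simp: openin_subtopology_Int2 fg)
    then show "\<exists>Ta. openin (subtopology Z C) Ta \<and> p \<in> Ta \<and> Ta \<subseteq> {p \<in> topspace (subtopology Z C). fst p \<in> R}"
      by blast
  qed
qed

text \<open>The continuous image of \<open>C\<close> is compact, hence closed, and contains \<open>S\<close>.\<close>

lemma compactin_closure_S: "compactin TA (TA closure_of S)"
proof -
  have "compactin (subtopology Z C) C" using compact_C by (simp add: compactin_subtopology)
  then have c: "compactin TA (fst ` C)" by (rule image_compactin[OF _ continuous_map_C_HAut])
  have "S \<subseteq> fst ` C" using graph_C by force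
  then have "TA closure_of S \<subseteq> fst ` C"
    using compactin_imp_closedin[OF Hausdorff_HAut c] by (rule closure_of_minimal)
  then show ?thesis by (rule closed_compactin[OF c _ closedin_closure_of])
qed

end

section \<open>Reduced completions and their uniqueness\<close>

context top_group
begin

text \<open>The compact set \<open>H - Q\<close> is covered by the complements of the conjugates, which are open because
  compact sets are closed in a Hausdorff space; a finite subcover gives \<open>F\<close>.\<close>

lemma nhd_base_conjugates:
  assumes "Hausdorff_space T" "compactin T H" "openin T H"
    and D: "D \<subseteq> carrier M" "(\<Inter>x\<in>D. conjugate M x H) \<subseteq> {\<one>}"
    and Q: "openin T Q" "\<one> \<in> Q"
  shows "\<exists>F. finite F \<and> F \<subseteq> D \<and> H \<inter> (\<Inter>x\<in>F. conjugate M x H) \<subseteq> Q"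
proof -
  have closed: "closedin T (conjugate M x H)" if "x \<in> carrier M" for x
    using compactin_imp_closedin[OF assms(1) compactin_conjugate[OF assms(2) that]] .
  have "closedin T (H - Q)"
    using compactin_imp_closedin[OF assms(1,2)] Q by (intro closedin_diff) auto
  then have c: "compactin T (H - Q)" by (rule closed_compactin[OF assms(2) Diff_subset])
  let ?U = "(\<lambda>x. carrier M - conjugate M x H) ` D"
  have "\<And>U. U \<in> ?U \<Longrightarrow> openin T U" using closed D(1) openin_topspace[of T] by auto
  moreover have "H - Q \<subseteq> \<Union>?U"
    using D(2) Q(2) openin_subset[OF assms(3)] by fastforce
  ultimately obtain \<F> where F: "finite \<F>" "\<F> \<subseteq> ?U" "H - Q \<subseteq> \<Union>\<F>"
    using c unfolding compactin_def by meson
  obtain F where "F \<subseteq> D" "finite F" "\<F> = (\<lambda>x. carrier M - conjugate M x H) ` F"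
    using finite_subset_image[OF F(1,2)] by blast
  then show ?thesis using F(3) by (intro exI[of _ F]) blast
qed

lemma conjugate_by_dense:
  assumes "subgroup H M" "openin T H" "T closure_of D = carrier M" "x \<in> carrier M"
  obtains d where "d \<in> D" "d \<in> carrier M" "inv d \<otimes> x \<in> H" "conjugate M x H = conjugate M d H"
proof -
  obtain d where d: "d \<in> D" "d \<in> carrier M" "inv d \<otimes> x \<in> H"
    using closure_coset_meets[of x D H] assms subgroup.one_closed[OF assms(1)] by metis
  have "conjugate M (d \<otimes> (inv d \<otimes> x)) H = conjugate M d H"
    by (rule conjugate_coset) (use d assms in auto)
  then show ?thesis using d assms(4) that by simp
qed

text \<open>If \<open>D\<close> is dense, then every left coset of the open subgroup \<open>H\<close> meets \<open>D\<close>, so the conjugates of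
  \<open>H\<close> by elements of \<open>D\<close> are all its conjugates.\<close>

lemma reduced_pair_dense:
  assumes "subgroup H M" "openin T H" "T closure_of D = carrier M" "reduced_pair M H"
  shows "(\<Inter>x\<in>D. conjugate M x H) \<subseteq> {\<one>}"
proof
  fix y assume y: "y \<in> (\<Inter>x\<in>D. conjugate M x H)"
  have "y \<in> conjugate M x H" if "x \<in> carrier M" for x
    using conjugate_by_dense[OF assms(1-3) that] y by (metis INT_iff)
  then show "y \<in> {\<one>}" using assms(4) by (auto simp: reduced_pair_def)
qed

end

text \<open>These conditions make \<open>M\<close> locally compact and totally disconnected: the translates of \<open>M0\<close> are
  compact and open, and by \<open>nhd_base_conjugates\<close> cosets of finite intersections of its conjugates
  separate points. The completed subgroup of \<open>N\<close> is left implicit as the preimage of \<open>M0\<close>, so that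
  two completions are comparable when their preimages agree.\<close>

locale reduced_completion = top_group M T + N: group N for N (structure) and M (structure) and T +
  fixes M0 \<phi>
  assumes Hausdorff: "Hausdorff_space T"
    and M0: "subgroup M0 M" "compactin T M0" "openin T M0"
    and reduced: "reduced_pair M M0"
    and hom: "\<phi> \<in> hom N M"
    and dense: "T closure_of (\<phi> ` carrier N) = carrier M"
begin

sublocale \<phi>: group_hom N M \<phi>
  by unfold_locales (rule hom)

lemma range_\<phi>: "\<phi> ` carrier N \<subseteq> carrier M" by auto

lemma closed_M0: "closedin T M0"
  by (rule compactin_imp_closedin[OF Hausdorff M0(2)])

lemma clopen_conjugate:
  assumes "x \<in> carrier M"
  shows "openin T (conjugate M x M0)" "closedin T (conjugate M x M0)"
  using openin_conjugate[OF M0(3) assms] compactin_imp_closedin[OF Hausdorff compactin_conjugate[OF M0(2) assms]]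
  by auto

lemma conjugate_base:
  assumes "openin T Q" "\<one>\<^bsub>M\<^esub> \<in> Q"
  obtains F where "finite F" "F \<subseteq> carrier N" "M0 \<inter> (\<Inter>n\<in>F. conjugate M (\<phi> n) M0) \<subseteq> Q"
proof -
  obtain F where F: "finite F" "F \<subseteq> \<phi> ` carrier N" "M0 \<inter> (\<Inter>x\<in>F. conjugate M x M0) \<subseteq> Q"
    using nhd_base_conjugates[OF Hausdorff M0(2,3) range_\<phi> reduced_pair_dense[OF M0(1,3) dense reduced] assms]
    by blast
  obtain F' where "F' \<subseteq> carrier N" "finite F'" "F = \<phi> ` F'"
    using finite_subset_image[OF F(1,2)] by blast
  then show ?thesis using F(3) that[of F'] by auto
qed

lemma \<phi>_conjugate_iff:
  assumes "m \<in> carrier N" "n \<in> carrier N"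
  shows "\<phi> m \<in> conjugate M (\<phi> n) M0 \<longleftrightarrow> inv\<^bsub>N\<^esub> n \<otimes>\<^bsub>N\<^esub> m \<otimes>\<^bsub>N\<^esub> n \<in> {x \<in> carrier N. \<phi> x \<in> M0}"
  using assms subgroup.subset[OF M0(1)] by (simp add: mem_conjugate_iff)

lemma M0_subset_closure: "M0 \<subseteq> T closure_of (\<phi> ` {x \<in> carrier N. \<phi> x \<in> M0})"
proof -
  have "M0 \<inter> T closure_of (\<phi> ` carrier N) \<subseteq> T closure_of (M0 \<inter> \<phi> ` carrier N)"
    by (rule openin_Int_closure_of_subset[OF M0(3)])
  moreover have "M0 \<inter> \<phi> ` carrier N = \<phi> ` {x \<in> carrier N. \<phi> x \<in> M0}" by auto
  ultimately show ?thesis using subgroup.subset[OF M0(1)] dense by auto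
qed

lemma closure_preimage_M0: "T closure_of (\<phi> ` {x \<in> carrier N. \<phi> x \<in> M0}) = M0"
  using M0_subset_closure closure_of_minimal[OF _ closed_M0, of "\<phi> ` {x \<in> carrier N. \<phi> x \<in> M0}"] by blast

end

lemma is_schlichting_completion_reduced:
  assumes "group N" "is_schlichting_completion N N0 M T M0 \<phi>"
  shows "reduced_completion N M T M0 \<phi>"
  using assms top_groupI[of M T]
  by (auto simp: is_schlichting_completion_def reduced_completion_def reduced_completion_axioms_def
      locally_compact_group_def)

text \<open>The extension is the map whose graph is the closure \<open>R\<close> of the set of pairs \<open>(\<phi> n, \<phi>' n)\<close>. Both completions
  see the same subgroups \<open>n N0 n\<^sup>-\<^sup>1\<close> of \<open>N\<close>, so related points lie in corresponding conjugates of \<open>M0\<close>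
  and \<open>M0'\<close>. Since the conjugates of \<open>M0'\<close> meet trivially, this makes \<open>R\<close> single-valued, and it yields continuity
  because they also form a neighbourhood base. Compactness of \<open>M0 \<times> M0'\<close> makes \<open>R\<close> total.\<close>

lemma completion_extends:
  fixes N (structure)
  assumes "reduced_completion N M T M0 \<phi>" "reduced_completion N M' T' M0' \<phi>'"
    and eq: "{x \<in> carrier N. \<phi> x \<in> M0} = {x \<in> carrier N. \<phi>' x \<in> M0'}"
  shows "\<exists>\<Phi>. \<Phi> \<in> hom M M' \<and> continuous_map T T' \<Phi> \<and> \<Phi> ` M0 \<subseteq> M0' \<and>
           (\<forall>n\<in>carrier N. \<Phi> (\<phi> n) = \<phi>' n)"
proof -
  interpret C: reduced_completion N M T M0 \<phi> by fact
  interpret C': reduced_completion N M' T' M0' \<phi>' by fact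
  let ?Z = "prod_topology T T'"
  interpret P: top_group "M \<times>\<times> M'" ?Z
    by (rule top_group_DirProd) unfold_locales
  define R where "R = ?Z closure_of ((\<lambda>n. (\<phi> n, \<phi>' n)) ` carrier N)"
  have "(\<lambda>n. (\<phi> n, \<phi>' n)) \<in> hom N (M \<times>\<times> M')" 
    by (simp add: hom_paired C.hom C'.hom)
  then interpret d: group_hom N "M \<times>\<times> M'" "\<lambda>n. (\<phi> n, \<phi>' n)" by unfold_locales
  interpret R: subgroup R "M \<times>\<times> M'"
    unfolding R_def by (intro P.subgroup_closure d.img_is_subgroup)
  have closedR: "closedin ?Z R" unfolding R_def by (rule closedin_closure_of)
  have graph: "(\<phi> n, \<phi>' n) \<in> R" if "n \<in> carrier N" for n
    unfolding R_def by (rule subsetD[OF closure_of_subset]) (use that in auto)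
  have R_carrier: "x \<in> carrier M \<and> y \<in> carrier M'" if "(x, y) \<in> R" for x y
    using R.mem_carrier[OF that] by simp
  have corr: "x \<in> conjugate M (\<phi> n) M0 \<longleftrightarrow> y \<in> conjugate M' (\<phi>' n) M0'"
    if xy: "(x, y) \<in> R" and n: "n \<in> carrier N" for x y n
  proof -
    let ?c = "conjugate M (\<phi> n) M0" and ?c' = "conjugate M' (\<phi>' n) M0'"
    have "fst (x, y) \<in> ?c \<longleftrightarrow> snd (x, y) \<in> ?c'"
    proof (rule forall_in_closure_of[OF xy[unfolded R_def]])
      fix p assume "p \<in> (\<lambda>n. (\<phi> n, \<phi>' n)) ` carrier N"
      then show "fst p \<in> ?c \<longleftrightarrow> snd p \<in> ?c'"
        using C.\<phi>_conjugate_iff C'.\<phi>_conjugate_iff n eq by auto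
    next
      have "closedin ?Z (?c \<times> ?c' \<union> (carrier M - ?c) \<times> (carrier M' - ?c'))"
        using C.clopen_conjugate[of "\<phi> n"] C'.clopen_conjugate[of "\<phi>' n"] n
          closedin_topspace[of T] closedin_topspace[of T']
        by (intro closedin_Un) (auto simp: closedin_prod_Times_iff)
      moreover have "{p \<in> topspace ?Z. fst p \<in> ?c \<longleftrightarrow> snd p \<in> ?c'} = 
          ?c \<times> ?c' \<union> (carrier M - ?c) \<times> (carrier M' - ?c')"
        using closedin_subset[OF C.clopen_conjugate(2)[of "\<phi> n"]] 
          closedin_subset[OF C'.clopen_conjugate(2)[of "\<phi>' n"]] n by auto
      ultimately show "closedin ?Z {p \<in> topspace ?Z. fst p \<in> ?c \<longleftrightarrow> snd p \<in> ?c'}" by simp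
    qed
    then show ?thesis by simp
  qed
  have corr0: "x \<in> M0 \<longleftrightarrow> y \<in> M0'" if "(x, y) \<in> R" for x y
    using corr[OF that C.N.one_closed] C.conjugate_subgroup_self[OF C.M0(1) subgroup.one_closed[OF C.M0(1)]]
      C'.conjugate_subgroup_self[OF C'.M0(1) subgroup.one_closed[OF C'.M0(1)]] by simp
  have unique: "y = y'" if y: "(x, y) \<in> R" "(x, y') \<in> R" for x y y'
  proof -
    have c: "x \<in> carrier M" "y \<in> carrier M'" "y' \<in> carrier M'" using R_carrier y by auto
    have "inv\<^bsub>M \<times>\<times> M'\<^esub> (x, y) \<otimes>\<^bsub>M \<times>\<times> M'\<^esub> (x, y') \<in> R" using y by blast
    then have r: "(\<one>\<^bsub>M\<^esub>, inv\<^bsub>M'\<^esub> y \<otimes>\<^bsub>M'\<^esub> y') \<in> R"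
      using c by (simp add: C.is_group C'.is_group)
    have "\<one>\<^bsub>M\<^esub> \<in> conjugate M (\<phi> n) M0" if "n \<in> carrier N" for n
      using subgroup.one_closed[OF C.subgroup_conjugate[OF _ C.M0(1)]] that by simp
    then have "inv\<^bsub>M'\<^esub> y \<otimes>\<^bsub>M'\<^esub> y' \<in> (\<Inter>x\<in>\<phi>' ` carrier N. conjugate M' x M0')"
      using corr[OF r] by auto
    then have "inv\<^bsub>M'\<^esub> y \<otimes>\<^bsub>M'\<^esub> y' = \<one>\<^bsub>M'\<^esub>"
      using C'.reduced_pair_dense[OF C'.M0(1,3) C'.dense C'.reduced] by auto
    then show ?thesis using c by (metis C'.inv_cancel_left(1) C'.r_one)
  qed
  \<comment> \<open>The projection of \<open>R \<inter> M0 \<times> M0'\<close> to \<open>M0\<close> is compact, hence closed, and contains the dense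
  subset \<open>\<phi> ` N \<inter> M0\<close>.\<close>
  have total0: "\<exists>y. (x, y) \<in> R" if x: "x \<in> M0" for x
  proof -
    have "compactin ?Z (R \<inter> M0 \<times> M0')"
      using closedR C.M0(2) C'.M0(2) by (intro closed_Int_compactin) (simp_all add: compactin_Times)
    then have "compactin T (fst ` (R \<inter> M0 \<times> M0'))"
      by (rule image_compactin) (rule continuous_map_fst)
    then have "closedin T (fst ` (R \<inter> M0 \<times> M0'))"
      by (rule compactin_imp_closedin[OF C.Hausdorff])
    moreover have "\<phi> ` {x \<in> carrier N. \<phi> x \<in> M0} \<subseteq> fst ` (R \<inter> M0 \<times> M0')"
    proof (intro image_subsetI)
      fix n assume "n \<in> {x \<in> carrier N. \<phi> x \<in> M0}"
      then have "(\<phi> n, \<phi>' n) \<in> R \<inter> M0 \<times> M0'" using graph corr0 by blast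
      then show "\<phi> n \<in> fst ` (R \<inter> M0 \<times> M0')" by force
    qed
    ultimately have "M0 \<subseteq> fst ` (R \<inter> M0 \<times> M0')"
      using closure_of_minimal C.M0_subset_closure by blast
    then show ?thesis using x by force
  qed
  have total: "\<exists>y. (x, y) \<in> R" if x: "x \<in> carrier M" for x
  proof -
    obtain d where d: "d \<in> \<phi> ` carrier N" "d \<in> carrier M" "inv\<^bsub>M\<^esub> d \<otimes>\<^bsub>M\<^esub> x \<in> M0"
      using C.conjugate_by_dense[OF C.M0(1,3) C.dense x] by metis
    then obtain n where n: "n \<in> carrier N" "d = \<phi> n" by blast
    obtain y where "(inv\<^bsub>M\<^esub> d \<otimes>\<^bsub>M\<^esub> x, y) \<in> R" using total0 d by blast
    from R.m_closed[OF graph[OF n(1)] this] show ?thesis using d n(1) x by (auto simp flip: n(2))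
  qed
  define \<Phi> where "\<Phi> x = (THE y. (x, y) \<in> R)" for x
  have \<Phi>: "(x, \<Phi> x) \<in> R" if "x \<in> carrier M" for x
  proof -
    have "\<exists>!y. (x, y) \<in> R" using total[OF that] unique by blast
    then show ?thesis unfolding \<Phi>_def by (rule theI')
  qed
  have \<Phi>_eq: "\<Phi> x = y" if "(x, y) \<in> R" for x y
    using unique[OF that \<Phi>] R_carrier[OF that] by simp
  have hom: "\<Phi> \<in> hom M M'"
  proof (rule homI)
    show "\<Phi> x \<in> carrier M'" if "x \<in> carrier M" for x using R_carrier \<Phi> that by blast
    show "\<Phi> (x \<otimes>\<^bsub>M\<^esub> y) = \<Phi> x \<otimes>\<^bsub>M'\<^esub> \<Phi> y" if "x \<in> carrier M" "y \<in> carrier M" for x y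
      using R.m_closed[OF \<Phi>[OF that(1)] \<Phi>[OF that(2)]] by (intro \<Phi>_eq) simp
  qed
  have "continuous_map T T' \<Phi>"
  proof (rule C.continuous_hom[OF _ hom])
    show "top_group M' T'" by unfold_locales
    fix Q assume "openin T' Q" "\<one>\<^bsub>M'\<^esub> \<in> Q"
    then obtain F where F: "finite F" "F \<subseteq> carrier N" "M0' \<inter> (\<Inter>n\<in>F. conjugate M' (\<phi>' n) M0') \<subseteq> Q"
      by (rule C'.conjugate_base)
    let ?U = "\<Inter>(insert M0 ((\<lambda>n. conjugate M (\<phi> n) M0) ` F))"
    have "openin T ?U"
      using F(1,2) C.M0(3) C.clopen_conjugate(1) by (intro openin_Inter) auto
    moreover have "\<one>\<^bsub>M\<^esub> \<in> ?U"
      using subgroup.one_closed[OF C.subgroup_conjugate[OF _ C.M0(1)]] subgroup.one_closed[OF C.M0(1)] F(2) by auto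
    moreover have "\<Phi> ` ?U \<subseteq> Q"
    proof (intro image_subsetI)
      fix x assume x: "x \<in> ?U"
      then have "x \<in> carrier M" using subgroup.subset[OF C.M0(1)] by auto
      note r = \<Phi>[OF this]
      have "\<Phi> x \<in> M0' \<inter> (\<Inter>n\<in>F. conjugate M' (\<phi>' n) M0')"
        using corr0[OF r] corr[OF r] x F(2) by auto
      then show "\<Phi> x \<in> Q" using F(3) by blast
    qed
    ultimately show "\<exists>U. openin T U \<and> \<one>\<^bsub>M\<^esub> \<in> U \<and> \<Phi> ` U \<subseteq> Q" by blast
  qed
  moreover have "\<Phi> ` M0 \<subseteq> M0'"
    using \<Phi> corr0 subgroup.subset[OF C.M0(1)] by blast
  ultimately show ?thesis using hom \<Phi>_eq graph by blast
qed

text \<open>The extensions in the two directions are mutually inverse on dense subgroups, hence everywhere.\<close>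

theorem reduced_completion_unique:
  fixes N (structure)
  assumes "reduced_completion N M T M0 \<phi>" "reduced_completion N M' T' M0' \<phi>'"
    and eq: "{x \<in> carrier N. \<phi> x \<in> M0} = {x \<in> carrier N. \<phi>' x \<in> M0'}"
  shows "\<exists>\<Phi>. topological_iso M T M' T' \<Phi> \<and> \<Phi> ` M0 = M0' \<and> (\<forall>n\<in>carrier N. \<Phi> (\<phi> n) = \<phi>' n)"
proof -
  interpret C: reduced_completion N M T M0 \<phi> by fact
  interpret C': reduced_completion N M' T' M0' \<phi>' by fact
  obtain \<Phi> where f: "\<Phi> \<in> hom M M'" "continuous_map T T' \<Phi>" "\<Phi> ` M0 \<subseteq> M0'" 
    "\<And>n. n \<in> carrier N \<Longrightarrow> \<Phi> (\<phi> n) = \<phi>' n"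
    using completion_extends[OF assms] by blast
  obtain \<Psi> where g: "\<Psi> \<in> hom M' M" "continuous_map T' T \<Psi>" "\<Psi> ` M0' \<subseteq> M0" 
    "\<And>n. n \<in> carrier N \<Longrightarrow> \<Psi> (\<phi>' n) = \<phi> n"
    using completion_extends[OF assms(2,1) eq[symmetric]] by blast
  have gf: "\<Psi> (\<Phi> x) = x" if "x \<in> carrier M" for x
    by (rule forall_in_closure_of_eq[OF that[folded C.dense] C.Hausdorff 
          continuous_map_compose[OF f(2) g(2), unfolded o_def] continuous_map_id[unfolded id_def]])
       (use f(4) g(4) in auto)
  have fg: "\<Phi> (\<Psi> x) = x" if "x \<in> carrier M'" for x
    by (rule forall_in_closure_of_eq[OF that[folded C'.dense] C'.Hausdorff 
          continuous_map_compose[OF g(2) f(2), unfolded o_def] continuous_map_id[unfolded id_def]])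
       (use f(4) g(4) in auto)
  have cl: "\<Phi> x \<in> carrier M'" if "x \<in> carrier M" for x using f(1) that by (auto simp: hom_def)
  have cl': "\<Psi> x \<in> carrier M" if "x \<in> carrier M'" for x using g(1) that by (auto simp: hom_def)
  have "homeomorphic_maps T T' \<Phi> \<Psi>"
    using f(2) g(2) gf fg by (simp add: homeomorphic_maps_def)
  moreover have "\<Phi> \<in> iso M M'"
    unfolding iso_def using f(1) by (auto intro!: bij_betwI[of _ _ _ \<Psi>] gf fg cl cl')
  ultimately have "topological_iso M T M' T' \<Phi>"
    unfolding topological_iso_def homeomorphic_map_maps by blast
  moreover have "M0' \<subseteq> \<Phi> ` M0"
  proof
    fix y assume y: "y \<in> M0'"
    then have "\<Psi> y \<in> M0" "y = \<Phi> (\<Psi> y)" using g(3) fg subgroup.subset[OF C'.M0(1)] by auto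
    then show "y \<in> \<Phi> ` M0" by blast
  qed
  ultimately show ?thesis using f(3,4) by blast
qed

section \<open>Semidirect products\<close>

locale semidirect_product = V: group V + G: group G
  for V (structure) and G (structure) and \<alpha> +
  assumes action: "\<alpha> \<in> hom G (AutoGroup V)"
begin

abbreviation "SP \<equiv> semidirect V G \<alpha>"

lemma act_auto: "g \<in> carrier G \<Longrightarrow> \<alpha> g \<in> auto V"
  using action by (auto simp: hom_def AutoGroup_def)

lemma act_closed [simp]: "g \<in> carrier G \<Longrightarrow> v \<in> carrier V \<Longrightarrow> \<alpha> g v \<in> carrier V"
  using act_auto by (auto simp: auto_def hom_def)

lemma act_mult [simp]:
  "g \<in> carrier G \<Longrightarrow> v \<in> carrier V \<Longrightarrow> w \<in> carrier V \<Longrightarrow> \<alpha> g (v \<otimes>\<^bsub>V\<^esub> w) = \<alpha> g v \<otimes>\<^bsub>V\<^esub> \<alpha> g w"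
  using act_auto by (auto simp: auto_def hom_def)

lemma act_hom: "g \<in> carrier G \<Longrightarrow> group_hom V V (\<alpha> g)"
  by unfold_locales (use act_auto in \<open>auto simp: auto_def\<close>)

lemma act_one_right [simp]: "g \<in> carrier G \<Longrightarrow> \<alpha> g \<one>\<^bsub>V\<^esub> = \<one>\<^bsub>V\<^esub>"
  using group_hom.hom_one[OF act_hom] .

lemma act_inv [simp]:
  "g \<in> carrier G \<Longrightarrow> v \<in> carrier V \<Longrightarrow> \<alpha> g (inv\<^bsub>V\<^esub> v) = inv\<^bsub>V\<^esub> (\<alpha> g v)"
  using group_hom.hom_inv[OF act_hom] .

lemma act_comp [simp]:
  assumes "g \<in> carrier G" "h \<in> carrier G" "v \<in> carrier V"
  shows "\<alpha> (g \<otimes>\<^bsub>G\<^esub> h) v = \<alpha> g (\<alpha> h v)"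
proof -
  have "\<alpha> (g \<otimes>\<^bsub>G\<^esub> h) = \<alpha> g \<otimes>\<^bsub>AutoGroup V\<^esub> \<alpha> h"
    using action assms by (auto simp: hom_def)
  also have "\<dots> = compose (carrier V) (\<alpha> g) (\<alpha> h)"
    using assms act_auto by (auto simp: AutoGroup_def BijGroup_def auto_def)
  finally show ?thesis using assms by (simp add: compose_def)
qed

lemma act_one [simp]: "v \<in> carrier V \<Longrightarrow> \<alpha> \<one>\<^bsub>G\<^esub> v = v"
  using hom_one[OF action G.is_group V.AutoGroup] by (simp add: AutoGroup_def BijGroup_def)

lemma act_inv_cancel [simp]:
  assumes "g \<in> carrier G" "v \<in> carrier V"
  shows "\<alpha> g (\<alpha> (inv\<^bsub>G\<^esub> g) v) = v" "\<alpha> (inv\<^bsub>G\<^esub> g) (\<alpha> g v) = v"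
  using act_comp[of g "inv\<^bsub>G\<^esub> g" v] act_comp[of "inv\<^bsub>G\<^esub> g" g v] assms by (auto simp del: act_comp)

lemma carrier_SP [simp]: "carrier SP = carrier V \<times> carrier G"
  and one_SP [simp]: "\<one>\<^bsub>SP\<^esub> = (\<one>\<^bsub>V\<^esub>, \<one>\<^bsub>G\<^esub>)"
  and mult_SP [simp]: "(v, g) \<otimes>\<^bsub>SP\<^esub> (w, h) = (v \<otimes>\<^bsub>V\<^esub> \<alpha> g w, g \<otimes>\<^bsub>G\<^esub> h)"
  by (simp_all add: semidirect_def)

lemma group_SP: "group SP"
proof (rule groupI)
  fix x assume "x \<in> carrier SP"
  then show "\<exists>y\<in>carrier SP. y \<otimes>\<^bsub>SP\<^esub> x = \<one>\<^bsub>SP\<^esub>"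
    by (intro bexI[of _ "(\<alpha> (inv\<^bsub>G\<^esub> (snd x)) (inv\<^bsub>V\<^esub> (fst x)), inv\<^bsub>G\<^esub> (snd x))"]) auto
qed (auto simp: V.m_assoc G.m_assoc)

lemma inv_SP [simp]:
  assumes "v \<in> carrier V" "g \<in> carrier G"
  shows "inv\<^bsub>SP\<^esub> (v, g) = (\<alpha> (inv\<^bsub>G\<^esub> g) (inv\<^bsub>V\<^esub> v), inv\<^bsub>G\<^esub> g)"
  by (rule group.inv_equality[OF group_SP]) (use assms in auto)

lemma conj_by_right_factor:
  assumes "u \<in> carrier V" "b \<in> carrier G" "g \<in> carrier G"
  shows "inv\<^bsub>SP\<^esub> (\<one>\<^bsub>V\<^esub>, g) \<otimes>\<^bsub>SP\<^esub> (u, b) \<otimes>\<^bsub>SP\<^esub> (\<one>\<^bsub>V\<^esub>, g)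
    = (\<alpha> (inv\<^bsub>G\<^esub> g) u, inv\<^bsub>G\<^esub> g \<otimes>\<^bsub>G\<^esub> b \<otimes>\<^bsub>G\<^esub> g)"
  using assms by simp

lemma conj_by_left_factor:
  assumes "u \<in> carrier V" "b \<in> carrier G" "v \<in> carrier V"
  shows "inv\<^bsub>SP\<^esub> (v, \<one>\<^bsub>G\<^esub>) \<otimes>\<^bsub>SP\<^esub> (u, b) \<otimes>\<^bsub>SP\<^esub> (v, \<one>\<^bsub>G\<^esub>)
    = (inv\<^bsub>V\<^esub> v \<otimes>\<^bsub>V\<^esub> u \<otimes>\<^bsub>V\<^esub> \<alpha> b v, b)"
  using assms by simp

lemma continuous_map_act:
  assumes "continuous_map (prod_topology S T) T (\<lambda>(g, v). \<alpha> g v)"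
    and "continuous_map X S f" "continuous_map X T h"
  shows "continuous_map X T (\<lambda>x. \<alpha> (f x) (h x))"
  using continuous_map_compose[OF continuous_map_pairedI[OF assms(2,3)] assms(1)] by (simp add: o_def)

lemma top_group_SP:
  assumes "top_group V T" "top_group G S"
    and cont: "continuous_map (prod_topology S T) T (\<lambda>(g, v). \<alpha> g v)"
  shows "top_group SP (prod_topology T S)"
proof -
  interpret V: top_group V T by fact
  interpret G: top_group G S by fact
  let ?Z = "prod_topology T S"
  have "continuous_map (prod_topology ?Z ?Z) ?Z
     (\<lambda>p. (fst (fst p) \<otimes>\<^bsub>V\<^esub> \<alpha> (snd (fst p)) (fst (snd p)), snd (fst p) \<otimes>\<^bsub>G\<^esub> snd (snd p)))"
    using continuous_map_compose[OF continuous_map_fst continuous_map_fst]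
      continuous_map_compose[OF continuous_map_fst continuous_map_snd]
      continuous_map_compose[OF continuous_map_snd continuous_map_fst]
      continuous_map_compose[OF continuous_map_snd continuous_map_snd]
    by (intro continuous_map_pairedI V.continuous_map_mult G.continuous_map_mult continuous_map_act[OF cont]) 
       (simp_all add: o_def)
  moreover have "(\<lambda>p. (fst (fst p) \<otimes>\<^bsub>V\<^esub> \<alpha> (snd (fst p)) (fst (snd p)), snd (fst p) \<otimes>\<^bsub>G\<^esub> snd (snd p)))
     = (\<lambda>(x, y). x \<otimes>\<^bsub>SP\<^esub> y)"
    by (auto simp: fun_eq_iff)
  moreover have "continuous_map ?Z ?Z (\<lambda>p. (\<alpha> (inv\<^bsub>G\<^esub> (snd p)) (inv\<^bsub>V\<^esub> (fst p)), inv\<^bsub>G\<^esub> (snd p)))"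
    by (intro continuous_map_pairedI V.continuous_map_inv G.continuous_map_inv continuous_map_act[OF cont]
        continuous_map_fst continuous_map_snd)
  then have "continuous_map ?Z ?Z (\<lambda>x. inv\<^bsub>SP\<^esub> x)"
    by (rule continuous_map_eq) auto
  ultimately show ?thesis
    by (intro top_groupI) (simp add: topological_group_def group_SP)
qed

end

section \<open>The Hecke condition inside the completion\<close>

text \<open>A map that is constant on the fibres of \<open>c\<close> factors through the image of \<open>c\<close>.\<close>

lemma finite_image_factor:
  assumes "finite (c ` A)" "\<And>x y. x \<in> A \<Longrightarrow> y \<in> A \<Longrightarrow> c x = c y \<Longrightarrow> f x = f y"
  shows "finite (f ` A)"
proof -
  have "f ` A \<subseteq> (\<lambda>z. f (SOME x. x \<in> A \<and> c x = z)) ` (c ` A)"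
  proof
    fix y assume "y \<in> f ` A"
    then obtain x where x: "x \<in> A" "y = f x" by blast
    have "(SOME x'. x' \<in> A \<and> c x' = c x) \<in> A \<and> c (SOME x'. x' \<in> A \<and> c x' = c x) = c x"
      by (rule someI[of _ x]) (use x in simp)
    then have "f (SOME x'. x' \<in> A \<and> c x' = c x) = f x" by (intro assms(2)) (use x in auto)
    then have "y = f (SOME x'. x' \<in> A \<and> c x' = c x)" using x by simp
    then show "y \<in> (\<lambda>z. f (SOME x. x \<in> A \<and> c x = z)) ` (c ` A)" using x by blast
  qed
  then show ?thesis by (rule finite_subset[OF _ finite_imageI[OF assms(1)]])
qed

locale semidirect_completion = semidirect_product V G \<alpha>
  for V :: "'v monoid" and G :: "'g monoid" and \<alpha> +
  fixes V0 and \<Gamma> and W :: "'w monoid" and TW W0 \<phi> and Gt :: "'t monoid" and TGt \<Gamma>t \<rho>t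
  assumes V0: "subgroup V0 V" and \<Gamma>: "subgroup \<Gamma> G"
    and \<Gamma>_V0: "\<forall>\<gamma>\<in>\<Gamma>. \<alpha> \<gamma> ` V0 \<subseteq> V0"
    and hecke: "hecke_pair (semidirect V G \<alpha>) (V0 \<times> \<Gamma>)"
    and schlichting: "is_schlichting_completion (semidirect V G \<alpha>) (V0 \<times> {\<one>\<^bsub>G\<^esub>}) W TW W0 \<phi>"
    and completion: "is_completion G \<Gamma> Gt TGt \<Gamma>t \<rho>t"
begin

sublocale W: reduced_completion SP W TW W0 \<phi>
  by (rule is_schlichting_completion_reduced[OF group_SP schlichting])

text \<open>The two factors of the semidirect product, mapped into the completion \<open>W\<close>.\<close>

abbreviation (input) "j v \<equiv> \<phi> (v, \<one>\<^bsub>G\<^esub>)"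
abbreviation (input) "k g \<equiv> \<phi> (\<one>\<^bsub>V\<^esub>, g)"

definition "B = TW closure_of (\<phi> ` (carrier V \<times> {\<one>\<^bsub>G\<^esub>}))"
abbreviation "Vb \<equiv> W\<lparr>carrier := B\<rparr>"
abbreviation "TVb \<equiv> subtopology TW B"

lemma V0_closed: "v \<in> V0 \<Longrightarrow> v \<in> carrier V" and \<Gamma>_closed: "\<gamma> \<in> \<Gamma> \<Longrightarrow> \<gamma> \<in> carrier G"
  using subgroup.subset[OF V0] subgroup.subset[OF \<Gamma>] by auto

lemma act_V0: "\<gamma> \<in> \<Gamma> \<Longrightarrow> v \<in> V0 \<Longrightarrow> \<alpha> \<gamma> v \<in> V0"
  using \<Gamma>_V0 by blast

lemma preimage_W0: "{n \<in> carrier SP. \<phi> n \<in> W0} = V0 \<times> {\<one>\<^bsub>G\<^esub>}"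
  using schlichting by (simp add: is_schlichting_completion_def)

lemma closure_V0: "TW closure_of (\<phi> ` (V0 \<times> {\<one>\<^bsub>G\<^esub>})) = W0"
  using W.closure_preimage_M0 unfolding preimage_W0 .

lemma j_W0_iff: "v \<in> carrier V \<Longrightarrow> j v \<in> W0 \<longleftrightarrow> v \<in> V0"
  using preimage_W0 by force

lemma \<phi>_closed [simp]: "v \<in> carrier V \<Longrightarrow> g \<in> carrier G \<Longrightarrow> \<phi> (v, g) \<in> carrier W"
  using W.\<phi>.hom_closed by simp

lemma \<phi>_mult: "n \<in> carrier SP \<Longrightarrow> m \<in> carrier SP \<Longrightarrow> \<phi> (n \<otimes>\<^bsub>SP\<^esub> m) = \<phi> n \<otimes>\<^bsub>W\<^esub> \<phi> m"
  by (rule W.\<phi>.hom_mult)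

lemma j_mult: "v \<in> carrier V \<Longrightarrow> w \<in> carrier V \<Longrightarrow> j (v \<otimes>\<^bsub>V\<^esub> w) = j v \<otimes>\<^bsub>W\<^esub> j w"
  using \<phi>_mult[of "(v, \<one>\<^bsub>G\<^esub>)" "(w, \<one>\<^bsub>G\<^esub>)"] by simp

lemma k_mult: "g \<in> carrier G \<Longrightarrow> h \<in> carrier G \<Longrightarrow> k (g \<otimes>\<^bsub>G\<^esub> h) = k g \<otimes>\<^bsub>W\<^esub> k h"
  using \<phi>_mult[of "(\<one>\<^bsub>V\<^esub>, g)" "(\<one>\<^bsub>V\<^esub>, h)"] by simp

lemma j_one: "j \<one>\<^bsub>V\<^esub> = \<one>\<^bsub>W\<^esub>"
  using W.\<phi>.hom_one by simp

lemma k_inv: "g \<in> carrier G \<Longrightarrow> k (inv\<^bsub>G\<^esub> g) = inv\<^bsub>W\<^esub> (k g)"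
  using W.\<phi>.hom_inv[of "(\<one>\<^bsub>V\<^esub>, g)"] by simp

lemma j_inv: "v \<in> carrier V \<Longrightarrow> j (inv\<^bsub>V\<^esub> v) = inv\<^bsub>W\<^esub> (j v)"
  using W.\<phi>.hom_inv[of "(v, \<one>\<^bsub>G\<^esub>)"] by simp

lemma conj_k_j:
  assumes "g \<in> carrier G" "v \<in> carrier V"
  shows "k g \<otimes>\<^bsub>W\<^esub> j v \<otimes>\<^bsub>W\<^esub> inv\<^bsub>W\<^esub> (k g) = j (\<alpha> g v)"
  using assms \<phi>_mult[of "(\<one>\<^bsub>V\<^esub>, g)" "(v, \<one>\<^bsub>G\<^esub>)"] \<phi>_mult[of "(\<alpha> g v, g)" "(\<one>\<^bsub>V\<^esub>, inv\<^bsub>G\<^esub> g)"]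
  by (simp flip: k_inv)

lemma subgroup_V1: "subgroup (carrier V \<times> {\<one>\<^bsub>G\<^esub>}) SP"
  by (rule group.subgroupI[OF group_SP]) auto

lemma subgroup_V0_\<Gamma>: "subgroup (V0 \<times> \<Gamma>) SP"
  using hecke by (simp add: hecke_pair_def)

lemma subgroup_B: "subgroup B W"
  unfolding B_def by (intro W.subgroup_closure W.\<phi>.subgroup_img_is_subgroup subgroup_V1)

lemma B_closed: "u \<in> B \<Longrightarrow> u \<in> carrier W"
  using subgroup.subset[OF subgroup_B] by blast

lemma W0_B: "W0 \<subseteq> B"
  unfolding closure_V0[symmetric] B_def by (rule closure_of_mono) (use V0_closed in auto)

lemma j_B: "v \<in> carrier V \<Longrightarrow> j v \<in> B"
  unfolding B_def by (rule subsetD[OF closure_of_subset]) auto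

text \<open>The subgroup \<open>V0 \<times> \<Gamma>\<close> of the semidirect product normalizes \<open>V0\<close>, and \<open>W0\<close> is the closure of the image of \<open>V0\<close>.\<close>

lemma conj_W0:
  assumes m: "m \<in> V0 \<times> \<Gamma>"
  shows "conjugate W (\<phi> m) W0 = W0"
proof -
  have sub: "conjugate W (\<phi> m) W0 \<subseteq> W0" if m_in: "m \<in> V0 \<times> \<Gamma>" for m
  proof -
    obtain w \<gamma> where m: "m = (w, \<gamma>)" "w \<in> V0" "\<gamma> \<in> \<Gamma>" using m_in by auto
    note c = V0_closed[OF m(2)] \<Gamma>_closed[OF m(3)]
    have *: "\<phi> m \<otimes>\<^bsub>W\<^esub> s \<otimes>\<^bsub>W\<^esub> inv\<^bsub>W\<^esub> (\<phi> m) \<in> \<phi> ` (V0 \<times> {\<one>\<^bsub>G\<^esub>})" if s: "s \<in> \<phi> ` (V0 \<times> {\<one>\<^bsub>G\<^esub>})" for s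
    proof -
      obtain v where v: "v \<in> V0" "s = j v" using s by blast
      note vc = V0_closed[OF v(1)]
      have mc: "m \<in> carrier SP" and vc': "(v, \<one>\<^bsub>G\<^esub>) \<in> carrier SP" using c vc m(1) by simp_all
      have "\<phi> m \<otimes>\<^bsub>W\<^esub> s \<otimes>\<^bsub>W\<^esub> inv\<^bsub>W\<^esub> (\<phi> m) = \<phi> (m \<otimes>\<^bsub>SP\<^esub> (v, \<one>\<^bsub>G\<^esub>) \<otimes>\<^bsub>SP\<^esub> inv\<^bsub>SP\<^esub> m)"
        using W.N.m_closed[OF mc vc'] W.N.inv_closed[OF mc] mc vc' 
        by (simp add: v(2) del: carrier_SP mult_SP inv_SP)
      also have "m \<otimes>\<^bsub>SP\<^esub> (v, \<one>\<^bsub>G\<^esub>) \<otimes>\<^bsub>SP\<^esub> inv\<^bsub>SP\<^esub> m = (w \<otimes>\<^bsub>V\<^esub> \<alpha> \<gamma> v \<otimes>\<^bsub>V\<^esub> inv\<^bsub>V\<^esub> w, \<one>\<^bsub>G\<^esub>)"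
        using c vc by (simp add: m(1))
      finally have e: "\<phi> m \<otimes>\<^bsub>W\<^esub> s \<otimes>\<^bsub>W\<^esub> inv\<^bsub>W\<^esub> (\<phi> m) = j (w \<otimes>\<^bsub>V\<^esub> \<alpha> \<gamma> v \<otimes>\<^bsub>V\<^esub> inv\<^bsub>V\<^esub> w)" .
      have "(w \<otimes>\<^bsub>V\<^esub> \<alpha> \<gamma> v \<otimes>\<^bsub>V\<^esub> inv\<^bsub>V\<^esub> w, \<one>\<^bsub>G\<^esub>) \<in> V0 \<times> {\<one>\<^bsub>G\<^esub>}"
        using m(2) act_V0[OF m(3) v(1)] subgroup.m_closed[OF V0] subgroup.m_inv_closed[OF V0] by simp
      then show ?thesis unfolding e by (rule imageI)
    qed
    have "\<phi> m \<otimes>\<^bsub>W\<^esub> h \<otimes>\<^bsub>W\<^esub> inv\<^bsub>W\<^esub> (\<phi> m) \<in> W0" if "h \<in> W0" for h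
      using W.closure_conjugate[of "\<phi> m" "\<phi> ` (V0 \<times> {\<one>\<^bsub>G\<^esub>})" "\<phi> ` (V0 \<times> {\<one>\<^bsub>G\<^esub>})" h] * that c
      unfolding closure_V0 by (simp add: m(1))
    then show ?thesis by (auto simp: W.conjugate_eq_image)
  qed
  have mc: "m \<in> carrier SP" using subgroup.subset[OF subgroup_V0_\<Gamma>] m by blast
  have i: "inv\<^bsub>SP\<^esub> m \<in> V0 \<times> \<Gamma>" using subgroup.m_inv_closed[OF subgroup_V0_\<Gamma> m] .
  have W0c: "W0 \<subseteq> carrier W" by (rule subgroup.subset[OF W.M0(1)])
  have "W0 = conjugate W (\<phi> m) (conjugate W (\<phi> (inv\<^bsub>SP\<^esub> m)) W0)"
    using W.conjugate_mult[of "\<phi> m" "\<phi> (inv\<^bsub>SP\<^esub> m)" W0] mc W0c 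
      W.conjugate_subgroup_self[OF W.M0(1) subgroup.one_closed[OF W.M0(1)]]
    by (simp add: W.\<phi>.hom_closed del: carrier_SP)
  also have "\<dots> \<subseteq> conjugate W (\<phi> m) W0"
    using sub[OF i] by (auto simp: W.conjugate_eq_image)
  finally show ?thesis using sub[OF m] by blast
qed

text \<open>The Hecke condition in the form in which it is applied. With \<open>H = (V0 \<times> \<Gamma>) \<inter> n (V0 \<times> \<Gamma>) n\<^sup>-\<^sup>1\<close>, the
  hypothesis on \<open>f\<close> says that \<open>f \<gamma>\<close> depends only on the right coset \<open>H \<gamma>\<close>, of which there are
  finitely many.\<close>

lemma finite_\<Gamma>_image:
  assumes n: "n \<in> carrier SP"
    and f: "\<And>\<gamma> \<eta>. \<gamma> \<in> \<Gamma> \<Longrightarrow> \<eta> \<in> \<Gamma> \<Longrightarrow>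
      inv\<^bsub>SP\<^esub> n \<otimes>\<^bsub>SP\<^esub> (\<one>\<^bsub>V\<^esub>, \<gamma> \<otimes>\<^bsub>G\<^esub> inv\<^bsub>G\<^esub> \<eta>) \<otimes>\<^bsub>SP\<^esub> n \<in> V0 \<times> \<Gamma> \<Longrightarrow> f \<gamma> = f \<eta>"
  shows "finite (f ` \<Gamma>)"
proof (rule finite_image_factor)
  let ?N = "SP\<lparr>carrier := V0 \<times> \<Gamma>\<rparr>" and ?H = "V0 \<times> \<Gamma> \<inter> conjugate SP n (V0 \<times> \<Gamma>)"
  let ?c = "\<lambda>\<gamma>. ?H #>\<^bsub>?N\<^esub> (\<one>\<^bsub>V\<^esub>, \<gamma>)"
  note sub = subgroup_V0_\<Gamma>
  have "finite (rcosets\<^bsub>?N\<^esub> ?H)" using hecke n unfolding hecke_pair_def by blast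
  moreover have "?c ` \<Gamma> \<subseteq> rcosets\<^bsub>?N\<^esub> ?H"
    using subgroup.one_closed[OF V0] by (auto simp: RCOSETS_def)
  ultimately show "finite (?c ` \<Gamma>)" by (rule rev_finite_subset)
  fix \<gamma> \<eta> assume g: "\<gamma> \<in> \<Gamma>" "\<eta> \<in> \<Gamma>" "?c \<gamma> = ?c \<eta>"
  note gc = \<Gamma>_closed[OF g(1)] \<Gamma>_closed[OF g(2)]
  have H: "subgroup ?H SP"
    using group.subgroups_Inter_pair[OF group_SP sub group.subgroup_conjugate[OF group_SP n sub]] .
  have "(\<one>\<^bsub>V\<^esub>, \<gamma>) \<in> ?H #>\<^bsub>SP\<^esub> (\<one>\<^bsub>V\<^esub>, \<gamma>)"
    using group.rcos_self[OF group_SP _ H] gc by simp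
  moreover have "?H #>\<^bsub>?N\<^esub> x = ?H #>\<^bsub>SP\<^esub> x" for x by (simp add: r_coset_def)
  ultimately have "(\<one>\<^bsub>V\<^esub>, \<gamma>) \<in> ?H #>\<^bsub>SP\<^esub> (\<one>\<^bsub>V\<^esub>, \<eta>)"
    using g(3) by blast
  then have "(\<one>\<^bsub>V\<^esub>, \<gamma>) \<otimes>\<^bsub>SP\<^esub> inv\<^bsub>SP\<^esub> (\<one>\<^bsub>V\<^esub>, \<eta>) \<in> ?H"
    using group.mem_r_coset_iff[OF group_SP subgroup.subset[OF H]] gc by (metis SigmaI V.one_closed carrier_SP)
  then have "(\<one>\<^bsub>V\<^esub>, \<gamma> \<otimes>\<^bsub>G\<^esub> inv\<^bsub>G\<^esub> \<eta>) \<in> conjugate SP n (V0 \<times> \<Gamma>)" using gc by simp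
  then show "f \<gamma> = f \<eta>"
    using f[OF g(1,2)] group.mem_conjugate_iff[OF group_SP n subgroup.subset[OF sub]] by blast
qed

text \<open>For each of the finitely many conjugates of \<open>W0\<close> needed to get inside \<open>Q\<close>, the subgroups
  obtained from it by conjugation with elements of \<open>\<Gamma>\<close> form a finite set by the Hecke condition.
  The intersection of all of them is therefore still open, and it is invariant under \<open>\<Gamma>\<close>.\<close>

lemma invariant_subgroup:
  assumes Q: "openin TW Q" "\<one>\<^bsub>W\<^esub> \<in> Q"
  shows "\<exists>U. subgroup U W \<and> openin TW U \<and> compactin TW U \<and> U \<subseteq> Q \<and> U \<subseteq> W0 \<and>
           (\<forall>\<gamma>\<in>\<Gamma>. \<forall>u\<in>U. k \<gamma> \<otimes>\<^bsub>W\<^esub> u \<otimes>\<^bsub>W\<^esub> inv\<^bsub>W\<^esub> (k \<gamma>) \<in> U)"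
proof -
  obtain F where F: "finite F" "F \<subseteq> carrier SP" "W0 \<inter> (\<Inter>n\<in>F. conjugate W (\<phi> n) W0) \<subseteq> Q"
    using W.conjugate_base[OF Q] .
  let ?F = "insert \<one>\<^bsub>SP\<^esub> F"
  have Fc: "n \<in> carrier SP" if "n \<in> ?F" for n
    using that F(2) monoid.one_closed[OF group.is_monoid[OF group_SP]] by auto
  \<comment> \<open>The inverse of \<open>\<gamma>\<close> appears because the Hecke condition counts right cosets \<open>H \<gamma>\<close>.\<close>
  define c where "c n \<gamma> = conjugate W (\<phi> ((\<one>\<^bsub>V\<^esub>, inv\<^bsub>G\<^esub> \<gamma>) \<otimes>\<^bsub>SP\<^esub> n)) W0" for n \<gamma>
  define I where "I = (\<Union>n\<in>?F. c n ` \<Gamma>)"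
  have W0c: "W0 \<subseteq> carrier W" by (rule subgroup.subset[OF W.M0(1)])
  have cin: "(\<one>\<^bsub>V\<^esub>, inv\<^bsub>G\<^esub> \<gamma>) \<otimes>\<^bsub>SP\<^esub> n \<in> carrier SP" if "n \<in> ?F" "\<gamma> \<in> \<Gamma>" for n \<gamma>
    using Fc[OF that(1)] \<Gamma>_closed[OF that(2)] by (intro W.N.m_closed) simp_all
  have "finite (c n ` \<Gamma>)" if n: "n \<in> ?F" for n
  proof (rule finite_\<Gamma>_image[OF Fc[OF n]])
    fix \<gamma> \<eta> assume g: "\<gamma> \<in> \<Gamma>" "\<eta> \<in> \<Gamma>"
      and m: "inv\<^bsub>SP\<^esub> n \<otimes>\<^bsub>SP\<^esub> (\<one>\<^bsub>V\<^esub>, \<gamma> \<otimes>\<^bsub>G\<^esub> inv\<^bsub>G\<^esub> \<eta>) \<otimes>\<^bsub>SP\<^esub> n \<in> V0 \<times> \<Gamma>" (is "?m \<in> _")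
    note gc = \<Gamma>_closed[OF g(1)] \<Gamma>_closed[OF g(2)] and nc = Fc[OF n]
    have kc: "(\<one>\<^bsub>V\<^esub>, \<gamma> \<otimes>\<^bsub>G\<^esub> inv\<^bsub>G\<^esub> \<eta>) \<in> carrier SP" "(\<one>\<^bsub>V\<^esub>, inv\<^bsub>G\<^esub> \<gamma>) \<in> carrier SP" using gc by simp_all
    have "(\<one>\<^bsub>V\<^esub>, inv\<^bsub>G\<^esub> \<gamma>) \<otimes>\<^bsub>SP\<^esub> n \<otimes>\<^bsub>SP\<^esub> ?m = (\<one>\<^bsub>V\<^esub>, inv\<^bsub>G\<^esub> \<gamma>) \<otimes>\<^bsub>SP\<^esub> (\<one>\<^bsub>V\<^esub>, \<gamma> \<otimes>\<^bsub>G\<^esub> inv\<^bsub>G\<^esub> \<eta>) \<otimes>\<^bsub>SP\<^esub> n"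
      using nc kc by (simp add: W.N.m_assoc del: carrier_SP mult_SP inv_SP)
    also have "(\<one>\<^bsub>V\<^esub>, inv\<^bsub>G\<^esub> \<gamma>) \<otimes>\<^bsub>SP\<^esub> (\<one>\<^bsub>V\<^esub>, \<gamma> \<otimes>\<^bsub>G\<^esub> inv\<^bsub>G\<^esub> \<eta>) = (\<one>\<^bsub>V\<^esub>, inv\<^bsub>G\<^esub> \<eta>)"
      using gc by simp
    finally have eq: "(\<one>\<^bsub>V\<^esub>, inv\<^bsub>G\<^esub> \<eta>) \<otimes>\<^bsub>SP\<^esub> n = (\<one>\<^bsub>V\<^esub>, inv\<^bsub>G\<^esub> \<gamma>) \<otimes>\<^bsub>SP\<^esub> n \<otimes>\<^bsub>SP\<^esub> ?m" ..
    have mc: "?m \<in> carrier SP" by (rule subsetD[OF subgroup.subset[OF subgroup_V0_\<Gamma>] m])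
    have "c n \<eta> = conjugate W (\<phi> ((\<one>\<^bsub>V\<^esub>, inv\<^bsub>G\<^esub> \<gamma>) \<otimes>\<^bsub>SP\<^esub> n) \<otimes>\<^bsub>W\<^esub> \<phi> ?m) W0"
      unfolding c_def eq by (simp only: \<phi>_mult[OF cin[OF n g(1)] mc])
    also have "\<dots> = conjugate W (\<phi> ((\<one>\<^bsub>V\<^esub>, inv\<^bsub>G\<^esub> \<gamma>) \<otimes>\<^bsub>SP\<^esub> n)) (conjugate W (\<phi> ?m) W0)"
      by (rule W.conjugate_mult[OF W.\<phi>.hom_closed[OF cin[OF n g(1)]] W.\<phi>.hom_closed[OF mc] W0c, symmetric])
    finally show "c n \<gamma> = c n \<eta>" unfolding conj_W0[OF m] c_def by (rule sym)
  qed
  then have "finite I" using F(1) by (simp add: I_def)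
  have one_\<Gamma>: "\<one>\<^bsub>G\<^esub> \<in> \<Gamma>" using subgroup.one_closed[OF \<Gamma>] .
  have c1: "c n \<one>\<^bsub>G\<^esub> = conjugate W (\<phi> n) W0" if "n \<in> ?F" for n
    using Fc[OF that] by (cases n) (simp add: c_def)
  have c11: "c \<one>\<^bsub>SP\<^esub> \<one>\<^bsub>G\<^esub> = W0"
    using c1[of "\<one>\<^bsub>SP\<^esub>"] W.conjugate_subgroup_self[OF W.M0(1) subgroup.one_closed[OF W.M0(1)]]
    by (simp add: j_one)
  have in_I: "c n \<gamma> \<in> I" if "n \<in> ?F" "\<gamma> \<in> \<Gamma>" for n \<gamma> using that by (auto simp: I_def)
  have I: "subgroup X W \<and> openin TW X \<and> closedin TW X" if "X \<in> I" for X
    using that W.subgroup_conjugate[OF W.\<phi>.hom_closed[OF cin] W.M0(1)] 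
      W.clopen_conjugate[OF W.\<phi>.hom_closed[OF cin]] by (auto simp: I_def c_def simp del: carrier_SP)
  have ne: "I \<noteq> {}" using in_I one_\<Gamma> by blast
  have W0I: "W0 \<in> I" using in_I[of "\<one>\<^bsub>SP\<^esub>" "\<one>\<^bsub>G\<^esub>"] one_\<Gamma> c11 by simp
  have "subgroup (\<Inter>I) W" using W.subgroup_INT[of I "\<lambda>X. X"] I ne by simp
  moreover have "openin TW (\<Inter>I)" using I \<open>finite I\<close> ne by (intro openin_Inter) auto
  moreover have "\<Inter>I \<subseteq> W0" using W0I by blast
  moreover have "closedin TW (\<Inter>I)" using I ne by (intro closedin_Inter) auto
  then have "compactin TW (\<Inter>I)" using \<open>\<Inter>I \<subseteq> W0\<close> by (intro closed_compactin[OF W.M0(2)])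
  moreover have "\<Inter>I \<subseteq> Q"
    using F(3) in_I[OF _ one_\<Gamma>] c1 W0I by blast
  moreover have "k \<gamma> \<otimes>\<^bsub>W\<^esub> u \<otimes>\<^bsub>W\<^esub> inv\<^bsub>W\<^esub> (k \<gamma>) \<in> \<Inter>I" if g: "\<gamma> \<in> \<Gamma>" and u: "u \<in> \<Inter>I" for \<gamma> u
  proof
    fix X assume "X \<in> I"
    then obtain n \<eta> where n: "n \<in> ?F" "\<eta> \<in> \<Gamma>" "X = c n \<eta>" by (auto simp: I_def)
    note gc = \<Gamma>_closed[OF g] \<Gamma>_closed[OF n(2)]
    have eg: "\<eta> \<otimes>\<^bsub>G\<^esub> \<gamma> \<in> \<Gamma>" using subgroup.m_closed[OF \<Gamma>] n g by blast
    have Xc: "X \<subseteq> carrier W" using I \<open>X \<in> I\<close> subgroup.subset by blast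
    have "(\<one>\<^bsub>V\<^esub>, inv\<^bsub>G\<^esub> (\<eta> \<otimes>\<^bsub>G\<^esub> \<gamma>)) \<otimes>\<^bsub>SP\<^esub> n = (\<one>\<^bsub>V\<^esub>, inv\<^bsub>G\<^esub> \<gamma>) \<otimes>\<^bsub>SP\<^esub> ((\<one>\<^bsub>V\<^esub>, inv\<^bsub>G\<^esub> \<eta>) \<otimes>\<^bsub>SP\<^esub> n)"
      using gc Fc[OF n(1)] by (cases n) (simp add: G.inv_mult_group G.m_assoc)
    then have "c n (\<eta> \<otimes>\<^bsub>G\<^esub> \<gamma>) = conjugate W (k (inv\<^bsub>G\<^esub> \<gamma>) \<otimes>\<^bsub>W\<^esub> \<phi> ((\<one>\<^bsub>V\<^esub>, inv\<^bsub>G\<^esub> \<eta>) \<otimes>\<^bsub>SP\<^esub> n)) W0"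
      unfolding c_def using \<phi>_mult[of "(\<one>\<^bsub>V\<^esub>, inv\<^bsub>G\<^esub> \<gamma>)", OF _ cin[OF n(1,2)]] gc by simp
    also have "\<dots> = conjugate W (inv\<^bsub>W\<^esub> (k \<gamma>)) X"
      using W.conjugate_mult[OF _ W.\<phi>.hom_closed[OF cin[OF n(1,2)]] W0c, of "k (inv\<^bsub>G\<^esub> \<gamma>)"] gc
      by (simp add: n(3) c_def k_inv)
    finally have "u \<in> conjugate W (inv\<^bsub>W\<^esub> (k \<gamma>)) X" using u in_I[OF n(1) eg] by blast
    then show "k \<gamma> \<otimes>\<^bsub>W\<^esub> u \<otimes>\<^bsub>W\<^esub> inv\<^bsub>W\<^esub> (k \<gamma>) \<in> X"
      using W.mem_conjugate_iff[OF _ Xc, of "inv\<^bsub>W\<^esub> (k \<gamma>)" u] gc by simp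
  qed
  ultimately show ?thesis by blast
qed

text \<open>If \<open>u \<in> j(v) W0\<close>, then the \<open>\<Gamma>\<close>-orbit of \<open>u\<close> is contained in the union of the compact cosets
  \<open>j(\<gamma> v) W0\<close>, and by the Hecke condition only finitely many of these are distinct.\<close>

lemma orbit_in_compact:
  assumes u: "u \<in> B"
  shows "\<exists>K. compactin TW K \<and> K \<subseteq> B \<and> (\<forall>\<gamma>\<in>\<Gamma>. k \<gamma> \<otimes>\<^bsub>W\<^esub> u \<otimes>\<^bsub>W\<^esub> inv\<^bsub>W\<^esub> (k \<gamma>) \<in> K)"
proof -
  obtain d where d: "d \<in> \<phi> ` (carrier V \<times> {\<one>\<^bsub>G\<^esub>})" "inv\<^bsub>W\<^esub> d \<otimes>\<^bsub>W\<^esub> u \<in> W0"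
    using W.closure_coset_meets[OF u[unfolded B_def] W.M0(3) subgroup.one_closed[OF W.M0(1)]] by metis
  then obtain v where v: "v \<in> carrier V" "d = j v" by blast
  define w where "w = inv\<^bsub>W\<^esub> (j v) \<otimes>\<^bsub>W\<^esub> u"
  have w: "w \<in> W0" "u = j v \<otimes>\<^bsub>W\<^esub> w" 
    using d(2) v B_closed[OF u] by (simp_all add: w_def)
  have W0c: "W0 \<subseteq> carrier W" by (rule subgroup.subset[OF W.M0(1)])
  define f where "f \<gamma> = j (\<alpha> (inv\<^bsub>G\<^esub> \<gamma>) v) <#\<^bsub>W\<^esub> W0" for \<gamma>
  have "finite (f ` \<Gamma>)"
  proof (rule finite_\<Gamma>_image[of "(v, \<one>\<^bsub>G\<^esub>)"])
    fix \<gamma> \<eta> assume g: "\<gamma> \<in> \<Gamma>" "\<eta> \<in> \<Gamma>"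
      and m: "inv\<^bsub>SP\<^esub> (v, \<one>\<^bsub>G\<^esub>) \<otimes>\<^bsub>SP\<^esub> (\<one>\<^bsub>V\<^esub>, \<gamma> \<otimes>\<^bsub>G\<^esub> inv\<^bsub>G\<^esub> \<eta>) \<otimes>\<^bsub>SP\<^esub> (v, \<one>\<^bsub>G\<^esub>) \<in> V0 \<times> \<Gamma>"
    note gc = \<Gamma>_closed[OF g(1)] \<Gamma>_closed[OF g(2)]
    \<comment> \<open>The element \<open>v0\<close> is the first component of the conjugate in \<open>m\<close>.\<close>
    define v0 where "v0 = inv\<^bsub>V\<^esub> v \<otimes>\<^bsub>V\<^esub> \<alpha> (\<gamma> \<otimes>\<^bsub>G\<^esub> inv\<^bsub>G\<^esub> \<eta>) v"
    have v0: "v0 \<in> V0" using m gc v(1) by (simp add: v0_def del: act_comp)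
    have "v \<otimes>\<^bsub>V\<^esub> v0 = \<alpha> \<gamma> (\<alpha> (inv\<^bsub>G\<^esub> \<eta>) v)" using gc v(1) by (simp add: v0_def)
    then have "\<alpha> (inv\<^bsub>G\<^esub> \<eta>) v = \<alpha> (inv\<^bsub>G\<^esub> \<gamma>) (v \<otimes>\<^bsub>V\<^esub> v0)" using gc v(1) by simp
    also have "\<dots> = \<alpha> (inv\<^bsub>G\<^esub> \<gamma>) v \<otimes>\<^bsub>V\<^esub> \<alpha> (inv\<^bsub>G\<^esub> \<gamma>) v0" using gc v(1) V0_closed[OF v0] by simp
    finally have e: "j (\<alpha> (inv\<^bsub>G\<^esub> \<eta>) v) = j (\<alpha> (inv\<^bsub>G\<^esub> \<gamma>) v) \<otimes>\<^bsub>W\<^esub> j (\<alpha> (inv\<^bsub>G\<^esub> \<gamma>) v0)"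
      using gc v(1) V0_closed[OF v0] by (simp add: j_mult)
    have "\<alpha> (inv\<^bsub>G\<^esub> \<gamma>) v0 \<in> V0" using act_V0[OF subgroup.m_inv_closed[OF \<Gamma> g(1)] v0] .
    then have "j (\<alpha> (inv\<^bsub>G\<^esub> \<gamma>) v0) \<in> W0" using j_W0_iff V0_closed by blast
    then show "f \<gamma> = f \<eta>"
      unfolding f_def e using W.l_coset_mult_subgroup[OF W.M0(1)] gc v(1) by simp
  qed (use v in simp)
  moreover have "compactin TW (f \<gamma>)" "f \<gamma> \<subseteq> B" if g: "\<gamma> \<in> \<Gamma>" for \<gamma>
  proof -
    note gc = \<Gamma>_closed[OF g]
    have e: "f \<gamma> = {j (\<alpha> (inv\<^bsub>G\<^esub> \<gamma>) v)} <#>\<^bsub>W\<^esub> W0" by (simp add: f_def l_coset_eq_set_mult)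
    show "compactin TW (f \<gamma>)"
      unfolding e by (rule W.compactin_set_mult[OF _ W.M0(2)]) (use gc v in simp)
    show "f \<gamma> \<subseteq> B" unfolding f_def l_coset_def
      using W0_B j_B[of "\<alpha> (inv\<^bsub>G\<^esub> \<gamma>) v"] gc v(1) subgroup.m_closed[OF subgroup_B] by auto
  qed
  ultimately have "compactin TW (\<Union>(f ` \<Gamma>))" "\<Union>(f ` \<Gamma>) \<subseteq> B"
    by (auto intro: compactin_Union)
  moreover have "k \<gamma> \<otimes>\<^bsub>W\<^esub> u \<otimes>\<^bsub>W\<^esub> inv\<^bsub>W\<^esub> (k \<gamma>) \<in> \<Union>(f ` \<Gamma>)" if g: "\<gamma> \<in> \<Gamma>" for \<gamma>
  proof -
    note gc = \<Gamma>_closed[OF g]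
    have wc: "w \<in> carrier W" using w(1) W0c by blast
    have "k \<gamma> \<otimes>\<^bsub>W\<^esub> u \<otimes>\<^bsub>W\<^esub> inv\<^bsub>W\<^esub> (k \<gamma>) = 
        (k \<gamma> \<otimes>\<^bsub>W\<^esub> j v \<otimes>\<^bsub>W\<^esub> inv\<^bsub>W\<^esub> (k \<gamma>)) \<otimes>\<^bsub>W\<^esub> (k \<gamma> \<otimes>\<^bsub>W\<^esub> w \<otimes>\<^bsub>W\<^esub> inv\<^bsub>W\<^esub> (k \<gamma>))"
      using gc v(1) wc by (simp add: w(2) W.m_assoc)
    also have "\<dots> = j (\<alpha> \<gamma> v) \<otimes>\<^bsub>W\<^esub> (k \<gamma> \<otimes>\<^bsub>W\<^esub> w \<otimes>\<^bsub>W\<^esub> inv\<^bsub>W\<^esub> (k \<gamma>))"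
      using conj_k_j[OF gc v(1)] by simp
    also have "k \<gamma> \<otimes>\<^bsub>W\<^esub> w \<otimes>\<^bsub>W\<^esub> inv\<^bsub>W\<^esub> (k \<gamma>) \<in> W0"
      using conj_W0[of "(\<one>\<^bsub>V\<^esub>, \<gamma>)"] g subgroup.one_closed[OF V0] w(1) by (auto simp: W.conjugate_eq_image)
    then have "j (\<alpha> \<gamma> v) \<otimes>\<^bsub>W\<^esub> (k \<gamma> \<otimes>\<^bsub>W\<^esub> w \<otimes>\<^bsub>W\<^esub> inv\<^bsub>W\<^esub> (k \<gamma>)) \<in> f (inv\<^bsub>G\<^esub> \<gamma>)"
      using gc by (auto simp: f_def l_coset_def)
    finally show ?thesis using subgroup.m_inv_closed[OF \<Gamma> g] by blast
  qed
  ultimately show ?thesis by blast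
qed

definition "ad g = Ad W B (k g)"

lemma ad_apply: "u \<in> B \<Longrightarrow> ad g u = k g \<otimes>\<^bsub>W\<^esub> u \<otimes>\<^bsub>W\<^esub> inv\<^bsub>W\<^esub> (k g)"
  by (simp add: ad_def Ad_def)

lemma ad_j: "g \<in> carrier G \<Longrightarrow> v \<in> carrier V \<Longrightarrow> ad g (j v) = j (\<alpha> g v)"
  using conj_k_j by (simp add: ad_apply j_B)

lemma ad_B:
  assumes "g \<in> carrier G" "u \<in> B"
  shows "ad g u \<in> B"
proof -
  have "k g \<otimes>\<^bsub>W\<^esub> s \<otimes>\<^bsub>W\<^esub> inv\<^bsub>W\<^esub> (k g) \<in> \<phi> ` (carrier V \<times> {\<one>\<^bsub>G\<^esub>})" 
    if s: "s \<in> \<phi> ` (carrier V \<times> {\<one>\<^bsub>G\<^esub>})" for s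
    using s assms(1) conj_k_j by auto
  then show ?thesis
    using W.closure_conjugate[OF _ _ assms(2)[unfolded B_def], where x = "k g"] assms ad_apply[of u g] by (simp add: B_def)
qed

lemma ad_comp: "g \<in> carrier G \<Longrightarrow> h \<in> carrier G \<Longrightarrow> u \<in> B \<Longrightarrow> ad (g \<otimes>\<^bsub>G\<^esub> h) u = ad g (ad h u)"
  using B_closed[of u] ad_B[of h u] by (simp add: ad_apply k_mult W.inv_mult_group W.m_assoc)

lemma ad_one: "u \<in> B \<Longrightarrow> ad \<one>\<^bsub>G\<^esub> u = u"
  using B_closed[of u] by (simp add: ad_apply j_one)

lemma ad_inv_cancel: 
  assumes "g \<in> carrier G" "u \<in> B" 
  shows "ad (inv\<^bsub>G\<^esub> g) (ad g u) = u" "ad g (ad (inv\<^bsub>G\<^esub> g) u) = u"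
  using ad_comp[of "inv\<^bsub>G\<^esub> g" g u] ad_comp[of g "inv\<^bsub>G\<^esub> g" u] assms by (auto simp: ad_one)

lemma top_group_Vb: "top_group Vb TVb"
  by (rule W.top_group_subgroup[OF subgroup_B])

sublocale Vb: tdlc_group Vb TVb
proof -
  interpret Vb: top_group Vb TVb by (rule top_group_Vb)
  show "tdlc_group Vb TVb"
  proof unfold_locales
    show "Hausdorff_space TVb" by (rule Hausdorff_space_subtopology[OF W.Hausdorff])
    fix Q assume "openin TVb Q" "\<one>\<^bsub>Vb\<^esub> \<in> Q"
    then obtain Q' where Q': "openin TW Q'" "Q = Q' \<inter> B" "\<one>\<^bsub>W\<^esub> \<in> Q'" by (auto simp: openin_subtopology)
    obtain U where U: "subgroup U W" "openin TW U" "compactin TW U" "U \<subseteq> Q'" "U \<subseteq> W0"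
      using invariant_subgroup[OF Q'(1,3)] by blast
    have UB: "U \<subseteq> B" using U(5) W0_B by blast
    have "subgroup U Vb" by (rule W.subgroup_incl[OF U(1) subgroup_B UB])
    moreover have "openin TVb U" using U(2) UB by (auto simp: openin_subtopology)
    moreover have "compactin TVb U" using U(3) UB by (simp add: compactin_subtopology)
    ultimately show "\<exists>U. subgroup U Vb \<and> openin TVb U \<and> compactin TVb U \<and> U \<subseteq> Q"
      using U(4) UB Q'(2) by blast
  qed
qed

lemma ad_HAut:
  assumes g: "g \<in> carrier G"
  shows "ad g \<in> carrier (HAut Vb TVb)"
proof -
  have cont: "continuous_map TVb TVb (ad h)" if h: "h \<in> carrier G" for h
  proof (rule continuous_map_eq)
    have "continuous_map TW TW (\<lambda>u. k h \<otimes>\<^bsub>W\<^esub> u \<otimes>\<^bsub>W\<^esub> inv\<^bsub>W\<^esub> (k h))"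
      using h by (intro W.continuous_map_mult) auto
    then show "continuous_map TVb TVb (\<lambda>u. k h \<otimes>\<^bsub>W\<^esub> u \<otimes>\<^bsub>W\<^esub> inv\<^bsub>W\<^esub> (k h))"
      unfolding continuous_map_in_subtopology
      using ad_B[OF h] by (auto simp: ad_apply intro: continuous_map_from_subtopology)
  qed (simp add: ad_apply)
  have "homeomorphic_maps TVb TVb (ad g) (ad (inv\<^bsub>G\<^esub> g))"
    using cont g ad_inv_cancel by (simp add: homeomorphic_maps_def)
  moreover have "bij_betw (ad g) B B"
    by (rule bij_betwI[of _ _ _ "ad (inv\<^bsub>G\<^esub> g)"]) (use g ad_inv_cancel ad_B in auto)
  moreover have "ad g \<in> extensional B" by (simp add: ad_def Ad_def)
  moreover have "ad g \<in> hom Vb Vb"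
    using ad_B[OF g] B_closed subgroup.m_closed[OF subgroup_B] g
    by (auto simp: hom_def ad_apply W.m_assoc)
  ultimately show ?thesis
    by (auto simp: Vb.HAut_carrier Bij_def homeomorphic_map_maps)
qed

lemma ad_hom: "ad \<in> hom G (HAut Vb TVb)"
proof (rule homI)
  fix g h assume g: "g \<in> carrier G" and h: "h \<in> carrier G"
  note A = ad_HAut[OF g] ad_HAut[OF h] ad_HAut[OF G.m_closed[OF g h]]
  show "ad (g \<otimes>\<^bsub>G\<^esub> h) = ad g \<otimes>\<^bsub>HAut Vb TVb\<^esub> ad h"
  proof (rule Vb.HAut_eqI[OF A(3) Vb.HAut_m_closed[OF A(1,2)]])
    fix u assume u: "u \<in> carrier Vb"
    then have "ad (g \<otimes>\<^bsub>G\<^esub> h) u = ad g (ad h u)" using ad_comp[OF g h] by simp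
    then show "ad (g \<otimes>\<^bsub>G\<^esub> h) u = (ad g \<otimes>\<^bsub>HAut Vb TVb\<^esub> ad h) u"
      using Vb.HAut_mult_apply[OF A(1,2) u] by simp
  qed
qed (rule ad_HAut)

sublocale Vb: relatively_compact_automorphisms Vb TVb "ad ` \<Gamma>"
proof (intro relatively_compact_automorphisms.intro relatively_compact_automorphisms_axioms.intro)
  show "tdlc_group Vb TVb" by unfold_locales
next
  interpret ad: group_hom G "HAut Vb TVb" ad
    by (intro group_hom.intro group_hom_axioms.intro G.is_group Vb.group_HAut ad_hom)
  show "subgroup (ad ` \<Gamma>) (HAut Vb TVb)" by (rule ad.subgroup_img_is_subgroup[OF \<Gamma>])
next
  fix Q assume "openin TVb Q" "\<one>\<^bsub>Vb\<^esub> \<in> Q"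
  then obtain Q' where Q': "openin TW Q'" "Q = Q' \<inter> B" "\<one>\<^bsub>W\<^esub> \<in> Q'" by (auto simp: openin_subtopology)
  obtain U where U: "subgroup U W" "openin TW U" "compactin TW U" "U \<subseteq> Q'" "U \<subseteq> W0"
      "\<forall>\<gamma>\<in>\<Gamma>. \<forall>u\<in>U. k \<gamma> \<otimes>\<^bsub>W\<^esub> u \<otimes>\<^bsub>W\<^esub> inv\<^bsub>W\<^esub> (k \<gamma>) \<in> U"
    using invariant_subgroup[OF Q'(1,3)] by blast
  have UB: "U \<subseteq> B" using U(5) W0_B by blast
  have "subgroup U Vb" by (rule W.subgroup_incl[OF U(1) subgroup_B UB])
  moreover have "openin TVb U" using U(2) UB by (auto simp: openin_subtopology)
  moreover have "closedin TVb U" 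
    using compactin_imp_closedin[OF W.Hausdorff U(3)] UB by (auto simp: closedin_subtopology)
  moreover have "\<forall>\<beta>\<in>ad ` \<Gamma>. \<beta> ` U \<subseteq> U" using U(6) UB by (auto simp: ad_apply subset_eq)
  ultimately show "\<exists>U. subgroup U Vb \<and> openin TVb U \<and> closedin TVb U \<and> U \<subseteq> Q \<and> (\<forall>\<beta>\<in>ad ` \<Gamma>. \<beta> ` U \<subseteq> U)"
    using U(4) UB Q'(2) by blast
next
  fix u assume "u \<in> carrier Vb"
  then have u: "u \<in> B" by simp
  obtain K where K: "compactin TW K" "K \<subseteq> B" "\<forall>\<gamma>\<in>\<Gamma>. k \<gamma> \<otimes>\<^bsub>W\<^esub> u \<otimes>\<^bsub>W\<^esub> inv\<^bsub>W\<^esub> (k \<gamma>) \<in> K"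
    using orbit_in_compact[OF u] by blast
  then have "compactin TVb K \<and> (\<forall>\<beta>\<in>ad ` \<Gamma>. \<beta> u \<in> K)"
    using u by (auto simp: compactin_subtopology ad_apply)
  then show "\<exists>K. compactin TVb K \<and> (\<forall>\<beta>\<in>ad ` \<Gamma>. \<beta> u \<in> K)" by blast
qed

end

section \<open>The completed semidirect product\<close>

lemma topological_iso_restrict:
  assumes "topological_iso M T M' T' f" "M0 \<subseteq> carrier M" "topspace T = carrier M" "topspace T' = carrier M'"
    "f ` M0 = M0'"
  shows "topological_iso (M\<lparr>carrier := M0\<rparr>) (subtopology T M0) (M'\<lparr>carrier := M0'\<rparr>) (subtopology T' M0') f"
proof -
  have f: "f \<in> hom M M'" "bij_betw f (carrier M) (carrier M')" "homeomorphic_map T T' f"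
    using assms(1) by (auto simp: topological_iso_def iso_def)
  have inj: "inj_on f (carrier M)" and im: "f ` carrier M = carrier M'" 
    using f(2) by (auto simp: bij_betw_def)
  have M0': "M0' \<subseteq> carrier M'" using assms(2,5) im by blast
  have "f \<in> iso (M\<lparr>carrier := M0\<rparr>) (M'\<lparr>carrier := M0'\<rparr>)"
    using f(1) assms(2,5) inj_on_subset[OF inj assms(2)]
    by (auto simp: iso_def hom_def bij_betw_def subset_eq)
  moreover have "f ` (topspace T \<inter> M0) = topspace T' \<inter> M0'"
  proof -
    have "topspace T \<inter> M0 = M0" "topspace T' \<inter> M0' = M0'"
      using assms(2) M0' unfolding assms(3,4) by blast+
    then show ?thesis using assms(5) by simp
  qed
  then have "homeomorphic_map (subtopology T M0) (subtopology T' M0') f"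
    by (rule homeomorphic_map_subtopologies[OF f(3)])
  ultimately show ?thesis by (simp add: topological_iso_def)
qed

context semidirect_completion
begin

lemma completionD:
  shows top_group_Gt: "top_group Gt TGt" and Hausdorff_Gt: "Hausdorff_space TGt"
    and \<Gamma>t: "subgroup \<Gamma>t Gt" "compactin TGt \<Gamma>t" "openin TGt \<Gamma>t"
    and \<rho>t_hom: "\<rho>t \<in> hom G Gt" and \<rho>t_dense: "TGt closure_of (\<rho>t ` carrier G) = carrier Gt"
    and preimage_\<Gamma>t: "{g \<in> carrier G. \<rho>t g \<in> \<Gamma>t} = \<Gamma>"
  using completion top_groupI[of Gt TGt]
  by (auto simp: is_completion_def locally_compact_group_def)

sublocale Gt: top_group Gt TGt by (rule top_group_Gt)

abbreviation "Am \<equiv> HAut Vb TVb \<times>\<times> Gt"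
abbreviation "TAm \<equiv> prod_topology (HAut_topology Vb TVb) TGt"

sublocale Am: top_group Am TAm
  by (rule top_group_DirProd[OF Vb.HAut_top_group top_group_Gt])

lemma Hausdorff_Am: "Hausdorff_space TAm"
  by (simp add: Hausdorff_space_prod_topology Vb.Hausdorff_HAut Hausdorff_Gt)

definition "\<rho> g = (ad g, \<rho>t g)"

lemma \<rho>_hom: "\<rho> \<in> hom G Am"
  unfolding \<rho>_def hom_paired using ad_hom \<rho>t_hom by simp

sublocale \<rho>: group_hom G Am \<rho>
  by (intro group_hom.intro group_hom_axioms.intro G.is_group Am.is_group \<rho>_hom)

definition "Gb = TAm closure_of (\<rho> ` carrier G)"
definition "\<Gamma>b = TAm closure_of (\<rho> ` \<Gamma>)"
abbreviation "Gbar \<equiv> Am\<lparr>carrier := Gb\<rparr>"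
abbreviation "TGb \<equiv> subtopology TAm Gb"

lemma subgroup_Gb: "subgroup Gb Am"
  unfolding Gb_def by (intro Am.subgroup_closure \<rho>.img_is_subgroup)

lemma Gb_carrier: "b \<in> Gb \<Longrightarrow> fst b \<in> carrier Vb.A \<and> snd b \<in> carrier Gt"
  using subgroup.mem_carrier[OF subgroup_Gb] by (cases b) auto

lemma \<rho>_Gb: "g \<in> carrier G \<Longrightarrow> \<rho> g \<in> Gb"
proof -
  assume g: "g \<in> carrier G"
  have "\<rho> ` carrier G \<subseteq> topspace TAm" unfolding Am.topspace by (rule image_subsetI) (rule \<rho>.hom_closed)
  then show "\<rho> g \<in> Gb" unfolding Gb_def using g by (intro subsetD[OF closure_of_subset]) blast+
qed

lemma \<Gamma>b_Gb: "\<Gamma>b \<subseteq> Gb"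
  unfolding Gb_def \<Gamma>b_def by (rule closure_of_mono) (use \<Gamma>_closed in auto)

text \<open>Both factors on the right are compact, and compactness of \<open>\<Gamma>b\<close> will follow from this inclusion.\<close>

lemma \<Gamma>b_subset: "\<Gamma>b \<subseteq> (Vb.TA closure_of (ad ` \<Gamma>)) \<times> \<Gamma>t"
proof -
  have "closedin TGt \<Gamma>t" by (rule compactin_imp_closedin[OF Hausdorff_Gt \<Gamma>t(2)])
  moreover have "ad ` \<Gamma> \<subseteq> Vb.TA closure_of (ad ` \<Gamma>)"
    by (rule closure_of_subset) (use ad_HAut \<Gamma>_closed in \<open>auto simp: Vb.topspace_HAut\<close>)
  then have "\<rho> ` \<Gamma> \<subseteq> (Vb.TA closure_of (ad ` \<Gamma>)) \<times> \<Gamma>t"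
    using preimage_\<Gamma>t by (auto simp: \<rho>_def)
  ultimately show ?thesis
    unfolding \<Gamma>b_def by (intro closure_of_minimal) (auto simp: closedin_prod_Times_iff)
qed

lemma compact_\<Gamma>b: "compactin TAm \<Gamma>b"
proof (rule closed_compactin[OF _ \<Gamma>b_subset])
  show "compactin TAm ((Vb.TA closure_of (ad ` \<Gamma>)) \<times> \<Gamma>t)"
    using Vb.compactin_closure_S \<Gamma>t(2) by (simp add: compactin_Times)
qed (simp add: \<Gamma>b_def)

text \<open>The set \<open>carrier Vb.A \<times> \<Gamma>t\<close> is open and meets \<open>\<rho>(G)\<close> exactly in \<open>\<rho>(\<Gamma>)\<close>, because \<open>\<Gamma>\<close> is the preimage of
  \<open>\<Gamma>t\<close>. A point of \<open>Gb\<close> in this open set is therefore a limit of points of \<open>\<rho>(\<Gamma>)\<close>. This is what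
  makes \<open>\<Gamma>b\<close> open in \<open>Gb\<close>.\<close>

lemma \<Gamma>b_eq: "\<Gamma>b = (carrier Vb.A \<times> \<Gamma>t) \<inter> Gb"
proof
  show "\<Gamma>b \<subseteq> (carrier Vb.A \<times> \<Gamma>t) \<inter> Gb"
    using \<Gamma>b_subset \<Gamma>b_Gb closure_of_subset_topspace[of Vb.TA "ad ` \<Gamma>"] Vb.topspace_HAut by blast
  have "openin TAm (carrier Vb.A \<times> \<Gamma>t)"
    using \<Gamma>t(3) openin_topspace[of Vb.TA] by (simp add: openin_prod_Times_iff Vb.topspace_HAut)
  from openin_Int_closure_of_subset[OF this, of "\<rho> ` carrier G"]
  have "(carrier Vb.A \<times> \<Gamma>t) \<inter> Gb \<subseteq> TAm closure_of ((carrier Vb.A \<times> \<Gamma>t) \<inter> \<rho> ` carrier G)"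
    unfolding Gb_def .
  also have "\<dots> \<subseteq> \<Gamma>b" unfolding \<Gamma>b_def
    by (rule closure_of_mono) (use preimage_\<Gamma>t in \<open>auto simp: \<rho>_def\<close>)
  finally show "(carrier Vb.A \<times> \<Gamma>t) \<inter> Gb \<subseteq> \<Gamma>b" .
qed

lemma \<rho>_\<Gamma>b_iff: "g \<in> carrier G \<Longrightarrow> \<rho> g \<in> \<Gamma>b \<longleftrightarrow> g \<in> \<Gamma>"
  unfolding \<Gamma>b_eq using \<rho>_Gb[of g] ad_HAut[of g] preimage_\<Gamma>t by (auto simp: \<rho>_def)

lemma openin_\<Gamma>b: "openin TGb \<Gamma>b"
  unfolding \<Gamma>b_eq openin_subtopology
  using \<Gamma>t(3) openin_topspace[of Vb.TA] 
  by (intro exI[of _ "carrier Vb.A \<times> \<Gamma>t"]) (simp add: openin_prod_Times_iff Vb.topspace_HAut)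

sublocale P: semidirect_product Vb Gbar fst
proof (intro semidirect_product.intro semidirect_product_axioms.intro)
  show "group Vb" by (rule Vb.is_group)
  show "group Gbar" by (rule Am.subgroup_imp_group[OF subgroup_Gb])
  show "fst \<in> hom Gbar (AutoGroup Vb)"
  proof (rule homI)
    show "fst x \<in> carrier (AutoGroup Vb)" if "x \<in> carrier Gbar" for x
      using Gb_carrier[of x] that by (simp add: HAut_def AutoGroup_def)
    show "fst (x \<otimes>\<^bsub>Gbar\<^esub> y) = fst x \<otimes>\<^bsub>AutoGroup Vb\<^esub> fst y" for x y
      by (simp add: mult_DirProd' HAut_def)
  qed
qed

abbreviation "TP \<equiv> prod_topology TVb TGb"

sublocale P: top_group P.SP TP
proof (rule P.top_group_SP[OF top_group_Vb Am.top_group_subgroup[OF subgroup_Gb]])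
  have "continuous_map (prod_topology TGb TVb) Vb.TA (\<lambda>p. fst (fst p))"
    using continuous_map_compose[OF continuous_map_into_fulltopology[OF continuous_map_fst] continuous_map_fst]
    by (force simp: o_def)
  then have "continuous_map (prod_topology TGb TVb) TVb (\<lambda>p. case (fst (fst p), snd p) of (\<beta>, u) \<Rightarrow> \<beta> u)"
    using continuous_map_compose[OF continuous_map_pairedI[OF _ continuous_map_snd] Vb.continuous_map_HAut_eval]
    by (simp add: o_def)
  then show "continuous_map (prod_topology TGb TVb) TVb (\<lambda>(g, v). fst g v)"
    by (simp add: case_prod_unfold)
qed

lemma Hausdorff_P: "Hausdorff_space TP"
  by (simp add: Hausdorff_space_prod_topology Vb.Hausdorff Hausdorff_space_subtopology[OF Hausdorff_Am])

definition "\<iota> = (\<lambda>(v, g). (j v, \<rho> g))"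

lemma \<iota>_apply [simp]: "\<iota> (v, g) = (j v, \<rho> g)"
  by (simp add: \<iota>_def)

lemma \<iota>_image: "\<iota> ` (S \<times> H) = \<phi> ` (S \<times> {\<one>\<^bsub>G\<^esub>}) \<times> \<rho> ` H"
  by (auto simp: \<iota>_def)

lemma \<iota>_hom: "\<iota> \<in> hom SP P.SP"
proof (rule homI)
  fix n assume "n \<in> carrier SP"
  then show "\<iota> n \<in> carrier P.SP" by (cases n) (simp add: j_B \<rho>_Gb)
  fix m assume "n \<in> carrier SP" "m \<in> carrier SP"
  then show "\<iota> (n \<otimes>\<^bsub>SP\<^esub> m) = \<iota> n \<otimes>\<^bsub>P.SP\<^esub> \<iota> m"
    by (cases n; cases m) (simp add: j_mult ad_j \<rho>.hom_mult, simp add: \<rho>_def ad_j)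
qed

lemma closure_\<iota>: "S \<subseteq> carrier V \<Longrightarrow> H \<subseteq> carrier G \<Longrightarrow>
   TP closure_of (\<iota> ` (S \<times> H)) = (TW closure_of (\<phi> ` (S \<times> {\<one>\<^bsub>G\<^esub>}))) \<times> (TAm closure_of (\<rho> ` H))"
proof -
  assume S: "S \<subseteq> carrier V" and H: "H \<subseteq> carrier G"
  have "\<phi> ` (S \<times> {\<one>\<^bsub>G\<^esub>}) \<subseteq> B" using j_B S by auto
  moreover have "TW closure_of (\<phi> ` (S \<times> {\<one>\<^bsub>G\<^esub>})) \<subseteq> B" unfolding B_def
    by (rule closure_of_mono) (use S in auto)
  moreover have "\<rho> ` H \<subseteq> Gb" using \<rho>_Gb H by auto
  moreover have "TAm closure_of (\<rho> ` H) \<subseteq> Gb" unfolding Gb_def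
    by (rule closure_of_mono) (use H in auto)
  ultimately show ?thesis
    by (simp add: \<iota>_image closure_of_Times closure_of_subtopology Int_absorb1)
qed

abbreviation "P0 \<equiv> W0 \<times> \<Gamma>b"

lemma closure_\<iota>_P0: "TP closure_of (\<iota> ` (V0 \<times> \<Gamma>)) = P0"
  using closure_\<iota>[of V0 \<Gamma>] V0_closed \<Gamma>_closed by (auto simp: closure_V0 \<Gamma>b_def)

lemma dense_\<iota>: "TP closure_of (\<iota> ` carrier SP) = carrier P.SP"
  using closure_\<iota>[OF subset_refl subset_refl, folded B_def Gb_def] by simp

lemma subgroup_P0: "subgroup P0 P.SP"
proof -
  interpret \<iota>: group_hom SP P.SP \<iota>
    by (intro group_hom.intro group_hom_axioms.intro group_SP P.group_SP \<iota>_hom)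
  show ?thesis
    unfolding closure_\<iota>_P0[symmetric]
    by (intro P.subgroup_closure \<iota>.subgroup_img_is_subgroup subgroup_V0_\<Gamma>)
qed

lemma openin_P0: "openin TP P0"
proof -
  have "openin TVb W0" using W.M0(3) W0_B by (auto simp: openin_subtopology)
  then show ?thesis using openin_\<Gamma>b by (simp add: openin_prod_Times_iff)
qed

lemma compactin_P0: "compactin TP P0"
proof -
  have "compactin TVb W0" "compactin TGb \<Gamma>b"
    using W.M0(2) W0_B compact_\<Gamma>b \<Gamma>b_Gb by (auto simp: compactin_subtopology)
  then show ?thesis by (simp add: compactin_Times)
qed

lemma \<iota>_P0_iff: "n \<in> carrier SP \<Longrightarrow> \<iota> n \<in> P0 \<longleftrightarrow> n \<in> V0 \<times> \<Gamma>"
  by (cases n) (simp add: j_W0_iff \<rho>_\<Gamma>b_iff)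

theorem is_completion_\<iota>: "is_completion SP (V0 \<times> \<Gamma>) P.SP TP P0 \<iota>"
proof -
  have "locally_compact_group P.SP TP"
    using P.topological_group Hausdorff_P
      P.locally_compact[OF openin_P0 compactin_P0 subgroup.one_closed[OF subgroup_P0]]
    by (simp add: locally_compact_group_def)
  moreover have sub: "n \<in> carrier SP" if "n \<in> V0 \<times> \<Gamma>" for n
    by (rule subsetD[OF subgroup.subset[OF subgroup_V0_\<Gamma>] that])
  have image: "\<iota> ` (V0 \<times> \<Gamma>) \<subseteq> P0"
    by (rule image_subsetI) (simp only: \<iota>_P0_iff[OF sub])
  moreover have "subtopology TP P0 closure_of (\<iota> ` (V0 \<times> \<Gamma>)) = P0"
    unfolding closure_of_subtopology Int_absorb1[OF image] closure_\<iota>_P0 by (rule Int_absorb)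
  moreover have "{n \<in> carrier SP. \<iota> n \<in> P0} = V0 \<times> \<Gamma>"
  proof (rule Set.set_eqI)
    show "n \<in> {n \<in> carrier SP. \<iota> n \<in> P0} \<longleftrightarrow> n \<in> V0 \<times> \<Gamma>" for n
      using \<iota>_P0_iff[of n] sub[of n] unfolding mem_Collect_eq by argo
  qed
  ultimately show ?thesis
    unfolding is_completion_def
    by (intro conjI subgroup_P0 openin_P0 compactin_P0 \<iota>_hom dense_\<iota>)
qed

text \<open>The condition on finite sets says that a finite intersection of subgroups \<open>g(V0)\<close> is contained
  in \<open>v V0 v\<^sup>-\<^sup>1\<close>. The corresponding intersection of open subgroups \<open>g(W0)\<close> is the closure of its dense part in the
  image of the semidirect product, so it is contained in \<open>v W0 v\<^sup>-\<^sup>1\<close> as well. Hence a point that all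
  of \<open>G\<close> moves into \<open>W0\<close> lies in every conjugate of \<open>W0\<close>.\<close>

lemma conjugates_by_G_trivial:
  assumes core: "\<forall>v\<in>carrier V. \<exists>F. finite F \<and> F \<noteq> {} \<and> F \<subseteq> carrier G \<and>
            (\<Inter>g\<in>F. \<alpha> g ` V0) \<subseteq> conjugate V v V0"
    and u: "u \<in> B" and all: "\<And>g. g \<in> carrier G \<Longrightarrow> ad g u \<in> W0"
  shows "u = \<one>\<^bsub>W\<^esub>"
proof -
  have W0c: "W0 \<subseteq> carrier W" by (rule subgroup.subset[OF W.M0(1)])
  have separated: "y \<in> conjugate W (j v) W0"
    if v: "v \<in> carrier V" and y: "y \<in> B" "\<And>g. g \<in> carrier G \<Longrightarrow> ad g y \<in> W0" for v y
  proof -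
    obtain F where F: "finite F" "F \<noteq> {}" "F \<subseteq> carrier G" "(\<Inter>g\<in>F. \<alpha> g ` V0) \<subseteq> conjugate V v V0"
      using bspec[OF core v] by (elim exE conjE)
    let ?O = "\<Inter>g\<in>F. conjugate W (k g) W0"
    have "openin TW ?O"
      using F W.clopen_conjugate(1) by (intro openin_Inter) auto
    then have "?O \<inter> TW closure_of (\<phi> ` carrier SP) \<subseteq> TW closure_of (?O \<inter> \<phi> ` carrier SP)"
      by (rule openin_Int_closure_of_subset)
    moreover have "TW closure_of (?O \<inter> \<phi> ` carrier SP) \<subseteq> conjugate W (j v) W0"
    proof (rule closure_of_minimal[OF _ W.clopen_conjugate(2)])
      show "?O \<inter> \<phi> ` carrier SP \<subseteq> conjugate W (j v) W0"
      proof
        fix z assume z: "z \<in> ?O \<inter> \<phi> ` carrier SP"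
        then obtain x h where n: "x \<in> carrier V" "h \<in> carrier G" "z = \<phi> (x, h)" by auto
        \<comment> \<open>A single \<open>g \<in> F\<close> already forces \<open>z\<close> into the image of \<open>V\<close>; this is where \<open>F \<noteq> {}\<close> enters.\<close>
        have conj: "h = \<one>\<^bsub>G\<^esub> \<and> x \<in> \<alpha> g ` V0" if g: "g \<in> F" for g
        proof -
          have gc: "g \<in> carrier G" using g F(3) by blast
          have "\<phi> (x, h) \<in> conjugate W (\<phi> (\<one>\<^bsub>V\<^esub>, g)) W0" using z g n(3) by blast
          then have "inv\<^bsub>SP\<^esub> (\<one>\<^bsub>V\<^esub>, g) \<otimes>\<^bsub>SP\<^esub> (x, h) \<otimes>\<^bsub>SP\<^esub> (\<one>\<^bsub>V\<^esub>, g) \<in> V0 \<times> {\<one>\<^bsub>G\<^esub>}"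
            using W.\<phi>_conjugate_iff[of "(x, h)" "(\<one>\<^bsub>V\<^esub>, g)"] gc n unfolding preimage_W0 by simp
          then have *: "\<alpha> (inv\<^bsub>G\<^esub> g) x \<in> V0" "inv\<^bsub>G\<^esub> g \<otimes>\<^bsub>G\<^esub> h \<otimes>\<^bsub>G\<^esub> g = \<one>\<^bsub>G\<^esub>"
            unfolding conj_by_right_factor[OF n(1,2) gc] by auto
          have "h = g \<otimes>\<^bsub>G\<^esub> (inv\<^bsub>G\<^esub> g \<otimes>\<^bsub>G\<^esub> h \<otimes>\<^bsub>G\<^esub> g) \<otimes>\<^bsub>G\<^esub> inv\<^bsub>G\<^esub> g"
            using gc n(2) by (simp add: G.m_assoc)
          then have "h = \<one>\<^bsub>G\<^esub>" using *(2) gc by simp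
          moreover have "x = \<alpha> g (\<alpha> (inv\<^bsub>G\<^esub> g) x)" using gc n(1) by simp
          ultimately show ?thesis using *(1) by blast
        qed
        then have h: "h = \<one>\<^bsub>G\<^esub>" and "x \<in> (\<Inter>g\<in>F. \<alpha> g ` V0)" using F(2) by blast+
        then have "x \<in> conjugate V v V0" using F(4) by blast
        then have "inv\<^bsub>V\<^esub> v \<otimes>\<^bsub>V\<^esub> x \<otimes>\<^bsub>V\<^esub> v \<in> V0"
          using V.mem_conjugate_iff[OF v subgroup.subset[OF V0]] by simp
        then have "j (inv\<^bsub>V\<^esub> v \<otimes>\<^bsub>V\<^esub> x \<otimes>\<^bsub>V\<^esub> v) \<in> W0" using j_W0_iff V0_closed by blast
        then show "z \<in> conjugate W (j v) W0"
          using W.mem_conjugate_iff[OF _ W0c, of "j v" z] v n h by (simp add: j_mult j_inv)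
      qed
    qed (use v in simp)
    moreover have "y \<in> ?O"
    proof
      fix g assume g: "g \<in> F"
      have gc: "g \<in> carrier G" using g F(3) by blast
      show "y \<in> conjugate W (k g) W0"
        using W.mem_conjugate_iff[OF _ W0c, of "k g" y] y(2)[of "inv\<^bsub>G\<^esub> g"] gc B_closed[OF y(1)]
        by (simp add: ad_apply y(1) k_inv)
    qed
    ultimately show ?thesis using B_closed[OF y(1)] W.dense by blast
  qed
  have "u \<in> conjugate W x W0" if x: "x \<in> \<phi> ` carrier SP" for x
  proof -
    obtain v g where n: "v \<in> carrier V" "g \<in> carrier G" "x = \<phi> (v, g)" using x by auto
    have uc: "u \<in> carrier W" by (rule B_closed[OF u])
    let ?v = "\<alpha> (inv\<^bsub>G\<^esub> g) v"
    have v': "?v \<in> carrier V" using n by simp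
    have "ad (inv\<^bsub>G\<^esub> g) u \<in> conjugate W (j ?v) W0"
    proof (rule separated[OF v'])
      show "ad (inv\<^bsub>G\<^esub> g) u \<in> B" by (rule ad_B[OF _ u]) (use n in simp)
      show "ad h (ad (inv\<^bsub>G\<^esub> g) u) \<in> W0" if "h \<in> carrier G" for h
        using all[of "h \<otimes>\<^bsub>G\<^esub> inv\<^bsub>G\<^esub> g"] ad_comp[of h "inv\<^bsub>G\<^esub> g" u] that n u by simp
    qed
    then have "k (inv\<^bsub>G\<^esub> g) \<otimes>\<^bsub>W\<^esub> u \<otimes>\<^bsub>W\<^esub> inv\<^bsub>W\<^esub> (k (inv\<^bsub>G\<^esub> g)) \<in> conjugate W (j ?v) W0"
      using ad_apply[OF u] by simp
    then have "u \<in> conjugate W (k g) (conjugate W (j ?v) W0)"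
      using W.mem_conjugate_iff[of "k g" "conjugate W (j ?v) W0" u] n v' uc
        subgroup.subset[OF W.subgroup_conjugate[OF _ W.M0(1)], of "j ?v"] by (simp add: k_inv)
    also have "\<dots> = conjugate W (k g \<otimes>\<^bsub>W\<^esub> j ?v) W0"
      by (rule W.conjugate_mult[OF _ _ W0c]) (use n v' in simp_all)
    also have "k g \<otimes>\<^bsub>W\<^esub> j ?v = x"
      using \<phi>_mult[of "(\<one>\<^bsub>V\<^esub>, g)" "(?v, \<one>\<^bsub>G\<^esub>)"] n v' by simp
    finally show ?thesis .
  qed
  then show ?thesis
    using W.reduced_pair_dense[OF W.M0(1,3) W.dense W.reduced] by blast
qed

text \<open>Write \<open>z = (u, b)\<close> for an element of all conjugates of \<open>P0\<close>. Conjugating \<open>z\<close> by the elements of \<open>G\<close> shows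
  that \<open>u\<close> satisfies the hypothesis of \<open>conjugates_by_G_trivial\<close> and that the second component of
  \<open>b\<close> lies in all conjugates of \<open>\<Gamma>t\<close>. Conjugating by \<open>v \<in> V\<close> first replaces \<open>u\<close> by \<open>v\<^sup>-\<^sup>1 u b(v)\<close>,
  which must then be trivial too.\<close>

lemma reduced_P:
  assumes core: "\<forall>v\<in>carrier V. \<exists>F. finite F \<and> F \<noteq> {} \<and> F \<subseteq> carrier G \<and>
            (\<Inter>g\<in>F. \<alpha> g ` V0) \<subseteq> conjugate V v V0"
    and red: "reduced_pair Gt \<Gamma>t"
  shows "reduced_pair P.SP P0"
proof -
  have core_trivial: "z = \<one>\<^bsub>P.SP\<^esub>" if z: "\<And>x. x \<in> carrier P.SP \<Longrightarrow> z \<in> conjugate P.SP x P0" for z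
  proof -
    have P0c: "P0 \<subseteq> carrier P.SP" by (rule subgroup.subset[OF subgroup_P0])
    have zP: "inv\<^bsub>P.SP\<^esub> x \<otimes>\<^bsub>P.SP\<^esub> z \<otimes>\<^bsub>P.SP\<^esub> x \<in> P0" if "x \<in> carrier P.SP" for x
      using P.mem_conjugate_iff[OF that P0c] z[OF that] by blast
    have "z \<in> carrier P.SP"
      using z[OF P.one_closed] P.mem_conjugate_iff[OF P.one_closed P0c] by blast
    then obtain u b where ub: "z = (u, b)" "u \<in> B" "b \<in> Gb" by auto
    have bc: "fst b \<in> carrier Vb.A" "snd b \<in> carrier Gt" using Gb_carrier[OF ub(3)] by auto
    \<comment> \<open>Conjugation first by \<open>x\<close>, with result \<open>(u', b)\<close>, and then by \<open>(\<one>, \<rho> g)\<close>; below \<open>x\<close> is either the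
      identity or an element of \<open>V\<close>.\<close>
    have shift: "ad (inv\<^bsub>G\<^esub> g) u' \<in> W0 \<and> inv\<^bsub>Gt\<^esub> (\<rho>t g) \<otimes>\<^bsub>Gt\<^esub> snd b \<otimes>\<^bsub>Gt\<^esub> \<rho>t g \<in> \<Gamma>t"
      if g: "g \<in> carrier G" and u': "u' \<in> B"
        and x: "x \<in> carrier P.SP" "inv\<^bsub>P.SP\<^esub> x \<otimes>\<^bsub>P.SP\<^esub> z \<otimes>\<^bsub>P.SP\<^esub> x = (u', b)" for g x u'
    proof -
      have r: "(\<one>\<^bsub>W\<^esub>, \<rho> g) \<in> carrier P.SP"
        using \<rho>_Gb[OF g] subgroup.one_closed[OF subgroup_B] by simp
      have zc: "z \<in> carrier P.SP" using ub by simp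
      have "inv\<^bsub>P.SP\<^esub> (x \<otimes>\<^bsub>P.SP\<^esub> (\<one>\<^bsub>W\<^esub>, \<rho> g)) \<otimes>\<^bsub>P.SP\<^esub> z \<otimes>\<^bsub>P.SP\<^esub> (x \<otimes>\<^bsub>P.SP\<^esub> (\<one>\<^bsub>W\<^esub>, \<rho> g))
        = inv\<^bsub>P.SP\<^esub> (\<one>\<^bsub>W\<^esub>, \<rho> g) \<otimes>\<^bsub>P.SP\<^esub> (inv\<^bsub>P.SP\<^esub> x \<otimes>\<^bsub>P.SP\<^esub> z \<otimes>\<^bsub>P.SP\<^esub> x) \<otimes>\<^bsub>P.SP\<^esub> (\<one>\<^bsub>W\<^esub>, \<rho> g)"
        using x(1) r zc P.inv_closed[OF x(1)] P.inv_closed[OF r]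
        by (simp add: P.inv_mult_group P.m_assoc del: P.carrier_SP P.mult_SP P.inv_SP)
      also have "\<dots> = (fst (inv\<^bsub>Gbar\<^esub> (\<rho> g)) u', inv\<^bsub>Gbar\<^esub> (\<rho> g) \<otimes>\<^bsub>Gbar\<^esub> b \<otimes>\<^bsub>Gbar\<^esub> \<rho> g)"
        unfolding x(2) using P.conj_by_right_factor[of u' b "\<rho> g"] u' ub(3) \<rho>_Gb[OF g] by simp
      finally have "(fst (inv\<^bsub>Gbar\<^esub> (\<rho> g)) u', inv\<^bsub>Gbar\<^esub> (\<rho> g) \<otimes>\<^bsub>Gbar\<^esub> b \<otimes>\<^bsub>Gbar\<^esub> \<rho> g) \<in> P0"
        using zP[OF P.m_closed[OF x(1) r]] by simp
      moreover have "inv\<^bsub>Gbar\<^esub> (\<rho> g) = \<rho> (inv\<^bsub>G\<^esub> g)"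
        using Am.m_inv_consistent[OF subgroup_Gb \<rho>_Gb[OF g]] \<rho>.hom_inv[OF g] by simp
      ultimately have *: "fst (\<rho> (inv\<^bsub>G\<^esub> g)) u' \<in> W0" "\<rho> (inv\<^bsub>G\<^esub> g) \<otimes>\<^bsub>Am\<^esub> b \<otimes>\<^bsub>Am\<^esub> \<rho> g \<in> \<Gamma>b"
        by auto
      then have "snd (\<rho> (inv\<^bsub>G\<^esub> g) \<otimes>\<^bsub>Am\<^esub> b \<otimes>\<^bsub>Am\<^esub> \<rho> g) \<in> \<Gamma>t" unfolding \<Gamma>b_eq by auto
      moreover have "\<rho>t (inv\<^bsub>G\<^esub> g) = inv\<^bsub>Gt\<^esub> (\<rho>t g)"
        using group_hom.hom_inv[OF group_hom.intro[OF G.is_group Gt.is_group group_hom_axioms.intro[OF \<rho>t_hom]] g] .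
      ultimately show ?thesis using *(1) by (simp add: \<rho>_def mult_DirProd')
    qed
    have ad_all: "ad g u' \<in> W0" 
      if "g \<in> carrier G" "u' \<in> B" "x \<in> carrier P.SP" "inv\<^bsub>P.SP\<^esub> x \<otimes>\<^bsub>P.SP\<^esub> z \<otimes>\<^bsub>P.SP\<^esub> x = (u', b)" for g u' x
      using shift[OF G.inv_closed[OF that(1)] that(2-4)] that(1) by simp
    have triv: "u' = \<one>\<^bsub>W\<^esub>" if "u' \<in> B" "x \<in> carrier P.SP" "inv\<^bsub>P.SP\<^esub> x \<otimes>\<^bsub>P.SP\<^esub> z \<otimes>\<^bsub>P.SP\<^esub> x = (u', b)" for u' x
      by (rule conjugates_by_G_trivial[OF core that(1) ad_all[OF _ that]])
    have z1: "inv\<^bsub>P.SP\<^esub> \<one>\<^bsub>P.SP\<^esub> \<otimes>\<^bsub>P.SP\<^esub> z \<otimes>\<^bsub>P.SP\<^esub> \<one>\<^bsub>P.SP\<^esub> = (u, b)"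
      using \<open>z \<in> carrier P.SP\<close> ub(1) by (simp del: P.carrier_SP P.one_SP P.mult_SP P.inv_SP)
    have u1: "u = \<one>\<^bsub>W\<^esub>" by (rule triv[OF ub(2) P.one_closed z1])
    have "snd b \<in> (\<Inter>x\<in>\<rho>t ` carrier G. conjugate Gt x \<Gamma>t)"
    proof
      fix x assume "x \<in> \<rho>t ` carrier G"
      then obtain g where g: "g \<in> carrier G" "x = \<rho>t g" by blast
      have "\<rho>t g \<in> carrier Gt" using \<rho>t_hom g by (auto simp: hom_def)
      then show "snd b \<in> conjugate Gt x \<Gamma>t"
        using Gt.mem_conjugate_iff[OF _ subgroup.subset[OF \<Gamma>t(1)], of "\<rho>t g" "snd b"] 
          shift[OF g(1) ub(2) P.one_closed z1] bc g(2) by simp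
    qed
    then have b2: "snd b = \<one>\<^bsub>Gt\<^esub>"
      using Gt.reduced_pair_dense[OF \<Gamma>t(1,3) \<rho>t_dense red] by blast
    have fixed: "fst b (j v) = j v" if v: "v \<in> carrier V" for v
    proof -
      have jB: "j v \<in> B" by (rule j_B[OF v])
      have bB: "fst b (j v) \<in> B" using Vb.HAut_closed[OF bc(1)] jB by simp
      have "(j v, \<one>\<^bsub>Gbar\<^esub>) \<in> carrier P.SP" using jB subgroup.one_closed[OF subgroup_Gb] by simp
      moreover have "inv\<^bsub>P.SP\<^esub> (j v, \<one>\<^bsub>Gbar\<^esub>) \<otimes>\<^bsub>P.SP\<^esub> z \<otimes>\<^bsub>P.SP\<^esub> (j v, \<one>\<^bsub>Gbar\<^esub>) 
          = (inv\<^bsub>Vb\<^esub> (j v) \<otimes>\<^bsub>Vb\<^esub> u \<otimes>\<^bsub>Vb\<^esub> fst b (j v), b)"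
        unfolding ub(1) using P.conj_by_left_factor[of u b "j v"] ub jB by simp
      moreover have "inv\<^bsub>Vb\<^esub> (j v) \<otimes>\<^bsub>Vb\<^esub> u \<otimes>\<^bsub>Vb\<^esub> fst b (j v) \<in> B"
        using Vb.m_closed Vb.inv_closed jB bB ub(2) by auto
      ultimately have "inv\<^bsub>Vb\<^esub> (j v) \<otimes>\<^bsub>Vb\<^esub> u \<otimes>\<^bsub>Vb\<^esub> fst b (j v) = \<one>\<^bsub>W\<^esub>"
        using triv by blast
      then have "inv\<^bsub>W\<^esub> (j v) \<otimes>\<^bsub>W\<^esub> fst b (j v) = \<one>\<^bsub>W\<^esub>"
        using W.m_inv_consistent[OF subgroup_B jB] u1 v by simp
      then have "j v \<otimes>\<^bsub>W\<^esub> (inv\<^bsub>W\<^esub> (j v) \<otimes>\<^bsub>W\<^esub> fst b (j v)) = j v" using v by simp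
      then show ?thesis using v B_closed[OF bB] by simp
    qed
    have b1: "fst b = \<one>\<^bsub>Vb.A\<^esub>"
    proof (rule Vb.HAut_eqI[OF bc(1)])
      show "\<one>\<^bsub>Vb.A\<^esub> \<in> carrier Vb.A" by (rule monoid.one_closed[OF group.is_monoid[OF Vb.group_HAut]])
      fix y assume "y \<in> carrier Vb"
      then have y: "y \<in> B" by simp
      have "y \<in> TVb closure_of (\<phi> ` (carrier V \<times> {\<one>\<^bsub>G\<^esub>}))"
        using y j_B unfolding closure_of_subtopology by (simp add: Int_absorb1 image_subset_iff flip: B_def)
      then have "fst b y = y"
        by (rule forall_in_closure_of_eq[OF _ Vb.Hausdorff 
              homeomorphic_imp_continuous_map[OF Vb.HAut_homeomorphic[OF bc(1)]] continuous_map_id[unfolded id_def]])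
           (use fixed in auto)
      then show "fst b y = \<one>\<^bsub>Vb.A\<^esub> y" using y by simp
    qed
    show ?thesis
      using ub(1) u1 b1 b2 by (simp add: prod_eq_iff del: HAut_one)
  qed
  show ?thesis
    unfolding reduced_pair_def
  proof (intro equalityI subsetI)
    fix z assume "z \<in> (\<Inter>x\<in>carrier P.SP. conjugate P.SP x P0)"
    then have "z = \<one>\<^bsub>P.SP\<^esub>" by (intro core_trivial) (rule INT_D)
    then show "z \<in> {\<one>\<^bsub>P.SP\<^esub>}" by (simp only: singleton_iff)
  next
    fix z assume "z \<in> {\<one>\<^bsub>P.SP\<^esub>}"
    then have z: "z = \<one>\<^bsub>P.SP\<^esub>" by (rule singletonD)
    show "z \<in> (\<Inter>x\<in>carrier P.SP. conjugate P.SP x P0)"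
      unfolding z by (intro INT_I subgroup.one_closed[OF P.subgroup_conjugate[OF _ subgroup_P0]])
  qed
qed

theorem \<iota>_schlichting:
  assumes core: "\<forall>v\<in>carrier V. \<exists>F. finite F \<and> F \<noteq> {} \<and> F \<subseteq> carrier G \<and>
            (\<Inter>g\<in>F. \<alpha> g ` V0) \<subseteq> conjugate V v V0"
    and red: "reduced_pair Gt \<Gamma>t"
    and X: "is_schlichting_completion SP (V0 \<times> \<Gamma>) X TX X0 \<psi>"
  shows "\<exists>\<Phi>. (\<forall>n\<in>carrier SP. \<Phi> (\<psi> n) = \<iota> n) \<and> topological_iso X TX P.SP TP \<Phi> \<and> \<Phi> ` X0 = P0 \<and>
           topological_iso (X\<lparr>carrier := X0\<rparr>) (subtopology TX X0) (P.SP\<lparr>carrier := P0\<rparr>) (subtopology TP P0) \<Phi>"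
proof -
  have rX: "reduced_completion SP X TX X0 \<psi>" 
    by (rule is_schlichting_completion_reduced[OF group_SP X])
  interpret X: reduced_completion SP X TX X0 \<psi> by (rule rX)
  have rP: "reduced_completion SP P.SP TP P0 \<iota>"
    by (intro reduced_completion.intro reduced_completion_axioms.intro P.top_group_axioms group_SP Hausdorff_P 
        subgroup_P0 compactin_P0 openin_P0 reduced_P[OF core red] \<iota>_hom dense_\<iota>)
  have "{n \<in> carrier SP. \<psi> n \<in> X0} = {n \<in> carrier SP. \<iota> n \<in> P0}"
    using X is_completion_\<iota> by (simp add: is_schlichting_completion_def is_completion_def)
  then obtain \<Phi> where f: "topological_iso X TX P.SP TP \<Phi>" "\<Phi> ` X0 = P0" "\<forall>n\<in>carrier SP. \<Phi> (\<psi> n) = \<iota> n"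
    using reduced_completion_unique[OF rX rP] by blast
  then show ?thesis
    using topological_iso_restrict[OF f(1) subgroup.subset[OF X.M0(1)] X.topspace P.topspace f(2)] by blast
qed

end

theorem theorem2p9:
  fixes V :: "'v monoid" and V0 :: "'v set"
    and G :: "'g monoid" and \<Gamma> :: "'g set"
    and \<alpha> :: "'g \<Rightarrow> 'v \<Rightarrow> 'v"
    and W :: "'w monoid" and TW :: "'w topology" and W0 :: "'w set"
    and \<phi> :: "'v \<times> 'g \<Rightarrow> 'w"
    and Gt :: "'t monoid" and TGt :: "'t topology" and \<Gamma>t :: "'t set"
    and \<rho>t :: "'g \<Rightarrow> 't"
    and X :: "'x monoid" and TX :: "'x topology" and X0 :: "'x set"
    and \<psi> :: "'v \<times> 'g \<Rightarrow> 'x"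
  assumes "group V" and "group G"
    and "\<alpha> \<in> hom G (AutoGroup V)"
    and "subgroup V0 V" and "subgroup \<Gamma> G"
    and "\<forall>\<gamma>\<in>\<Gamma>. \<alpha> \<gamma> ` V0 \<subseteq> V0"
    and "hecke_pair (semidirect V G \<alpha>) (V0 \<times> \<Gamma>)"
    and "reduced_pair (semidirect V G \<alpha>) (V0 \<times> \<Gamma>)"
    and "is_schlichting_completion (semidirect V G \<alpha>) (V0 \<times> {\<one>\<^bsub>G\<^esub>}) W TW W0 \<phi>"
    and "is_completion G \<Gamma> Gt TGt \<Gamma>t \<rho>t"
  shows
    "let Vb = W\<lparr>carrier := TW closure_of (\<phi> ` (carrier V \<times> {\<one>\<^bsub>G\<^esub>}))\<rparr>;
         TVb = subtopology TW (carrier Vb);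
         V0b = TW closure_of (\<phi> ` (V0 \<times> {\<one>\<^bsub>G\<^esub>}));
         A = HAut Vb TVb \<times>\<times> Gt;
         TA = prod_topology (HAut_topology Vb TVb) TGt;
         \<rho> = (\<lambda>g. (Ad W (carrier Vb) (\<phi> (\<one>\<^bsub>V\<^esub>, g)), \<rho>t g));
         Gb = A\<lparr>carrier := TA closure_of (\<rho> ` carrier G)\<rparr>;
         \<Gamma>b = TA closure_of (\<rho> ` \<Gamma>);
         P = semidirect Vb Gb fst;
         TP = prod_topology TVb (subtopology TA (carrier Gb));
         P0 = V0b \<times> \<Gamma>b;
         \<iota> = (\<lambda>(v, g). (\<phi> (v, \<one>\<^bsub>G\<^esub>), \<rho> g))
     in
       (\<rho> \<in> hom G A \<and>
        is_completion (semidirect V G \<alpha>) (V0 \<times> \<Gamma>) P TP P0 \<iota>) \<and>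
       (is_schlichting_completion (semidirect V G \<alpha>) (V0 \<times> \<Gamma>) X TX X0 \<psi> \<and>
        is_schlichting_completion G \<Gamma> Gt TGt \<Gamma>t \<rho>t \<and>
        (\<forall>v\<in>carrier V. \<exists>F. finite F \<and> F \<noteq> {} \<and> F \<subseteq> carrier G \<and>
            (\<Inter>g\<in>F. \<alpha> g ` V0) \<subseteq> conjugate V v V0)
        \<longrightarrow> (\<exists>\<Phi>. (\<forall>n\<in>carrier (semidirect V G \<alpha>). \<Phi> (\<psi> n) = \<iota> n) \<and>
              topological_iso X TX P TP \<Phi> \<and>
              \<Phi> ` X0 = P0 \<and>
              topological_iso (X\<lparr>carrier := X0\<rparr>) (subtopology TX X0)
                (P\<lparr>carrier := P0\<rparr>) (subtopology TP P0) \<Phi>))"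
proof -
  interpret C: semidirect_completion V G \<alpha> V0 \<Gamma> W TW W0 \<phi> Gt TGt \<Gamma>t \<rho>t
    by (intro semidirect_completion.intro semidirect_completion_axioms.intro semidirect_product.intro
        semidirect_product_axioms.intro assms)
  have \<rho>: "(\<lambda>g. (Ad W C.B (\<phi> (\<one>\<^bsub>V\<^esub>, g)), \<rho>t g)) = C.\<rho>"
    by (simp add: fun_eq_iff C.\<rho>_def C.ad_def)
  have \<iota>: "(\<lambda>(v, g). (\<phi> (v, \<one>\<^bsub>G\<^esub>), Ad W C.B (\<phi> (\<one>\<^bsub>V\<^esub>, g)), \<rho>t g)) = C.\<iota>"
    by (simp add: fun_eq_iff C.\<iota>_def C.\<rho>_def C.ad_def)
  have carrier: "carrier C.Vb = C.B" "carrier C.Gbar = C.Gb" by simp_all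
  have red: "reduced_pair Gt \<Gamma>t" if "is_schlichting_completion G \<Gamma> Gt TGt \<Gamma>t \<rho>t"
    using that by (simp add: is_schlichting_completion_def)
  show ?thesis
    unfolding Let_def C.B_def[symmetric] C.closure_V0 carrier \<iota> \<rho> C.Gb_def[symmetric] C.\<Gamma>b_def[symmetric]
    by (intro conjI impI C.\<rho>_hom C.is_completion_\<iota>)
       (elim conjE, rule C.\<iota>_schlichting[OF _ red], assumption+)
qed

end
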